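(* Let $r \geq 1$ be an integer and let $m \in \mathbb{R}_{>0}$. If the set \[ P := \{ (x,y) : x + y \leq 1 \} \cap \mathbb{R}^2_{\geq 0} \] contains asymptotically $(m^r)$-non-special systems of dimension $\geq 0$, then the divisor \[ H - m \sum_{j=1}^r E_j \] is nef on $X$, where $X$ is the blow-up of $\mathbb{P}^2 = \mathbb{CP}^2$ in $r$ very general points, $H$ is the pullback to $X$ of a line in $\mathbb{P}^2$, and $E_1, \ldots, E_r$ are the exceptional divisors on $X$.
   Context: Here $\mathbb{N}$ includes $0$, and $(m^r)$ denotes the $r$-tuple $(m, \ldots, m)$. Linear systems: for a finite set $D \subset \mathbb{N}^2$ and $m_1, \ldots, m_r \in \mathbb{N}$, $\mathcal{L}_D(m_1, \ldots, m_r)$ denotes the projective space of (curve equations given by) nonzero polynomials $\sum_{(\alpha,\beta) \in D} c_{\alpha,\beta} x^\alpha y^\beta$, $c_{\alpha,\beta} \in \mathbb{C}$, up to scalars, which vanish with multiplicity at least $m_i$ at $p_i$ for $i = 1, \ldots, r$, where $p_1, \ldots, p_r$ are general points of the plane. Dimension means projective dimension, and the empty system has dimension $-1$. The expected dimension is $\max\left(-1,\ \#D - 1 - \sum_{i=1}^r \frac{m_i(m_i+1)}{2}\right)$. The system is non-special if its dimension equals its expected dimension. Asymptotic systems: let $m_1, \ldots, m_r \in \mathbb{R}_{>0}$. A subset $P \subset \mathbb{R}^2_{\geq 0}$ contains asymptotically $(m_1, \ldots, m_r)$-non-special systems of dimension $\geq d$ iff for all $\delta > 0$ and all sufficiently large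 integers $k$ there exist $m_1^{(k)}, \ldots, m_r^{(k)} \in \mathbb{N}$ and a finite set $D_k \subset (k \cdot P) \cap \mathbb{N}^2$ such that (i) $\mathcal{L}_{D_k}(m_1^{(k)}, \ldots, m_r^{(k)})$ is non-special of dimension $\geq d$, and (ii) $\left| \frac{m_i^{(k)} - k m_i}{k m_i} \right| < \delta$ for $i = 1, \ldots, r$. A divisor with real coefficients is nef if its intersection number with every irreducible curve on $X$ is $\geq 0$. "Very general" means outside a countable union of proper closed subvarieties of the space of $r$-tuples of points. *)

theory Defs
  imports "HOL-Analysis.Analysis" "HOL-Library.Function_Algebras"
begin

subsection \<open>Polynomial functions\<close>

text \<open>Over the complex numbers polynomials and polynomial functions are the same thing. The set
  \<open>polys X\<close> is the algebra of functions generated by the coordinate functions in \<open>X\<close>.\<close>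

inductive_set polys :: "('a \<Rightarrow> complex) set \<Rightarrow> ('a \<Rightarrow> complex) set" for X where
  const: "(\<lambda>_. c) \<in> polys X"
| coord: "f \<in> X \<Longrightarrow> f \<in> polys X"
| add: "f \<in> polys X \<Longrightarrow> g \<in> polys X \<Longrightarrow> (\<lambda>v. f v + g v) \<in> polys X"
| mult: "f \<in> polys X \<Longrightarrow> g \<in> polys X \<Longrightarrow> (\<lambda>v. f v * g v) \<in> polys X"

text \<open>Complex-valued functions as a complex vector space.\<close>

global_interpretation cfun: vector_space "\<lambda>(c::complex) (f :: 'a \<Rightarrow> complex) x. c * f x"
  by unfold_locales (auto simp: fun_eq_iff algebra_simps)

subsection \<open>Linear systems of plane curves\<close>

definition plane_poly :: "(nat \<times> nat) set \<Rightarrow> (nat \<times> nat \<Rightarrow> complex) \<Rightarrow> complex \<Rightarrow> complex \<Rightarrow> complex" where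
  "plane_poly D c x y = (\<Sum>(\<alpha>, \<beta>)\<in>D. c (\<alpha>, \<beta>) * x ^ \<alpha> * y ^ \<beta>)"

text \<open>Vanishing with multiplicity at least \<open>m\<close>: all partial derivatives of order less than \<open>m\<close>
  vanish at the point.\<close>

definition vanishes_to :: "(complex \<Rightarrow> complex \<Rightarrow> complex) \<Rightarrow> nat \<Rightarrow> complex \<times> complex \<Rightarrow> bool" where
  "vanishes_to f m P \<longleftrightarrow>
     (\<forall>s t. s + t < m \<longrightarrow> (deriv ^^ s) (\<lambda>x. (deriv ^^ t) (f x) (snd P)) (fst P) = 0)"

text \<open>The vector space whose projectivisation is the linear system with points \<open>p 1, \<dots>, p r\<close>;
  a polynomial with exponents in \<open>D\<close> is given by its coefficients.\<close>

definition linear_system ::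
  "nat \<Rightarrow> (nat \<times> nat) set \<Rightarrow> (nat \<Rightarrow> nat) \<Rightarrow> (nat \<Rightarrow> complex \<times> complex) \<Rightarrow> (nat \<times> nat \<Rightarrow> complex) set" where
  "linear_system r D m p =
     {c. (\<forall>z. z \<notin> D \<longrightarrow> c z = 0) \<and> (\<forall>i\<in>{1..r}. vanishes_to (plane_poly D c) (m i) (p i))}"

definition system_dim ::
  "nat \<Rightarrow> (nat \<times> nat) set \<Rightarrow> (nat \<Rightarrow> nat) \<Rightarrow> (nat \<Rightarrow> complex \<times> complex) \<Rightarrow> int" where
  "system_dim r D m p = int (cfun.dim (linear_system r D m p)) - 1"

definition expected_dim :: "nat \<Rightarrow> (nat \<times> nat) set \<Rightarrow> (nat \<Rightarrow> nat) \<Rightarrow> int" where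
  "expected_dim r D m = max (- 1) (int (card D) - 1 - (\<Sum>i=1..r. int (m i * (m i + 1) div 2)))"

text \<open>A property holds for general points \<open>p 1, \<dots>, p r\<close> of the affine plane if it holds outside
  the zero set of some nonzero polynomial in the coordinates of the points. (Every proper Zariski
  closed subset is contained in such a zero set.)\<close>

definition general_points :: "nat \<Rightarrow> ((nat \<Rightarrow> complex \<times> complex) \<Rightarrow> bool) \<Rightarrow> bool" where
  "general_points r Q \<longleftrightarrow>
     (\<exists>F \<in> polys ({\<lambda>p. fst (p i) | i. i \<in> {1..r}} \<union> {\<lambda>p. snd (p i) | i. i \<in> {1..r}}).
        (\<exists>p. F p \<noteq> 0) \<and> (\<forall>p. F p \<noteq> 0 \<longrightarrow> Q p))"

definition nonspecial_dim_ge :: "nat \<Rightarrow> (nat \<times> nat) set \<Rightarrow> (nat \<Rightarrow> nat) \<Rightarrow> int \<Rightarrow> bool" where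
  "nonspecial_dim_ge r D m d \<longleftrightarrow>
     general_points r (\<lambda>p. system_dim r D m p = expected_dim r D m \<and> d \<le> system_dim r D m p)"

definition contains_asymptotically ::
  "(real \<times> real) set \<Rightarrow> nat \<Rightarrow> (nat \<Rightarrow> real) \<Rightarrow> int \<Rightarrow> bool" where
  "contains_asymptotically P r m d \<longleftrightarrow>
     (\<forall>\<delta>>0. \<exists>k0::nat. \<forall>k\<ge>k0. \<exists>(mk :: nat \<Rightarrow> nat) (D :: (nat \<times> nat) set).
        finite D \<and>
        (\<lambda>(\<alpha>, \<beta>). (real \<alpha>, real \<beta>)) ` D \<subseteq> (\<lambda>x. real k *\<^sub>R x) ` P \<and>
        nonspecial_dim_ge r D mk d \<and>
        (\<forall>i\<in>{1..r}. \<bar>(real (mk i) - real k * m i) / (real k * m i)\<bar> < \<delta>))"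

subsection \<open>Products of projective planes\<close>

text \<open>Points of the projective plane are the one-dimensional subspaces of the space of complex
  triples. A point of the product of copies of the plane indexed by \<open>I\<close> is a function in
  \<open>PiE I (\<lambda>_. P2)\<close>. A tuple \<open>v\<close> of vectors with \<open>v i \<in> q i\<close> for all \<open>i \<in> I\<close> consists of
  homogeneous coordinates of \<open>q\<close>, except that some \<open>v i\<close> may be zero; allowing this is harmless in
  what follows, as a multihomogeneous form either has degree \<open>0\<close> in the coordinates with index
  \<open>i\<close> or vanishes when they are all zero.\<close>

type_synonym point = "(complex ^ 3) set"
type_synonym coords = "nat \<Rightarrow> complex ^ 3"

definition P2 :: "point set" where
  "P2 = {vec.span {v} | v. v \<noteq> 0}"

definition P2s :: "nat set \<Rightarrow> (nat \<Rightarrow> point) set" where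
  "P2s I = PiE I (\<lambda>_. P2)"

definition reps :: "nat set \<Rightarrow> (nat \<Rightarrow> point) \<Rightarrow> coords set" where
  "reps I q = {v. \<forall>i\<in>I. v i \<in> q i}"

text \<open>Multihomogeneous forms of multidegree \<open>d\<close>.\<close>

definition forms :: "nat set \<Rightarrow> (nat \<Rightarrow> nat) \<Rightarrow> (coords \<Rightarrow> complex) set" where
  "forms I d = {F \<in> polys {\<lambda>v. v i $ k | i k. i \<in> I}.
     \<forall>(t :: nat \<Rightarrow> complex) v. F (\<lambda>i. t i *s v i) = (\<Prod>i\<in>I. t i ^ d i) * F v}"

definition vanishes_at :: "nat set \<Rightarrow> (coords \<Rightarrow> complex) \<Rightarrow> (nat \<Rightarrow> point) \<Rightarrow> bool" where
  "vanishes_at I F q \<longleftrightarrow> (\<forall>v \<in> reps I q. F v = 0)"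

definition zariski_closed :: "nat set \<Rightarrow> (nat \<Rightarrow> point) set \<Rightarrow> bool" where
  "zariski_closed I Z \<longleftrightarrow>
     (\<exists>S \<subseteq> (\<Union>d. forms I d). Z = {q \<in> P2s I. \<forall>F\<in>S. vanishes_at I F q})"

definition zariski_irreducible :: "nat set \<Rightarrow> (nat \<Rightarrow> point) set \<Rightarrow> bool" where
  "zariski_irreducible I Z \<longleftrightarrow> zariski_closed I Z \<and> Z \<noteq> {} \<and>
     (\<forall>A B. zariski_closed I A \<longrightarrow> zariski_closed I B \<longrightarrow> Z \<subseteq> A \<union> B \<longrightarrow> Z \<subseteq> A \<or> Z \<subseteq> B)"

text \<open>Irreducible closed subsets of Krull dimension one: there are chains of irreducible closed
  subsets of length one, but not of length two, that end in the given set.\<close>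

definition irreducible_curve :: "nat set \<Rightarrow> (nat \<Rightarrow> point) set \<Rightarrow> bool" where
  "irreducible_curve I C \<longleftrightarrow> zariski_irreducible I C \<and>
     (\<exists>Z. zariski_irreducible I Z \<and> Z \<subset> C) \<and>
     \<not> (\<exists>Z Z'. zariski_irreducible I Z \<and> zariski_irreducible I Z' \<and> Z \<subset> Z' \<and> Z' \<subset> C)"

definition very_general_points :: "nat \<Rightarrow> ((nat \<Rightarrow> point) \<Rightarrow> bool) \<Rightarrow> bool" where
  "very_general_points r Q \<longleftrightarrow>
     (\<exists>\<Z>. countable \<Z> \<and> (\<forall>Z\<in>\<Z>. zariski_closed {1..r} Z \<and> Z \<subset> P2s {1..r}) \<and>
          (\<forall>p \<in> P2s {1..r} - \<Union>\<Z>. Q p))"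

subsection \<open>The blow-up of the projective plane\<close>

text \<open>A line in the plane is given by the span of its coefficient vector, a point of the dual
  plane.\<close>

definition on_line :: "point \<Rightarrow> point \<Rightarrow> bool" where
  "on_line x l \<longleftrightarrow> (\<forall>v\<in>x. \<forall>a\<in>l. (\<Sum>k\<in>UNIV. a $ k * v $ k) = 0)"

text \<open>The blow-up of the plane in pairwise distinct points \<open>p 1, \<dots>, p r\<close>, as a closed
  subvariety of the product of the plane with \<open>r\<close> copies of its dual: the component with index
  \<open>0\<close> is the image point in the plane, and the component with index \<open>j \<ge> 1\<close> is a line through
  \<open>p j\<close> and the image point. The lines through \<open>p j\<close> form a projective line, so that for
  \<open>r = 1\<close> this is the usual incidence variety in the product of the plane and a projective line;
  for larger \<open>r\<close> it is the fibre product of these varieties over the plane.\<close>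

definition blowup :: "nat \<Rightarrow> (nat \<Rightarrow> point) \<Rightarrow> (nat \<Rightarrow> point) set" where
  "blowup r p = {q \<in> P2s {0..r}. \<forall>j\<in>{1..r}. on_line (p j) (q j) \<and> on_line (q 0) (q j)}"

text \<open>Set-theoretic preimage of the line \<open>l\<close>.\<close>

definition line_preimage :: "nat \<Rightarrow> (nat \<Rightarrow> point) \<Rightarrow> point \<Rightarrow> (nat \<Rightarrow> point) set" where
  "line_preimage r p l = {q \<in> blowup r p. on_line (q 0) l}"

definition exceptional_curve :: "nat \<Rightarrow> (nat \<Rightarrow> point) \<Rightarrow> nat \<Rightarrow> (nat \<Rightarrow> point) set" where
  "exceptional_curve r p j = {q \<in> blowup r p. q 0 = p j}"

text \<open>The strict transform of a line \<open>l\<close> which contains \<open>p j\<close>, but no other \<open>p i\<close>.\<close>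

definition strict_line :: "nat \<Rightarrow> (nat \<Rightarrow> point) \<Rightarrow> nat \<Rightarrow> point \<Rightarrow> (nat \<Rightarrow> point) set" where
  "strict_line r p j l = {q \<in> blowup r p. q j = l}"

subsection \<open>Intersection numbers and nef divisors\<close>

text \<open>Functions which are regular at the point \<open>P\<close>, that is, quotients of two forms of equal
  multidegree on a Zariski open neighbourhood of \<open>P\<close>. The values outside of this neighbourhood are
  irrelevant: the local ring at \<open>P\<close> is the quotient of \<open>regular_at r p P\<close> by the functions that
  vanish in a neighbourhood of \<open>P\<close>, and these lie in \<open>local_ideal r p C P\<close> for every \<open>C\<close>.\<close>

definition regular_at ::
  "nat \<Rightarrow> (nat \<Rightarrow> point) \<Rightarrow> (nat \<Rightarrow> point) \<Rightarrow> ((nat \<Rightarrow> point) \<Rightarrow> complex) set" where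
  "regular_at r p P = {\<phi>. \<exists>d. \<exists>F\<in>forms {0..r} d. \<exists>G\<in>forms {0..r} d. \<not> vanishes_at {0..r} G P \<and>
     (\<forall>q\<in>blowup r p. \<forall>v\<in>reps {0..r} q. G v \<noteq> 0 \<longrightarrow> \<phi> q = F v / G v)}"

text \<open>The ideal at \<open>P\<close> of the closed subset \<open>C\<close> with its reduced structure.\<close>

definition local_ideal ::
  "nat \<Rightarrow> (nat \<Rightarrow> point) \<Rightarrow> (nat \<Rightarrow> point) set \<Rightarrow> (nat \<Rightarrow> point) \<Rightarrow> ((nat \<Rightarrow> point) \<Rightarrow> complex) set" where
  "local_ideal r p C P = {\<phi> \<in> regular_at r p P. \<exists>d. \<exists>G\<in>forms {0..r} d. \<not> vanishes_at {0..r} G P \<and>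
     (\<forall>q\<in>C. \<not> vanishes_at {0..r} G q \<longrightarrow> \<phi> q = 0)}"

text \<open>Dimension of the quotient of \<open>V\<close> by a subspace \<open>W\<close> of finite codimension: the size of a
  family in \<open>V\<close> that induces a basis of the quotient.\<close>

definition quot_dim :: "('a \<Rightarrow> complex) set \<Rightarrow> ('a \<Rightarrow> complex) set \<Rightarrow> nat" where
  "quot_dim V W = (THE n. \<exists>B \<subseteq> V. finite B \<and> card B = n \<and> cfun.independent B \<and>
     cfun.span B \<inter> W = {0} \<and> V \<subseteq> cfun.span (B \<union> W))"

text \<open>The intersection number of two distinct irreducible curves, as the sum of the local
  intersection multiplicities, i.e. of the dimensions of the quotients of the local rings by the sum
  of the ideals of the two curves.\<close>

definition curve_int :: "nat \<Rightarrow> (nat \<Rightarrow> point) \<Rightarrow> (nat \<Rightarrow> point) set \<Rightarrow> (nat \<Rightarrow> point) set \<Rightarrow> nat" where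
  "curve_int r p C C' = (\<Sum>P \<in> C \<inter> C'. quot_dim (regular_at r p P)
     {\<lambda>q. \<phi> q + \<psi> q | \<phi> \<psi>. \<phi> \<in> local_ideal r p C P \<and> \<psi> \<in> local_ideal r p C' P})"

text \<open>Intersection number of the pullback of a line with an irreducible curve. As it depends only
  on the linear equivalence class, the line may be chosen: one which avoids the points that are
  blown up, so that its pullback is an irreducible curve, and whose pullback is not \<open>C\<close>.\<close>

definition line_dot :: "nat \<Rightarrow> (nat \<Rightarrow> point) \<Rightarrow> (nat \<Rightarrow> point) set \<Rightarrow> int" where
  "line_dot r p C = (let l = (SOME l. l \<in> P2 \<and> (\<forall>i\<in>{1..r}. \<not> on_line (p i) l) \<and>
       line_preimage r p l \<noteq> C)
     in int (curve_int r p (line_preimage r p l) C))"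

text \<open>Intersection number of the \<open>j\<close>-th exceptional curve with an irreducible curve. For the
  self-intersection the divisor has to be moved: if \<open>l\<close> is a line through \<open>p j\<close> but no other
  \<open>p i\<close>, then the pullback of \<open>l\<close> is the sum of its strict transform and the exceptional curve,
  so the latter is linearly equivalent to the pullback of a line minus the strict transform.\<close>

definition exceptional_dot :: "nat \<Rightarrow> (nat \<Rightarrow> point) \<Rightarrow> nat \<Rightarrow> (nat \<Rightarrow> point) set \<Rightarrow> int" where
  "exceptional_dot r p j C =
     (if C \<noteq> exceptional_curve r p j then int (curve_int r p (exceptional_curve r p j) C)
      else let l = (SOME l. l \<in> P2 \<and> on_line (p j) l \<and> (\<forall>i\<in>{1..r} - {j}. \<not> on_line (p i) l))
           in line_dot r p C - int (curve_int r p (strict_line r p j l) C))"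

text \<open>Up to linear equivalence, every divisor with real coefficients on the blow-up is a
  combination of the pullback \<open>H\<close> of a line and the exceptional curves \<open>E j\<close>. It is given by
  the coefficient \<open>D 0\<close> of \<open>H\<close> and the coefficients \<open>D j\<close> of \<open>E j\<close> for \<open>1 \<le> j \<le> r\<close>.\<close>

type_synonym real_divisor = "nat \<Rightarrow> real"

definition H_div :: real_divisor where
  "H_div = (\<lambda>i. if i = 0 then 1 else 0)"

definition E_div :: "nat \<Rightarrow> real_divisor" where
  "E_div j = (\<lambda>i. if i = j then 1 else 0)"

definition divisor_dot :: "nat \<Rightarrow> (nat \<Rightarrow> point) \<Rightarrow> real_divisor \<Rightarrow> (nat \<Rightarrow> point) set \<Rightarrow> real" where
  "divisor_dot r p D C =
     D 0 * of_int (line_dot r p C) + (\<Sum>j=1..r. D j * of_int (exceptional_dot r p j C))"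

definition nef :: "nat \<Rightarrow> (nat \<Rightarrow> point) \<Rightarrow> real_divisor \<Rightarrow> bool" where
  "nef r p D \<longleftrightarrow>
     (\<forall>C. C \<subseteq> blowup r p \<and> irreducible_curve {0..r} C \<longrightarrow> 0 \<le> divisor_dot r p D C)"

end

theory Submission
  imports Defs "HOL-Computational_Algebra.Fundamental_Theorem_Algebra"
begin

text \<open>Let \<open>C\<close> be an irreducible curve on the blow-up other than the exceptional curves, and put
  \<open>d = H \<cdot> C\<close> and \<open>e\<^sub>j = E\<^sub>j \<cdot> C\<close>. Modulo the forms that vanish on the image of \<open>C\<close>, the space of ternary
  forms of degree \<open>k\<close> has dimension at most \<open>k d\<close> plus a constant. A non-special nonempty system
  imposes independent conditions, so for all \<open>j\<close>, all \<open>n < m\<^sub>j\<close> and every binary form of degree \<open>n\<close> there is a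
  form of degree \<open>k\<close> which vanishes to order \<open>m\<^sub>i\<close> at the other points \<open>p\<^sub>i\<close> and to order \<open>n\<close> at \<open>p\<^sub>j\<close>, with
  the given leading form there. If a form vanishes on the image of \<open>C\<close>, then its leading form at \<open>p\<^sub>j\<close>
  vanishes on the scheme \<open>E\<^sub>j \<inter> C\<close>, which has length \<open>e\<^sub>j\<close>. Choosing for \<open>n \<ge> e\<^sub>j\<close> leading forms which
  are independent on that scheme yields \<open>\<Sum> (m\<^sub>j - e\<^sub>j) e\<^sub>j\<close> forms that are independent modulo those
  vanishing on \<open>C\<close>. Hence \<open>\<Sum> (m\<^sub>j - e\<^sub>j) e\<^sub>j \<le> k d\<close> up to a constant, and dividing by \<open>k\<close> and passing to the
  limit gives \<open>m \<Sum> e\<^sub>j \<le> d\<close>.\<close>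

subsection \<open>Linear algebra modulo a subspace\<close>

text \<open>Intersection numbers are made computable by parametrisations. The pullback of a line and
  an exceptional curve are both images of an affine line t -> a + t b together with one point at
  infinity, and that point can be placed off C. The forms that vanish on C then restrict to an ideal
  of C[t]. The orders of the zeros of its generator h are the local intersection multiplicities, so
  the intersection number is deg h. For a line this means that, from some degree on, each new degree
  needs only deg h new generators modulo the ideal of the image of C. For E_j it means that a
  leading form whose restriction is a polynomial of degree below e_j, and which belongs to a curve
  through the image of C, restricts to 0. The curves C = E_j are treated apart, since their image is
  a point: there H.C = 0 and no E_i.C is positive. The points have to be very general because every
  k and every tolerance 1/(N+1) excludes a closed set of its own, while the limit needs all large k
  at the same points.\<close>

lemma (in vector_space) inj_on_of_independent_mod:
  assumes W: "subspace W" and X: "finite X"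
    and ind: "\<And>y. (\<Sum>x\<in>X. scale (y x) (f x)) \<in> W \<Longrightarrow> \<forall>x\<in>X. y x = 0"
  shows "inj_on f X"
proof (rule inj_onI, rule ccontr)
  fix x x' assume x: "x \<in> X" "x' \<in> X" "f x = f x'" "x \<noteq> x'"
  define y where "y z = (if z = x then 1 else if z = x' then - 1 else (0::'a))" for z
  have "(\<Sum>z\<in>X. scale (y z) (f z)) = (\<Sum>z\<in>{x, x'}. scale (y z) (f z))"
    by (rule sum.mono_neutral_right) (use X x in \<open>auto simp: y_def\<close>)
  also have "\<dots> = 0"
    using x by (simp add: y_def)
  finally have "\<forall>z\<in>X. y z = 0"
    using ind subspace_0[OF W] by simp
  then have "y x = 0"
    using x by blast
  then show False
    by (simp add: y_def)
qed

text \<open>A linear relation among the \<open>f x\<close> and \<open>W0\<close> puts the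
  combination of the \<open>f x\<close> into \<open>W\<close>. Its coefficients are then 0, and what
  is left is a relation inside \<open>W0\<close>.\<close>

lemma (in vector_space) independent_image_of_independent_mod:
  assumes W: "subspace W" and X: "finite X"
    and ind: "\<And>y. (\<Sum>x\<in>X. scale (y x) (f x)) \<in> W \<Longrightarrow> \<forall>x\<in>X. y x = 0"
    and W0: "finite W0" "W0 \<subseteq> W" "independent W0"
  shows "f ` X \<inter> W0 = {}" "independent (f ` X \<union> W0)"
proof -
  have inj: "inj_on f X"
    using inj_on_of_independent_mod[OF W X ind] by blast
  show disj: "f ` X \<inter> W0 = {}"
  proof (rule ccontr)
    assume "f ` X \<inter> W0 \<noteq> {}"
    then obtain x where x: "x \<in> X" "f x \<in> W"
      using W0 by auto
    have "(\<Sum>z\<in>X. scale (if z = x then 1 else 0) (f z)) = (\<Sum>z\<in>{x}. scale (if z = x then 1 else 0) (f z))"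
      by (rule sum.mono_neutral_right) (use X x in auto)
    then have "(\<Sum>z\<in>X. scale (if z = x then 1 else 0) (f z)) \<in> W"
      using x by simp
    from ind[OF this] show False
      using x by auto
  qed
  show "independent (f ` X \<union> W0)"
  proof
    assume "dependent (f ` X \<union> W0)"
    then obtain u v where uv: "v \<in> f ` X \<union> W0" "u v \<noteq> 0" "(\<Sum>v\<in>f ` X \<union> W0. scale (u v) v) = 0"
      using dependent_finite[of "f ` X \<union> W0"] X W0 by auto
    have eq: "(\<Sum>x\<in>X. scale (u (f x)) (f x)) + (\<Sum>v\<in>W0. scale (u v) v) = 0"
      using uv(3) X W0 disj by (simp add: sum.union_disjoint sum.reindex[OF inj] o_def)
    have mem: "(\<Sum>v\<in>W0. scale (u v) v) \<in> W"
      using W0 by (intro subspace_sum[OF W] subspace_scale[OF W]) auto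
    have "(\<Sum>x\<in>X. scale (u (f x)) (f x)) = - (\<Sum>v\<in>W0. scale (u v) v)"
      using eq by (simp only: eq_neg_iff_add_eq_0)
    then have "(\<Sum>x\<in>X. scale (u (f x)) (f x)) \<in> W"
      using subspace_neg[OF W mem] by simp
    then have 0: "\<forall>x\<in>X. u (f x) = 0"
      by (rule ind)
    then have "(\<Sum>v\<in>W0. scale (u v) v) = 0"
      using eq by simp
    then have "\<forall>v\<in>W0. u v = 0"
      using independentD[OF W0(3,1)] by blast
    with 0 uv show False
      by auto
  qed
qed

lemma (in vector_space) card_le_of_independent_mod:
  assumes W: "subspace W" and X: "finite X" and B: "finite B"
    and f: "\<And>x. x \<in> X \<Longrightarrow> f x \<in> span (B \<union> W)"
    and ind: "\<And>y. (\<Sum>x\<in>X. scale (y x) (f x)) \<in> W \<Longrightarrow> \<forall>x\<in>X. y x = 0"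
  shows "card X \<le> card B"
proof -
  have "\<forall>x\<in>X. \<exists>S. finite S \<and> S \<subseteq> W \<and> f x \<in> span (B \<union> S)"
  proof
    fix x assume "x \<in> X"
    then obtain S r where S: "finite S" "S \<subseteq> B \<union> W" "f x = (\<Sum>a\<in>S. scale (r a) a)"
      using f unfolding span_explicit by blast
    have "f x \<in> span S"
      unfolding S(3) by (intro span_sum span_scale span_base)
    then have "f x \<in> span (B \<union> (S \<inter> W))"
      using S(2) span_mono[of S "B \<union> (S \<inter> W)"] by blast
    then show "\<exists>S. finite S \<and> S \<subseteq> W \<and> f x \<in> span (B \<union> S)"
      using S by blast
  qed
  then obtain S where S: "\<forall>x\<in>X. finite (S x) \<and> S x \<subseteq> W \<and> f x \<in> span (B \<union> S x)"
    by metis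
  define W1 where "W1 = (\<Union>x\<in>X. S x)"
  have W1: "finite W1" "W1 \<subseteq> W"
    using S X by (auto simp: W1_def)
  obtain W0 where W0: "W0 \<subseteq> W1" "independent W0" "W1 \<subseteq> span W0"
    using maximal_independent_subset by blast
  have W0': "finite W0" "W0 \<subseteq> W"
    using W0 W1 finite_subset by auto
  have sub: "f ` X \<union> W0 \<subseteq> span (B \<union> W0)"
  proof
    fix z assume "z \<in> f ` X \<union> W0"
    then consider x where "x \<in> X" "z = f x" | "z \<in> W0"
      by blast
    then show "z \<in> span (B \<union> W0)"
    proof cases
      case 1
      have "B \<union> S x \<subseteq> span (B \<union> W0)"
        using 1 W0(3) span_mono[of W0 "B \<union> W0"] span_superset[of "B \<union> W0"] by (auto simp: W1_def)
      then have "span (B \<union> S x) \<subseteq> span (B \<union> W0)"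
        by (simp add: span_minimal)
      then show ?thesis
        using S 1 by blast
    qed (simp add: span_base)
  qed
  have disj: "f ` X \<inter> W0 = {}" and indep: "independent (f ` X \<union> W0)"
    using independent_image_of_independent_mod[OF W X _ W0'(1,2) W0(2), where f = f] ind by blast+
  have "card (f ` X \<union> W0) \<le> card (B \<union> W0)"
    using independent_span_bound[OF _ indep sub] B W0' by blast
  then have "card (f ` X) + card W0 \<le> card B + card W0"
    using card_Un_disjoint[OF _ W0'(1) disj] X card_Un_le[of B W0] by simp
  then show ?thesis
    using card_image[OF inj_on_of_independent_mod[OF W X ind]] by simp
qed

lemma quot_dim_eq:
  fixes f :: "'i \<Rightarrow> 'a \<Rightarrow> complex"
  assumes W: "cfun.subspace W" and X: "finite X" and fV: "f ` X \<subseteq> V"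
    and ind: "\<And>y. (\<Sum>x\<in>X. (\<lambda>v. y x * f x v)) \<in> W \<Longrightarrow> \<forall>x\<in>X. y x = 0"
    and V: "V \<subseteq> cfun.span (f ` X \<union> W)"
  shows "quot_dim V W = card X"
  unfolding quot_dim_def
proof (rule the_equality)
  have inj: "inj_on f X"
    using cfun.inj_on_of_independent_mod[OF W X ind] by blast
  have indep: "cfun.independent (f ` X)"
    using cfun.independent_image_of_independent_mod(2)[OF W X ind, where f = f and ?W0.0 = "{}"] cfun.independent_empty by simp
  have "z = 0" if z: "z \<in> cfun.span (f ` X)" "z \<in> W" for z
  proof -
    obtain u where u: "z = (\<Sum>a\<in>f ` X. (\<lambda>v. u a * a v))"
      using z X cfun.span_finite[of "f ` X"] by auto
    have eq: "z = (\<Sum>x\<in>X. (\<lambda>v. u (f x) * f x v))"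
      unfolding u by (simp add: sum.reindex[OF inj])
    have "\<forall>x\<in>X. u (f x) = 0"
      using ind[of "\<lambda>x. u (f x)"] z(2) eq by simp
    then show "z = 0"
      unfolding eq by (intro sum.neutral) (auto simp: fun_eq_iff)
  qed
  then have int: "cfun.span (f ` X) \<inter> W = {0}"
    using cfun.span_zero cfun.subspace_0[OF W] by blast
  show "\<exists>B\<subseteq>V. finite B \<and> card B = card X \<and> cfun.independent B \<and> cfun.span B \<inter> W = {0} \<and>
      V \<subseteq> cfun.span (B \<union> W)"
    using X fV V inj indep int card_image by (intro exI[of _ "f ` X"]) auto
next
  fix n assume "\<exists>B\<subseteq>V. finite B \<and> card B = n \<and> cfun.independent B \<and> cfun.span B \<inter> W = {0} \<and>
      V \<subseteq> cfun.span (B \<union> W)"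
  then obtain B where B: "B \<subseteq> V" "finite B" "card B = n" "cfun.independent B" "cfun.span B \<inter> W = {0}"
      "V \<subseteq> cfun.span (B \<union> W)"
    by blast
  have indB: "\<forall>x\<in>B. y x = 0" if y: "(\<Sum>x\<in>B. (\<lambda>v. y x * x v)) \<in> W" for y
  proof -
    have "(\<Sum>x\<in>B. (\<lambda>v. y x * x v)) \<in> cfun.span B"
      by (intro cfun.span_sum cfun.span_scale cfun.span_base)
    then have "(\<Sum>x\<in>B. (\<lambda>v. y x * x v)) = 0"
      using B(5) y by blast
    then show ?thesis
      using cfun.independentD[OF B(4,2)] by blast
  qed
  have "card B \<le> card (f ` X)"
    by (rule cfun.card_le_of_independent_mod[OF W B(2), of _ "\<lambda>x. x"]) (use X V B indB in auto)
  moreover have "card (f ` X) \<le> card X"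
    using X by (rule card_image_le)
  moreover have "card X \<le> card B"
    by (rule cfun.card_le_of_independent_mod[OF W X B(2), of f]) (use fV B ind in auto)
  ultimately show "n = card X"
    using B by simp
qed

section \<open>Finite families of linear functionals: codimension of the common kernel and
  surjectivity\<close>

lemma (in vector_space) dim_le_Suc_dim_kernel:
  assumes U: "subspace U" "U \<subseteq> span E" "finite E"
    and l: "\<And>x y. l (x + y) = l x + l y" "\<And>c x. l (scale c x) = c * l x"
  shows "dim U \<le> dim {u \<in> U. l u = 0} + 1"
proof -
  obtain B where B: "B \<subseteq> {u \<in> U. l u = 0}" "independent B" "{u \<in> U. l u = 0} \<subseteq> span B"
      "card B = dim {u \<in> U. l u = 0}"
    using basis_exists by blast
  have fin: "finite B"
    using independent_span_bound[OF U(3) B(2)] B(1) U(2) by blast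
  show ?thesis
  proof (cases "\<forall>u\<in>U. l u = 0")
    case True
    then have "{u \<in> U. l u = 0} = U"
      by blast
    then show ?thesis
      by simp
  next
    case False
    then obtain u0 where u0: "u0 \<in> U" "l u0 \<noteq> 0"
      by blast
    have "U \<subseteq> span (insert u0 B)"
    proof
      fix u assume u: "u \<in> U"
      \<comment> \<open>Subtracting the multiple of \<open>u0\<close> with the same value under
        \<open>l\<close> moves \<open>u\<close> into the kernel.\<close>
      define w where "w = u + scale (- (l u / l u0)) u0"
      have "w \<in> U" "l w = 0"
        using u u0 U(1) subspace_add subspace_scale by (simp_all add: w_def l del: scale_minus_left)
      then have "w \<in> span (insert u0 B)"
        using B(3) span_mono[of B "insert u0 B"] by blast
      moreover have "u = w + scale (l u / l u0) u0"
        by (simp add: w_def)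
      ultimately show "u \<in> span (insert u0 B)"
        by (metis span_add span_scale span_base insertI1)
    qed
    then have "dim U \<le> card (insert u0 B)"
      using fin by (intro dim_le_card) auto
    also have "\<dots> \<le> card B + 1"
      using fin by (simp add: card_insert_if)
    finally show ?thesis
      using B(4) by simp
  qed
qed

lemma (in vector_space) dim_le_dim_kernel_plus_card:
  assumes S: "finite S" and U: "subspace U" "U \<subseteq> span E" "finite E"
    and l: "\<And>s x y. l s (x + y) = l s x + l s y" "\<And>s c x. l s (scale c x) = c * l s x"
  shows "dim U \<le> dim {u \<in> U. \<forall>s\<in>S. l s u = 0} + card S"
  using S
proof induction
  case (insert s S)
  have l0: "l s 0 = 0" for s
    using l(2)[of s 0 0] by simp
  have "subspace {u \<in> U. \<forall>s\<in>S. l s u = 0}"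
    using U(1) l l0 unfolding subspace_def by simp
  from dim_le_Suc_dim_kernel[OF this _ U(3), of "l s"]
  have "dim {u \<in> U. \<forall>s\<in>S. l s u = 0} \<le> dim {u \<in> {u \<in> U. \<forall>s\<in>S. l s u = 0}. l s u = 0} + 1"
    using U(2) l by blast
  moreover have "{u \<in> {u \<in> U. \<forall>s\<in>S. l s u = 0}. l s u = 0} = {u \<in> U. \<forall>s\<in>insert s S. l s u = 0}"
    by blast
  ultimately show ?case
    using insert by simp
qed simp

text \<open>If the common kernel has full codimension \<open>card S\<close>, omitting one functional
  must enlarge it: otherwise \<open>card S - 1\<close> conditions would already lower the dimension
  by \<open>card S\<close>. So every functional has a dual vector on which the others vanish, and
  combinations of the dual vectors take any prescribed values.\<close>

lemma (in vector_space) functionals_surjective: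
  assumes S: "finite S" and U: "subspace U" "U \<subseteq> span E" "finite E"
    and l: "\<And>s x y. l s (x + y) = l s x + l s y" "\<And>s c x. l s (scale c x) = c * l s x"
    and dim: "dim {u \<in> U. \<forall>s\<in>S. l s u = 0} + card S \<le> dim U"
  shows "\<exists>u\<in>U. \<forall>s\<in>S. l s u = b s"
proof -
  have l0: "l s 0 = 0" for s
    using l(2)[of s 0 0] by simp
  have "\<exists>u\<in>U. (\<forall>s\<in>S. s \<noteq> s0 \<longrightarrow> l s u = 0) \<and> l s0 u = 1" if s0: "s0 \<in> S" for s0
  proof -
    have "\<exists>u\<in>U. (\<forall>s\<in>S - {s0}. l s u = 0) \<and> l s0 u \<noteq> 0"
    proof (rule ccontr)
      assume "\<not> ?thesis"
      then have eq: "{u \<in> U. \<forall>s\<in>S. l s u = 0} = {u \<in> U. \<forall>s\<in>S - {s0}. l s u = 0}"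
        by blast
      have "dim U \<le> dim {u \<in> U. \<forall>s\<in>S - {s0}. l s u = 0} + card (S - {s0})"
        using dim_le_dim_kernel_plus_card[where l = l and S = "S - {s0}", OF _ U l] S by simp
      then show False
        using dim s0 S card_gt_0_iff[of S] unfolding eq by (auto simp: card_Diff_singleton)
    qed
    then obtain u where u: "u \<in> U" "\<forall>s\<in>S - {s0}. l s u = 0" "l s0 u \<noteq> 0"
      by blast
    then show ?thesis
      using U(1) subspace_scale by (intro bexI[of _ "scale (1 / l s0 u) u"]) (auto simp: l)
  qed
  then obtain u where u: "\<And>s0. s0 \<in> S \<Longrightarrow> u s0 \<in> U \<and> (\<forall>s\<in>S. s \<noteq> s0 \<longrightarrow> l s (u s0) = 0) \<and> l s0 (u s0) = 1"
    by metis
  define w where "w = (\<Sum>s0\<in>S. scale (b s0) (u s0))"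
  have lsum: "l s (\<Sum>x\<in>A. g x) = (\<Sum>x\<in>A. l s (g x))" for s A and g :: "'c \<Rightarrow> 'b"
    by (induction A rule: infinite_finite_induct) (auto simp: l l0)
  have "l s w = b s" if s: "s \<in> S" for s
  proof -
    have "l s w = (\<Sum>s0\<in>S. b s0 * l s (u s0))"
      by (simp add: w_def lsum l)
    also have "\<dots> = (\<Sum>s0\<in>S. if s0 = s then b s else 0)"
      using u s by (intro sum.cong) auto
    finally show ?thesis
      using s S by simp
  qed
  moreover have "w \<in> U"
    unfolding w_def using u U(1) by (intro subspace_sum subspace_scale) auto
  ultimately show ?thesis
    by blast
qed

lemma dim_supported_functions:
  fixes D :: "'a set"
  assumes D: "finite D"
  shows "cfun.subspace {c :: 'a \<Rightarrow> complex. \<forall>z. z \<notin> D \<longrightarrow> c z = 0}"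
    and "\<exists>E. finite E \<and> {c :: 'a \<Rightarrow> complex. \<forall>z. z \<notin> D \<longrightarrow> c z = 0} \<subseteq> cfun.span E"
    and "cfun.dim {c :: 'a \<Rightarrow> complex. \<forall>z. z \<notin> D \<longrightarrow> c z = 0} = card D"
proof -
  let ?U = "{c :: 'a \<Rightarrow> complex. \<forall>z. z \<notin> D \<longrightarrow> c z = 0}"
  define e :: "'a \<Rightarrow> 'a \<Rightarrow> complex" where "e d z = (if z = d then 1 else 0)" for d z
  show "cfun.subspace ?U"
    by (auto simp: cfun.subspace_def)
  have sum_e: "(\<Sum>d\<in>D. (\<lambda>v. c d * e d v)) z = (if z \<in> D then c z else 0)" for c z
  proof -
    have "(\<Sum>d\<in>D. (\<lambda>v. c d * e d v)) z = (\<Sum>d\<in>D. c d * e d z)"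
      using D by (induction D rule: finite_induct) auto
    also have "\<dots> = (\<Sum>d\<in>D. if d = z then c z else 0)"
      by (intro sum.cong) (auto simp: e_def)
    finally show ?thesis
      using D by simp
  qed
  have span: "?U \<subseteq> cfun.span (e ` D)"
  proof
    fix c assume c: "c \<in> ?U"
    have "c = (\<Sum>d\<in>D. (\<lambda>v. c d * e d v))"
    proof
      fix z show "c z = (\<Sum>d\<in>D. (\<lambda>v. c d * e d v)) z"
        using c by (simp only: sum_e) auto
    qed
    also have "\<dots> \<in> cfun.span (e ` D)"
      by (intro cfun.span_sum cfun.span_scale cfun.span_base) auto
    finally show "c \<in> cfun.span (e ` D)" .
  qed
  then show "\<exists>E. finite E \<and> ?U \<subseteq> cfun.span E"
    using D by blast
  have ind: "\<forall>d\<in>D. y d = 0" if "(\<Sum>d\<in>D. (\<lambda>v. y d * e d v)) \<in> {0}" for y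
  proof
    fix d assume "d \<in> D"
    have "(\<Sum>d\<in>D. (\<lambda>v. y d * e d v)) d = 0"
      using that by simp
    then show "y d = 0"
      using \<open>d \<in> D\<close> by (simp only: sum_e if_True)
  qed
  have "cfun.independent (e ` D)"
    using cfun.independent_image_of_independent_mod(2)[OF _ D ind, where f = e and W = "{0}" and ?W0.0 = "{}"] cfun.independent_empty by simp
  moreover have "inj_on e D"
    using cfun.inj_on_of_independent_mod[OF _ D ind, where f = e and W = "{0}"] by simp
  moreover have "e ` D \<subseteq> ?U"
    by (auto simp: e_def)
  ultimately show "cfun.dim ?U = card D"
    using cfun.basis_card_eq_dim[of "e ` D" ?U] span by (simp add: card_image)
qed

subsection \<open>Polynomial functions and forms\<close>

lemma polys_sum: "(\<And>i. i \<in> A \<Longrightarrow> f i \<in> polys X) \<Longrightarrow> (\<lambda>v. \<Sum>i\<in>A. f i v) \<in> polys X"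
  by (induction A rule: infinite_finite_induct) (auto intro: polys.intros)

lemma polys_prod: "(\<And>i. i \<in> A \<Longrightarrow> f i \<in> polys X) \<Longrightarrow> (\<lambda>v. \<Prod>i\<in>A. f i v) \<in> polys X"
  by (induction A rule: infinite_finite_induct) (auto intro: polys.intros)

lemma polys_power: "f \<in> polys X \<Longrightarrow> (\<lambda>v. f v ^ n) \<in> polys X"
  by (induction n) (auto intro: polys.intros)

lemma polys_compose:
  assumes "F \<in> polys X" "\<And>f. f \<in> X \<Longrightarrow> (\<lambda>v. f (g v)) \<in> polys Y"
  shows "(\<lambda>v. F (g v)) \<in> polys Y"
  using assms(1) by induction (auto intro: polys.intros assms(2))

lemma polys_poly:
  assumes "F \<in> polys X" "\<And>f. f \<in> X \<Longrightarrow> \<exists>q. \<forall>t. f (g t) = poly q t"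
  shows "\<exists>q. \<forall>t. F (g t) = poly q t"
  using assms(1)
proof induction
  case (const c)
  show ?case
    by (intro exI[of _ "[:c:]"]) simp
next
  case (add f h)
  then show ?case
    by (metis poly_add)
next
  case (mult f h)
  then show ?case
    by (metis poly_mult)
qed (use assms(2) in blast)

lemma forms_polys: "F \<in> forms I d \<Longrightarrow> F \<in> polys {\<lambda>v. v i $ k | i k. i \<in> I}"
  by (simp add: forms_def)

lemma forms_scale: "F \<in> forms I d \<Longrightarrow> F (\<lambda>i. t i *s v i) = (\<Prod>i\<in>I. t i ^ d i) * F v"
  by (simp add: forms_def)

lemma forms_cong:
  assumes "F \<in> forms I d" "\<And>i. i \<in> I \<Longrightarrow> v i = v' i"
  shows "F v = F v'"
proof -
  have "F \<in> polys {\<lambda>v. v i $ k | i k. i \<in> I}"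
    using assms(1) by (rule forms_polys)
  then show ?thesis
    by induction (auto simp: assms(2))
qed

lemma forms_degree_cong: "(\<And>i. i \<in> I \<Longrightarrow> d i = e i) \<Longrightarrow> forms I d = forms I e"
  by (simp add: forms_def)

lemma forms_add: "F \<in> forms I d \<Longrightarrow> G \<in> forms I d \<Longrightarrow> (\<lambda>v. F v + G v) \<in> forms I d"
  by (auto simp: forms_def algebra_simps intro: polys.intros)

lemma forms_mult: "F \<in> forms I d \<Longrightarrow> G \<in> forms I e \<Longrightarrow> (\<lambda>v. F v * G v) \<in> forms I (\<lambda>i. d i + e i)"
  by (auto simp: forms_def algebra_simps power_add prod.distrib intro: polys.intros)

lemma forms_cmult: "F \<in> forms I d \<Longrightarrow> (\<lambda>v. c * F v) \<in> forms I d"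
  by (auto simp: forms_def algebra_simps intro: polys.intros)

lemma forms_0: "(\<lambda>v. 0) \<in> forms I d"
  by (auto simp: forms_def intro: polys.intros)

lemma forms_1: "(\<lambda>v. 1) \<in> forms I (\<lambda>_. 0)"
  by (auto simp: forms_def intro: polys.intros)

lemma forms_sum: "(\<And>i. i \<in> A \<Longrightarrow> F i \<in> forms I d) \<Longrightarrow> (\<lambda>v. \<Sum>i\<in>A. F i v) \<in> forms I d"
  by (induction A rule: infinite_finite_induct) (auto intro: forms_add forms_0)

lemma forms_power: "F \<in> forms I d \<Longrightarrow> (\<lambda>v. F v ^ n) \<in> forms I (\<lambda>i. n * d i)"
proof (induction n)
  case (Suc n)
  then show ?case
    using forms_mult[of F I d "\<lambda>v. F v ^ n" "\<lambda>i. n * d i"] by simp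
qed (simp add: forms_1)

lemma forms_prod:
  assumes "\<And>j. j \<in> A \<Longrightarrow> F j \<in> forms I (d j)"
  shows "(\<lambda>v. \<Prod>j\<in>A. F j v) \<in> forms I (\<lambda>i. \<Sum>j\<in>A. d j i)"
  using assms
proof (induction A rule: infinite_finite_induct)
  case (insert x A)
  have "(\<lambda>v. F x v * (\<Prod>j\<in>A. F j v)) \<in> forms I (\<lambda>i. d x i + (\<Sum>j\<in>A. d j i))"
    by (rule forms_mult) (use insert in auto)
  then show ?case
    using insert by simp
qed (auto simp: forms_1)

text \<open>The bilinear pairing, without conjugation: \<open>dot a v = 0\<close> says that the
  point \<open>v\<close> lies on the line \<open>a\<close>.\<close>

definition dot :: "complex ^ 3 \<Rightarrow> complex ^ 3 \<Rightarrow> complex" where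
  "dot a v = (\<Sum>k\<in>UNIV. a $ k * v $ k)"

lemma dot_simps:
  "dot a (v + w) = dot a v + dot a w" "dot a (v - w) = dot a v - dot a w" "dot a (c *s v) = c * dot a v"
  "dot (a + b) v = dot a v + dot b v" "dot (a - b) v = dot a v - dot b v" "dot (c *s a) v = c * dot a v"
  "dot a 0 = 0" "dot 0 v = 0"
  by (simp_all add: dot_def sum.distrib sum_subtractf algebra_simps sum_distrib_left)

lemma forms_dot:
  assumes "i \<in> I" "finite I"
  shows "(\<lambda>v. dot a (v i)) \<in> forms I (\<lambda>l. if l = i then 1 else 0)"
proof -
  have "(\<Prod>l\<in>I. t l ^ (if l = i then 1 else 0)) = t i" for t :: "nat \<Rightarrow> complex"
  proof -
    have "(\<Prod>l\<in>I. t l ^ (if l = i then 1 else 0)) = (\<Prod>l\<in>I. if l = i then t i else 1)"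
      by (intro prod.cong) auto
    then show ?thesis
      using assms by simp
  qed
  moreover have "(\<lambda>v. dot a (v i)) \<in> polys {\<lambda>v. v i $ k | i k. i \<in> I}"
    unfolding dot_def using assms by (intro polys_sum polys.mult polys.const polys.coord) auto
  ultimately show ?thesis
    unfolding forms_def by (simp add: dot_simps)
qed

lemma forms_nth:
  assumes "i \<in> I" "finite I"
  shows "(\<lambda>v. v i $ k) \<in> forms I (\<lambda>l. if l = i then 1 else 0)"
proof -
  have "dot (axis k 1) w = w $ k" for w
  proof -
    have "dot (axis k 1) w = (\<Sum>l\<in>UNIV. if l = k then w $ k else 0)"
      unfolding dot_def by (intro sum.cong) (auto simp: axis_def)
    then show ?thesis
      by simp
  qed
  with forms_dot[OF assms, of "axis k 1"] show ?thesis
    by simp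
qed

subsection \<open>The cross product\<close>

text \<open>The complex cross product: the line joining two points, and dually the common point of
  two lines. It vanishes exactly on proportional vectors.\<close>

definition crs :: "complex ^ 3 \<Rightarrow> complex ^ 3 \<Rightarrow> complex ^ 3" where
  "crs a b = vector [a $ 2 * b $ 3 - a $ 3 * b $ 2, a $ 3 * b $ 1 - a $ 1 * b $ 3, a $ 1 * b $ 2 - a $ 2 * b $ 1]"

lemma crs_nth:
  "crs a b $ 1 = a $ 2 * b $ 3 - a $ 3 * b $ 2" "crs a b $ 2 = a $ 3 * b $ 1 - a $ 1 * b $ 3"
  "crs a b $ 3 = a $ 1 * b $ 2 - a $ 2 * b $ 1"
  by (simp_all add: crs_def)

lemma crs_simps:
  "crs (a + a') b = crs a b + crs a' b" "crs (c *s a) b = c *s crs a b" "crs 0 b = 0" "crs a a = 0"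
  by (simp_all add: vec_eq_iff forall_3 crs_nth algebra_simps)

lemma dot_commute: "dot a b = dot b a"
  by (simp add: dot_def mult.commute)

lemma dot_crs_self: "dot a (crs a b) = 0" "dot b (crs a b) = 0" "dot (crs a b) a = 0" "dot (crs a b) b = 0"
  by (simp_all add: dot_def sum_3 crs_nth algebra_simps)

lemma dot_crs_rotate: "dot (crs b c) a = dot c (crs a b)" "dot (crs c a) b = dot c (crs a b)"
  by (simp_all add: dot_def sum_3 crs_nth algebra_simps)

lemma crs_crs: "crs (crs a b) c = dot a c *s b - dot b c *s a"
  by (simp add: vec_eq_iff forall_3 dot_def sum_3 crs_nth algebra_simps)

lemma crs_swap: "crs a b = - crs b a"
  by (simp add: vec_eq_iff forall_3 crs_nth)

text \<open>Cramer's rule; \<open>dot c (crs a b)\<close> is the determinant of the three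
  vectors.\<close>

lemma cramer_crs: "dot c (crs a b) *s x = dot c (crs x b) *s a + dot c (crs a x) *s b + dot x (crs a b) *s c"
  by (simp add: vec_eq_iff forall_3 dot_def sum_3 crs_nth algebra_simps)

lemma exists_dot_eq_1:
  assumes "u \<noteq> 0"
  shows "\<exists>c. dot c u = 1"
proof -
  obtain k where k: "u $ k \<noteq> 0"
    using assms by (auto simp: vec_eq_iff)
  have "dot (axis k (1 / u $ k)) u = (\<Sum>l\<in>UNIV. if l = k then 1 else 0)"
    unfolding dot_def using k by (intro sum.cong) (auto simp: axis_def)
  also have "\<dots> = 1"
    by simp
  finally show ?thesis
    by blast
qed

lemma exists_crs_nonzero:
  assumes "n \<noteq> 0"
  shows "\<exists>x. crs n x \<noteq> 0"
proof (rule ccontr)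
  assume "\<not> ?thesis"
  then have 0: "crs n x = 0" for x
    by blast
  have "n $ 1 = 0" "n $ 2 = 0" "n $ 3 = 0"
    using arg_cong[OF 0[of "axis 1 1"], of "\<lambda>v. v $ 2"] arg_cong[OF 0[of "axis 1 1"], of "\<lambda>v. v $ 3"]
      arg_cong[OF 0[of "axis 2 1"], of "\<lambda>v. v $ 3"]
    by (simp_all add: crs_nth axis_def)
  then show False
    using assms by (simp add: vec_eq_iff forall_3)
qed

text \<open>Choose \<open>c\<close> such that \<open>c\<close>, \<open>a\<close>, \<open>b\<close>
  have determinant 1. The dual functionals of \<open>a\<close> and \<open>b\<close> are then
  \<open>crs b c\<close> and \<open>crs c a\<close>.\<close>

lemma exists_dual_pair:
  assumes "crs a b \<noteq> 0"
  shows "\<exists>l m. dot l a = 1 \<and> dot l b = 0 \<and> dot m a = 0 \<and> dot m b = 1"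
proof -
  obtain c where "dot c (crs a b) = 1"
    using exists_dot_eq_1[OF assms] by blast
  then show ?thesis
    by (intro exI[of _ "crs b c"] exI[of _ "crs c a"])
      (simp add: dot_crs_rotate(1)[of b c a] dot_crs_rotate(2)[of c a b] dot_crs_self)
qed

lemma perp_crs_span:
  assumes "crs a b \<noteq> 0" "dot x (crs a b) = 0"
  shows "\<exists>s t. x = s *s a + t *s b"
proof -
  obtain c where "dot c (crs a b) = 1"
    using exists_dot_eq_1[OF assms(1)] by blast
  then have "x = dot c (crs x b) *s a + dot c (crs a x) *s b"
    using cramer_crs[of c a b x] assms(2) by simp
  then show ?thesis
    by blast
qed

lemma crs_eq_0D:
  assumes "crs u w = 0" "u \<noteq> 0"
  shows "\<exists>c. w = c *s u"
proof -
  obtain c where c: "dot c u = 1"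
    using exists_dot_eq_1[OF assms(2)] by blast
  have "crs (crs u w) c = dot u c *s w - dot w c *s u"
    by (rule crs_crs)
  then have "w = dot w c *s u"
    using assms(1) c by (simp add: crs_simps dot_commute[of u c])
  then show ?thesis
    by blast
qed

lemma perp_pair_crs:
  assumes "dot w x = 0" "dot w y = 0" "crs x y \<noteq> 0"
  shows "\<exists>c. w = c *s crs x y"
proof (rule crs_eq_0D)
  show "crs (crs x y) w = 0"
    using assms by (simp add: crs_crs dot_commute[of _ w])
qed (rule assms(3))

text \<open>Completes a point \<open>b\<close> of the line \<open>n\<close> to a basis of the plane
  of vectors on that line, scaled so that the cross product is \<open>n\<close> itself and not just
  a multiple. The vector is \<open>- crs n c\<close> with \<open>dot c b = 1\<close>.\<close>

lemma perp_plane_basis: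
  assumes "dot n b = 0" "b \<noteq> 0"
  shows "\<exists>a. dot n a = 0 \<and> crs a b = n"
proof -
  obtain c where c: "dot c b = 1"
    using exists_dot_eq_1[OF assms(2)] by blast
  have "crs (crs n c) b = - n"
    using assms c by (simp add: crs_crs)
  then have "crs ((- 1) *s crs n c) b = n"
    unfolding crs_simps(2) by simp
  moreover have "dot n ((- 1) *s crs n c) = 0"
    by (simp only: dot_simps dot_crs_self) simp
  ultimately show ?thesis
    by blast
qed

subsection \<open>Points and their homogeneous coordinates\<close>

definition pt :: "nat set \<Rightarrow> coords \<Rightarrow> nat \<Rightarrow> point" where
  "pt I w = (\<lambda>i\<in>I. vec.span {w i})"

lemma mem_span_singleton: "x \<in> vec.span {v :: complex ^ 3} \<longleftrightarrow> (\<exists>c. x = c *s v)"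
  by (auto simp: vec.span_singleton)

lemma span_singleton_eqD:
  assumes "vec.span {v} = vec.span {w :: complex ^ 3}" "w \<noteq> 0"
  shows "\<exists>c. c \<noteq> 0 \<and> w = c *s v"
proof -
  have "w \<in> vec.span {v}"
    using assms(1) vec.span_base[of w "{w}"] by simp
  then show ?thesis
    using assms(2) by (auto simp: mem_span_singleton)
qed

lemma span_singleton_scale:
  assumes "c \<noteq> 0"
  shows "vec.span {c *s v} = vec.span {v :: complex ^ 3}"
proof -
  have "v = (1 / c) *s (c *s v)"
    using assms by simp
  also have "\<dots> \<in> vec.span {c *s v}"
    by (intro vec.span_scale vec.span_base) simp
  finally have "v \<in> vec.span {c *s v}" .
  moreover have "c *s v \<in> vec.span {v}"
    by (intro vec.span_scale vec.span_base) simp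
  ultimately show ?thesis
    unfolding vec.span_eq by simp
qed

lemma pt_eqI:
  assumes "\<And>i. i \<in> I \<Longrightarrow> \<exists>c. c \<noteq> 0 \<and> w i = c *s v i"
  shows "pt I w = pt I v"
  unfolding pt_def
proof (rule restrict_ext)
  fix i assume "i \<in> I"
  then obtain c where c: "c \<noteq> 0" "w i = c *s v i"
    using assms by blast
  show "vec.span {w i} = vec.span {v i}"
    unfolding c(2) by (rule span_singleton_scale) (rule c(1))
qed

lemma pt_in_P2s: "(\<And>i. i \<in> I \<Longrightarrow> w i \<noteq> 0) \<Longrightarrow> pt I w \<in> P2s I"
  by (auto simp: pt_def P2s_def P2_def)

lemma P2s_rep:
  assumes "q \<in> P2s I"
  obtains w where "\<And>i. i \<in> I \<Longrightarrow> w i \<noteq> 0" "q = pt I w"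
proof -
  have "\<forall>i\<in>I. \<exists>v. v \<noteq> 0 \<and> q i = vec.span {v}"
    using assms by (auto simp: P2s_def P2_def PiE_iff)
  then obtain w where w: "\<forall>i\<in>I. w i \<noteq> 0 \<and> q i = vec.span {w i}"
    by metis
  have "q = restrict q I"
    using assms by (simp add: P2s_def PiE_restrict)
  also have "\<dots> = pt I w"
    unfolding pt_def using w by (intro restrict_ext) blast
  finally have "q = pt I w" .
  then show thesis
    using that w by blast
qed

lemma reps_pt: "v \<in> reps I (pt I w) \<longleftrightarrow> (\<exists>t. \<forall>i\<in>I. v i = t i *s w i)"
proof
  assume "v \<in> reps I (pt I w)"
  then have "\<forall>i\<in>I. \<exists>c. v i = c *s w i"
    by (auto simp: reps_def pt_def mem_span_singleton)
  then show "\<exists>t. \<forall>i\<in>I. v i = t i *s w i"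
    by metis
next
  assume "\<exists>t. \<forall>i\<in>I. v i = t i *s w i"
  then show "v \<in> reps I (pt I w)"
    by (auto simp: reps_def pt_def mem_span_singleton)
qed

lemma reps_pt_self: "w \<in> reps I (pt I w)"
  unfolding reps_pt by (rule exI[of _ "\<lambda>_. 1"]) simp

text \<open>The scalars \<open>t\<close> depend on \<open>v\<close> only and serve all forms of all
  multidegrees at once. Hence a quotient of two forms of equal multidegree does not depend on the
  coordinates.\<close>

lemma forms_reps:
  assumes "v \<in> reps I (pt I w)"
  shows "\<exists>t. \<forall>d. \<forall>F\<in>forms I d. F v = (\<Prod>i\<in>I. t i ^ d i) * F w"
proof -
  obtain t where t: "\<forall>i\<in>I. v i = t i *s w i"
    using assms by (auto simp: reps_pt)
  have "F v = (\<Prod>i\<in>I. t i ^ d i) * F w" if F: "F \<in> forms I d" for F d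
    using forms_cong[OF F, of v "\<lambda>i. t i *s w i"] forms_scale[OF F, of t w] t by simp
  then show ?thesis
    by blast
qed

lemma vanishes_at_pt:
  assumes F: "F \<in> forms I d"
  shows "vanishes_at I F (pt I w) \<longleftrightarrow> F w = 0"
proof -
  have "F v = 0" if "v \<in> reps I (pt I w)" "F w = 0" for v
    using forms_reps[OF that(1)] F that(2) by (metis mult_zero_right)
  then show ?thesis
    unfolding vanishes_at_def using reps_pt_self by blast
qed

section \<open>Zariski closed sets and irreducibility\<close>

lemma zariski_closed_vanishing:
  assumes "F \<in> forms I d"
  shows "zariski_closed I {q \<in> P2s I. vanishes_at I F q}"
  unfolding zariski_closed_def using assms by (intro exI[of _ "{F}"]) auto

lemma zariski_closed_vanishing_set:
  assumes "\<And>F. F \<in> S \<Longrightarrow> \<exists>d. F \<in> forms I d"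
  shows "zariski_closed I {q \<in> P2s I. \<forall>F\<in>S. vanishes_at I F q}"
  unfolding zariski_closed_def using assms by (intro exI[of _ S]) auto

lemma zariski_closed_subset: "zariski_closed I Z \<Longrightarrow> Z \<subseteq> P2s I"
  by (auto simp: zariski_closed_def)

lemma zariski_closedE:
  assumes "zariski_closed I Z" "q \<in> P2s I" "q \<notin> Z"
  obtains d F where "F \<in> forms I d" "\<And>q. q \<in> Z \<Longrightarrow> vanishes_at I F q" "\<not> vanishes_at I F q"
  using assms unfolding zariski_closed_def by blast

lemma zariski_closed_Int:
  assumes "zariski_closed I A" "zariski_closed I B"
  shows "zariski_closed I (A \<inter> B)"
proof -
  obtain S S' where "S \<subseteq> (\<Union>d. forms I d)" "A = {q \<in> P2s I. \<forall>F\<in>S. vanishes_at I F q}"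
    "S' \<subseteq> (\<Union>d. forms I d)" "B = {q \<in> P2s I. \<forall>F\<in>S'. vanishes_at I F q}"
    using assms unfolding zariski_closed_def by blast
  then show ?thesis
    unfolding zariski_closed_def by (intro exI[of _ "S \<union> S'"]) blast
qed

lemma zariski_closed_INT:
  assumes "\<And>j. j \<in> J \<Longrightarrow> zariski_closed I (A j)"
  shows "zariski_closed I {q \<in> P2s I. \<forall>j\<in>J. q \<in> A j}"
proof -
  have "\<forall>j\<in>J. \<exists>S\<subseteq>(\<Union>d. forms I d). A j = {q \<in> P2s I. \<forall>F\<in>S. vanishes_at I F q}"
    using assms unfolding zariski_closed_def by blast
  from bchoice[OF this] obtain S
    where "\<forall>j\<in>J. S j \<subseteq> (\<Union>d. forms I d) \<and> A j = {q \<in> P2s I. \<forall>F\<in>S j. vanishes_at I F q}"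
    by blast
  then show ?thesis
    unfolding zariski_closed_def by (intro exI[of _ "\<Union>j\<in>J. S j"]) auto
qed

lemma zariski_closed_forms_pt:
  assumes S: "\<And>F. F \<in> S \<Longrightarrow> \<exists>d. F \<in> forms I d"
    and Q: "\<And>w. (\<And>i. i \<in> I \<Longrightarrow> w i \<noteq> 0) \<Longrightarrow> Q (pt I w) \<longleftrightarrow> (\<forall>F\<in>S. F w = 0)"
  shows "zariski_closed I {q \<in> P2s I. Q q}"
proof -
  have "{q \<in> P2s I. Q q} = {q \<in> P2s I. \<forall>F\<in>S. vanishes_at I F q}"
  proof (intro Collect_cong conj_cong refl)
    fix q assume "q \<in> P2s I"
    then obtain w where w: "\<And>i. i \<in> I \<Longrightarrow> w i \<noteq> 0" "q = pt I w"
      by (rule P2s_rep) blast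
    have "vanishes_at I F q \<longleftrightarrow> F w = 0" if "F \<in> S" for F
      using S[OF that] vanishes_at_pt w(2) by blast
    then show "Q q \<longleftrightarrow> (\<forall>F\<in>S. vanishes_at I F q)"
      using Q[of w] w by simp
  qed
  then show ?thesis
    using zariski_closed_vanishing_set[of S I] S by simp
qed

lemma zariski_closed_form_pt:
  assumes "F \<in> forms I d" "\<And>w. (\<And>i. i \<in> I \<Longrightarrow> w i \<noteq> 0) \<Longrightarrow> Q (pt I w) \<longleftrightarrow> F w = 0"
  shows "zariski_closed I {q \<in> P2s I. Q q}"
  by (rule zariski_closed_forms_pt[of "{F}"]) (use assms in auto)

lemma pt_nth: "i \<in> I \<Longrightarrow> pt I w i = vec.span {w i}"
  by (simp add: pt_def)

lemma span_eq_span_iff_crs: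
  assumes "v \<noteq> 0" "w \<noteq> 0"
  shows "vec.span {v} = vec.span {w} \<longleftrightarrow> crs w v = 0"
proof
  assume "vec.span {v} = vec.span {w}"
  then obtain c where "w = c *s v"
    using span_singleton_eqD assms by blast
  then show "crs w v = 0"
    by (simp add: crs_simps)
next
  assume "crs w v = 0"
  then obtain c where c: "v = c *s w"
    using crs_eq_0D assms by blast
  then have "c \<noteq> 0"
    using assms by auto
  then show "vec.span {v} = vec.span {w}"
    unfolding c by (rule span_singleton_scale)
qed

lemma zariski_closed_coordinate_eq:
  assumes i: "i \<in> I" and I: "finite I" and x: "x \<noteq> 0"
  shows "zariski_closed I {q \<in> P2s I. q i = vec.span {x}}"
proof (rule zariski_closed_forms_pt)
  fix F assume "F \<in> {(\<lambda>v. dot (crs (axis k 1) x) (v i)) | k. True}"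
  then show "\<exists>d. F \<in> forms I d"
    using forms_dot[OF i I] by blast
next
  fix w :: coords assume w: "\<And>i. i \<in> I \<Longrightarrow> w i \<noteq> 0"
  \<comment> \<open>Equality of two points is proportionality, so the equations are the components
    of the cross product with \<open>x\<close>, each of them a linear form in
    \<open>v\<close>.\<close>
  have "dot (crs (axis k 1) x) v = crs x v $ k" for k v
    using exhaust_3[of k] by (auto simp: dot_def sum_3 crs_nth axis_def algebra_simps)
  then have "(\<forall>F\<in>{(\<lambda>v. dot (crs (axis k 1) x) (v i)) | k. True}. F w = 0) \<longleftrightarrow> crs x (w i) = 0"
    by (auto simp: vec_eq_iff)
  then show "pt I w i = vec.span {x} \<longleftrightarrow> (\<forall>F\<in>{(\<lambda>v. dot (crs (axis k 1) x) (v i)) | k. True}. F w = 0)"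
    using span_eq_span_iff_crs[OF w[OF i] x] by (simp add: pt_nth[OF i])
qed

lemma zariski_closed_singleton:
  assumes q: "q \<in> P2s I" and I: "finite I"
  shows "zariski_closed I {q}"
proof -
  obtain w where w: "\<And>i. i \<in> I \<Longrightarrow> w i \<noteq> 0" "q = pt I w"
    using q P2s_rep by blast
  have "x = q" if "x \<in> P2s I" "\<forall>i\<in>I. x i = q i" for x
    by (rule PiE_ext[OF that(1)[unfolded P2s_def] q[unfolded P2s_def]]) (use that(2) in blast)
  moreover have "q i = vec.span {w i}" if "i \<in> I" for i
    using that w(2) by (simp only: pt_nth)
  ultimately have "{q} = {x \<in> P2s I. \<forall>i\<in>I. x \<in> {x \<in> P2s I. x i = vec.span {w i}}}"
    using q by blast
  also have "zariski_closed I \<dots>"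
    using w(1) I by (intro zariski_closed_INT zariski_closed_coordinate_eq)
  finally show ?thesis .
qed

lemma zariski_irreducible_singleton:
  "q \<in> P2s I \<Longrightarrow> finite I \<Longrightarrow> zariski_irreducible I {q}"
  unfolding zariski_irreducible_def using zariski_closed_singleton by blast

text \<open>\<open>C\<close> is covered by \<open>A\<close> and the zero set of \<open>F\<close>,
  and \<open>A\<close> alone does not suffice. This allows a vanishing statement to be checked away
  from an exceptional curve only.\<close>

lemma zariski_irreducible_vanishing:
  assumes C: "zariski_irreducible I C" and F: "F \<in> forms I d"
    and A: "zariski_closed I A" "\<not> C \<subseteq> A"
    and van: "\<And>q. q \<in> C \<Longrightarrow> q \<notin> A \<Longrightarrow> vanishes_at I F q"
  shows "\<forall>q\<in>C. vanishes_at I F q"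
proof -
  have "C \<subseteq> A \<union> {q \<in> P2s I. vanishes_at I F q}"
    using van zariski_closed_subset[of I C] C by (auto simp: zariski_irreducible_def)
  then have "C \<subseteq> {q \<in> P2s I. vanishes_at I F q}"
    using C A zariski_closed_vanishing[OF F] unfolding zariski_irreducible_def by blast
  then show ?thesis
    by blast
qed

text \<open>A total function of the point, evaluated in some chosen nonzero coordinates. Where
  \<open>G\<close> does not vanish, the choice does not matter by \<open>ratio_eq\<close>; elsewhere
  the value is arbitrary.\<close>

definition ratio :: "nat set \<Rightarrow> (coords \<Rightarrow> complex) \<Rightarrow> (coords \<Rightarrow> complex) \<Rightarrow> (nat \<Rightarrow> point) \<Rightarrow> complex" where
  "ratio I F G q = (let w = (SOME w. (\<forall>i\<in>I. w i \<noteq> 0) \<and> q = pt I w) in F w / G w)"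

lemma ratio_eq:
  assumes F: "F \<in> forms I d" "G \<in> forms I d" and q: "q \<in> P2s I" "v \<in> reps I q" "G v \<noteq> 0"
  shows "ratio I F G q = F v / G v"
proof -
  define w where "w = (SOME w. (\<forall>i\<in>I. w i \<noteq> 0) \<and> q = pt I w)"
  have "\<exists>w. (\<forall>i\<in>I. w i \<noteq> 0) \<and> q = pt I w"
    using q(1) P2s_rep by metis
  then have w: "q = pt I w"
    unfolding w_def by (rule someI2_ex) simp
  obtain t where t: "\<forall>d. \<forall>F\<in>forms I d. F v = (\<Prod>i\<in>I. t i ^ d i) * F w"
    using forms_reps q(2) w by blast
  then have "F v = (\<Prod>i\<in>I. t i ^ d i) * F w" "G v = (\<Prod>i\<in>I. t i ^ d i) * G w"
    using F by blast+
  then show ?thesis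
    using q(3) by (simp add: ratio_def w_def[symmetric])
qed

lemma sum_fun_eq:
  fixes f :: "'i \<Rightarrow> 'a \<Rightarrow> 'b::comm_monoid_add"
  shows "(\<Sum>i\<in>A. (\<lambda>v. f i v)) = (\<lambda>v. \<Sum>i\<in>A. f i v)"
  by (induction A rule: infinite_finite_induct) (auto simp: fun_eq_iff)

subsection \<open>Local rings\<close>

lemma not_vanishes_at_mult:
  assumes "F \<in> forms I d" "G \<in> forms I e" "P \<in> P2s I" "\<not> vanishes_at I F P" "\<not> vanishes_at I G P"
  shows "\<not> vanishes_at I (\<lambda>v. F v * G v) P"
proof -
  obtain w where w: "P = pt I w"
    using assms(3) P2s_rep by blast
  then show ?thesis
    using assms by (simp add: vanishes_at_pt[OF forms_mult[OF assms(1,2)]] vanishes_at_pt)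
qed

lemma regular_at_ratio:
  assumes "F \<in> forms {0..r} d" "G \<in> forms {0..r} d" "\<not> vanishes_at {0..r} G P"
  shows "ratio {0..r} F G \<in> regular_at r p P"
  unfolding regular_at_def mem_Collect_eq
proof (intro exI bexI conjI ballI impI)
  fix q v assume "q \<in> blowup r p" "v \<in> reps {0..r} q" "G v \<noteq> 0"
  then show "ratio {0..r} F G q = F v / G v"
    using ratio_eq[OF assms(1,2)] by (simp add: blowup_def)
qed (use assms in auto)

lemma regular_at_cmult:
  assumes "\<phi> \<in> regular_at r p P"
  shows "(\<lambda>q. c * \<phi> q) \<in> regular_at r p P"
proof -
  obtain d F G where "F \<in> forms {0..r} d" "G \<in> forms {0..r} d" "\<not> vanishes_at {0..r} G P"
    "\<forall>q\<in>blowup r p. \<forall>v\<in>reps {0..r} q. G v \<noteq> 0 \<longrightarrow> \<phi> q = F v / G v"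
    using assms unfolding regular_at_def by blast
  then show ?thesis
    unfolding regular_at_def mem_Collect_eq
    by (intro exI[of _ d] bexI[of _ "\<lambda>v. c * F v"] bexI[of _ G]) (auto intro: forms_cmult)
qed

lemma regular_at_add:
  assumes P: "P \<in> P2s {0..r}" and "\<phi> \<in> regular_at r p P" "\<psi> \<in> regular_at r p P"
  shows "(\<lambda>q. \<phi> q + \<psi> q) \<in> regular_at r p P"
proof -
  obtain d F G where F: "F \<in> forms {0..r} d" "G \<in> forms {0..r} d" "\<not> vanishes_at {0..r} G P"
    "\<forall>q\<in>blowup r p. \<forall>v\<in>reps {0..r} q. G v \<noteq> 0 \<longrightarrow> \<phi> q = F v / G v"
    using assms unfolding regular_at_def by blast
  obtain e F' G' where F': "F' \<in> forms {0..r} e" "G' \<in> forms {0..r} e" "\<not> vanishes_at {0..r} G' P"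
    "\<forall>q\<in>blowup r p. \<forall>v\<in>reps {0..r} q. G' v \<noteq> 0 \<longrightarrow> \<psi> q = F' v / G' v"
    using assms unfolding regular_at_def by blast
  show ?thesis
    unfolding regular_at_def mem_Collect_eq
  proof (rule exI[of _ "\<lambda>i. d i + e i"], rule bexI[of _ "\<lambda>v. F v * G' v + G v * F' v"],
      rule bexI[of _ "\<lambda>v. G v * G' v"], rule conjI)
    show "(\<lambda>v. F v * G' v + G v * F' v) \<in> forms {0..r} (\<lambda>i. d i + e i)"
      using F F' by (intro forms_add forms_mult) auto
    show "(\<lambda>v. G v * G' v) \<in> forms {0..r} (\<lambda>i. d i + e i)"
      using F F' by (intro forms_mult)
    show "\<not> vanishes_at {0..r} (\<lambda>v. G v * G' v) P"
      using F F' P by (intro not_vanishes_at_mult)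
    show "\<forall>q\<in>blowup r p. \<forall>v\<in>reps {0..r} q. G v * G' v \<noteq> 0 \<longrightarrow>
        \<phi> q + \<psi> q = (F v * G' v + G v * F' v) / (G v * G' v)"
      using F(4) F'(4) by (auto simp: field_simps)
  qed
qed

lemma not_vanishes_at_1: "P \<in> P2s I \<Longrightarrow> \<not> vanishes_at I (\<lambda>v. 1) P"
  by (metis P2s_rep reps_pt_self vanishes_at_def zero_neq_one)

lemma regular_at_0:
  assumes "P \<in> P2s {0..r}"
  shows "(\<lambda>q. 0) \<in> regular_at r p P"
  unfolding regular_at_def mem_Collect_eq
proof (rule exI[of _ "\<lambda>_. 0"], rule bexI[of _ "\<lambda>v. 0"], rule bexI[of _ "\<lambda>v. 1"], rule conjI)
  show "\<not> vanishes_at {0..r} (\<lambda>v. 1) P"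
    using assms by (rule not_vanishes_at_1)
qed (simp_all add: forms_0 forms_1)

lemma regular_at_sum:
  assumes "P \<in> P2s {0..r}" "\<And>i. i \<in> A \<Longrightarrow> \<phi> i \<in> regular_at r p P"
  shows "(\<lambda>q. \<Sum>i\<in>A. \<phi> i q) \<in> regular_at r p P"
  using assms(2)
  by (induction A rule: infinite_finite_induct) (auto intro: regular_at_0 regular_at_add assms(1))

lemma local_ideal_subspace:
  assumes P: "P \<in> P2s {0..r}"
  shows "cfun.subspace (local_ideal r p C P)"
  unfolding cfun.subspace_def
proof (intro conjI ballI allI)
  have "(\<lambda>v. 1) \<in> forms {0..r} (\<lambda>_. 0)"
    by (rule forms_1)
  moreover have "\<not> vanishes_at {0..r} (\<lambda>v. 1) P"
    using P by (rule not_vanishes_at_1)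
  ultimately show "0 \<in> local_ideal r p C P"
    unfolding local_ideal_def using regular_at_0[OF P] by (auto simp: zero_fun_def)
next
  fix \<phi> \<psi> assume "\<phi> \<in> local_ideal r p C P" "\<psi> \<in> local_ideal r p C P"
  then obtain d G e G' where *: "\<phi> \<in> regular_at r p P" "\<psi> \<in> regular_at r p P"
    "G \<in> forms {0..r} d" "G' \<in> forms {0..r} e" "\<not> vanishes_at {0..r} G P" "\<not> vanishes_at {0..r} G' P"
    "\<forall>q\<in>C. \<not> vanishes_at {0..r} G q \<longrightarrow> \<phi> q = 0" "\<forall>q\<in>C. \<not> vanishes_at {0..r} G' q \<longrightarrow> \<psi> q = 0"
    unfolding local_ideal_def by blast
  have "\<forall>q\<in>C. \<not> vanishes_at {0..r} (\<lambda>v. G v * G' v) q \<longrightarrow> \<phi> q + \<psi> q = 0"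
    using *(7,8) unfolding vanishes_at_def by (metis add_0 mult_eq_0_iff)
  then show "\<phi> + \<psi> \<in> local_ideal r p C P"
    unfolding local_ideal_def plus_fun_def
    using regular_at_add[OF P *(1,2)] forms_mult[OF *(3,4)] not_vanishes_at_mult[OF *(3,4) P *(5,6)] by blast
next
  fix c \<phi> assume "\<phi> \<in> local_ideal r p C P"
  then show "(\<lambda>x. c * \<phi> x) \<in> local_ideal r p C P"
    unfolding local_ideal_def using regular_at_cmult by fastforce
qed

subsection \<open>Parametrised rational curves\<close>

lemma poly_ideal_principal:
  fixes J :: "'a::field poly set"
  assumes add: "\<And>f g. f \<in> J \<Longrightarrow> g \<in> J \<Longrightarrow> f + g \<in> J" and mult: "\<And>f g. f \<in> J \<Longrightarrow> g * f \<in> J"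
    and nz: "f0 \<in> J" "f0 \<noteq> 0"
  obtains h where "h \<in> J" "h \<noteq> 0" "\<And>f. f \<in> J \<Longrightarrow> h dvd f"
proof -
  obtain h where h: "h \<in> J \<and> h \<noteq> 0" "\<And>g. g \<in> J \<and> g \<noteq> 0 \<Longrightarrow> degree h \<le> degree g"
    using ex_has_least_nat[of "\<lambda>h. h \<in> J \<and> h \<noteq> 0" f0 degree] nz by blast
  have "h dvd f" if "f \<in> J" for f
  proof -
    have "f mod h = f + (- (f div h)) * h"
      by (simp add: minus_div_mult_eq_mod[symmetric])
    then have "f mod h \<in> J"
      using add mult h that by metis
    then have "f mod h = 0"
      using h(2)[of "f mod h"] degree_mod_less[of h f] h(1) by fastforce
    then show ?thesis
      by (simp add: dvd_eq_mod_eq_0)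
  qed
  then show thesis
    using that h by blast
qed

text \<open>Identities between regular functions hold only off the zeros of the denominators;
  \<open>(f - g) * k\<close> vanishes everywhere, which turns them into identities of
  polynomials.\<close>

lemma poly_eq_iff_nonzero:
  fixes f g k :: "complex poly"
  assumes "\<And>t. poly k t \<noteq> 0 \<Longrightarrow> poly f t = poly g t" "k \<noteq> 0"
  shows "f = g"
proof -
  have "poly ((f - g) * k) t = 0" for t
    using assms(1)[of t] by (cases "poly k t = 0") auto
  then have "(f - g) * k = 0"
    using poly_all_0_iff_0 by blast
  then show ?thesis
    using assms(2) by simp
qed

text \<open>The Taylor expansion of \<open>f / g\<close> at \<open>t0\<close> to order
  \<open>n\<close>, with the denominator cleared. As \<open>g\<close> is nonzero at
  \<open>t0\<close>, a suitable next coefficient makes the remaining factor vanish at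
  \<open>t0\<close>, so that one more linear factor splits off.\<close>

lemma poly_quotient_expansion:
  fixes f g :: "complex poly"
  assumes "poly g t0 \<noteq> 0"
  shows "\<exists>y k. f - (\<Sum>i<n. smult (y i) ([:- t0, 1:] ^ i)) * g = [:- t0, 1:] ^ n * k"
proof (induction n)
  case (Suc n)
  then obtain y k where yk: "f - (\<Sum>i<n. smult (y i) ([:- t0, 1:] ^ i)) * g = [:- t0, 1:] ^ n * k"
    by blast
  define c where "c = poly k t0 / poly g t0"
  have "poly (k - smult c g) t0 = 0"
    using assms by (simp add: c_def)
  then obtain k' where k': "k - smult c g = [:- t0, 1:] * k'"
    unfolding poly_eq_0_iff_dvd by (elim dvdE)
  define y' where "y' i = (if i = n then c else y i)" for i
  have "(\<Sum>i<Suc n. smult (y' i) ([:- t0, 1:] ^ i)) = (\<Sum>i<n. smult (y i) ([:- t0, 1:] ^ i)) + smult c ([:- t0, 1:] ^ n)"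
    by (simp add: y'_def)
  then have "f - (\<Sum>i<Suc n. smult (y' i) ([:- t0, 1:] ^ i)) * g =
      [:- t0, 1:] ^ n * k - smult c ([:- t0, 1:] ^ n) * g"
    using yk by (simp add: algebra_simps)
  also have "\<dots> = [:- t0, 1:] ^ n * (k - smult c g)"
    by (simp add: algebra_simps)
  also have "\<dots> = [:- t0, 1:] ^ Suc n * k'"
    unfolding k' by (simp only: power_Suc2 mult.assoc)
  finally show ?case
    by blast
qed auto

text \<open>The powers of t - t0 below \<open>n\<close> are independent modulo the
  \<open>n\<close>-th power: the sum is the composition of a polynomial of degree below
  \<open>n\<close> with t - t0, and composition preserves this degree.\<close>

lemma linear_factor_power_dvd_expansion:
  fixes t0 :: complex
  assumes "[:- t0, 1:] ^ n dvd (\<Sum>i<n. smult (y i) ([:- t0, 1:] ^ i))"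
  shows "\<forall>i<n. y i = 0"
proof -
  define U where "U = (\<Sum>i<n. monom (y i) i)"
  have pow: "pcompose (f ^ i) g = pcompose f g ^ i" for f g :: "complex poly" and i
    by (induction i) (simp_all add: pcompose_mult pcompose_1)
  have eq: "(\<Sum>i<n. smult (y i) ([:- t0, 1:] ^ i)) = pcompose U [:- t0, 1:]"
    by (simp add: U_def pcompose_sum monom_altdef pcompose_smult pow pcompose_pCons)
  have coeff: "coeff U i = (if i < n then y i else 0)" for i
    by (simp add: U_def coeff_sum)
  have "U = 0"
  proof (rule ccontr)
    assume U: "U \<noteq> 0"
    then have "degree U < n"
      using coeff by (metis leading_coeff_0_iff)
    moreover have "pcompose U [:- t0, 1:] \<noteq> 0"
      using U by (simp add: pcompose_eq_0_iff)
    then have "degree ([:- t0, 1:] ^ n) \<le> degree (pcompose U [:- t0, 1:])"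
      using assms unfolding eq by (intro dvd_imp_degree_le) auto
    ultimately show False
      by (simp add: degree_linear_power degree_pcompose)
  qed
  then show ?thesis
    using coeff by (metis coeff_0)
qed

text \<open>\<open>T\<close> is the image of a projective line, with \<open>\<tau>\<close> as affine
  chart and \<open>\<omega>\<close> as point at infinity. Components with \<open>b l = 0\<close> are
  constant; this happens on exceptional curves. The linear form \<open>lam l\<close> is 1 along the
  chart, and \<open>bet\<close> recovers the parameter from the component \<open>i0\<close>.
  Together they make it possible to homogenise polynomials in t.\<close>

locale rational_curve =
  fixes r :: nat and p :: "nat \<Rightarrow> point" and T :: "(nat \<Rightarrow> point) set"
    and a b lam :: "nat \<Rightarrow> complex ^ 3" and i0 :: nat and bet :: "complex ^ 3"
    and \<tau> :: "complex \<Rightarrow> coords" and \<omega> :: coords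
  defines "\<tau> \<equiv> \<lambda>t l. a l + t *s b l" and "\<omega> \<equiv> \<lambda>l. if b l = 0 then a l else b l"
  assumes lam_a: "\<And>l. l \<le> r \<Longrightarrow> dot (lam l) (a l) = 1"
    and lam_b: "\<And>l. l \<le> r \<Longrightarrow> dot (lam l) (b l) = 0"
    and i0: "i0 \<le> r"
    and bet_a: "dot bet (a i0) = 0" and bet_b: "dot bet (b i0) = 1"
    and T_blowup: "T \<subseteq> blowup r p"
    and T_eq: "T = insert (pt {0..r} \<omega>) (range (\<lambda>t. pt {0..r} (\<tau> t)))"
    and T_closed: "zariski_closed {0..r} T"
begin

abbreviation "I \<equiv> {0..r}"

lemma lam_\<tau>: "l \<le> r \<Longrightarrow> dot (lam l) (\<tau> t l) = 1"
  by (simp add: \<tau>_def dot_simps lam_a lam_b)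

lemma bet_\<tau>: "dot bet (\<tau> t i0) = t"
  by (simp add: \<tau>_def dot_simps bet_a bet_b)

lemma \<tau>_nz: "l \<le> r \<Longrightarrow> \<tau> t l \<noteq> 0"
  using lam_\<tau>[of l t] by (auto simp: dot_simps)

lemma pt_\<tau>: "pt I (\<tau> t) \<in> T" "pt I (\<tau> t) \<in> P2s I" "pt I (\<tau> t) \<in> blowup r p"
  using T_eq T_blowup by (auto simp: blowup_def)

lemma pt_\<omega>: "pt I \<omega> \<in> T" "pt I \<omega> \<in> P2s I" "pt I \<omega> \<in> blowup r p"
  using T_eq T_blowup by (auto simp: blowup_def)

lemma b_i0: "b i0 \<noteq> 0"
  using bet_b by (auto simp: dot_simps)

lemma pt_i0: "pt I w i0 = vec.span {w i0}"
  using i0 by (simp add: pt_def)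

lemma pt_\<tau>_inj: "pt I (\<tau> t) = pt I (\<tau> t') \<longleftrightarrow> t = t'"
proof
  assume "pt I (\<tau> t) = pt I (\<tau> t')"
  from fun_cong[OF this, of i0] have "vec.span {\<tau> t i0} = vec.span {\<tau> t' i0}"
    unfolding pt_i0 .
  then obtain c where c: "\<tau> t' i0 = c *s \<tau> t i0"
    using span_singleton_eqD \<tau>_nz[OF i0] by blast
  have "c = 1"
    using lam_\<tau>[OF i0, of t] lam_\<tau>[OF i0, of t'] unfolding c by (simp add: dot_simps)
  then have "dot bet (\<tau> t' i0) = dot bet (\<tau> t i0)"
    unfolding c by (simp add: dot_simps)
  then show "t = t'"
    unfolding bet_\<tau> by (rule sym)
qed simp

lemma pt_\<tau>_neq_\<omega>: "pt I (\<tau> t) \<noteq> pt I \<omega>"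
proof
  assume "pt I (\<tau> t) = pt I \<omega>"
  from fun_cong[OF this, of i0] have "vec.span {\<omega> i0} = vec.span {\<tau> t i0}"
    unfolding pt_i0 by (rule sym)
  then obtain c where c: "\<tau> t i0 = c *s \<omega> i0"
    using span_singleton_eqD \<tau>_nz[OF i0] by blast
  show False
    using lam_\<tau>[OF i0, of t] lam_b[OF i0] b_i0 unfolding c by (simp add: \<omega>_def dot_simps)
qed

section \<open>Restriction of forms to the affine parameter\<close>

definition pull :: "(coords \<Rightarrow> complex) \<Rightarrow> complex poly" where
  "pull F = (SOME f. \<forall>t. F (\<tau> t) = poly f t)"

lemma poly_pull:
  assumes "F \<in> forms I d"
  shows "F (\<tau> t) = poly (pull F) t"
proof -
  have "\<exists>q. \<forall>t. F (\<tau> t) = poly q t"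
  proof (rule polys_poly[OF forms_polys[OF assms]])
    fix f :: "coords \<Rightarrow> complex" assume "f \<in> {\<lambda>v. v i $ k | i k. i \<in> I}"
    then obtain i k where "f = (\<lambda>v. v i $ k)"
      by blast
    then show "\<exists>q. \<forall>t. f (\<tau> t) = poly q t"
      by (intro exI[of _ "[:a i $ k, b i $ k:]"]) (simp add: \<tau>_def)
  qed
  then show ?thesis
    unfolding pull_def by (rule someI2_ex) simp
qed

lemma pull_eqI: "F \<in> forms I d \<Longrightarrow> (\<And>t. F (\<tau> t) = poly f t) \<Longrightarrow> pull F = f"
  by (rule poly_eq_poly_eq_iff[THEN iffD1]) (simp add: poly_pull[symmetric] fun_eq_iff)

lemma pull_mult: "F \<in> forms I d \<Longrightarrow> G \<in> forms I e \<Longrightarrow> pull (\<lambda>v. F v * G v) = pull F * pull G"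
  by (rule pull_eqI[OF forms_mult]) (auto simp: poly_pull)

lemma vanishes_at_\<tau>: "F \<in> forms I d \<Longrightarrow> vanishes_at I F (pt I (\<tau> t)) \<longleftrightarrow> poly (pull F) t = 0"
  by (simp add: vanishes_at_pt poly_pull)

text \<open>The point at infinity needs the opposite chart \<open>g s\<close>, in which the moving
  components are s a + b. There \<open>F\<close> is a polynomial in s with nonzero value at 0, hence
  nonzero at some s \<noteq> 0, and \<open>g s\<close> has the same point as
  \<open>\<tau> (1 / s)\<close>.\<close>

lemma pull_nonzero:
  assumes F: "F \<in> forms I d" and q: "q \<in> T" "\<not> vanishes_at I F q"
  shows "pull F \<noteq> 0"
proof (cases "q = pt I \<omega>")
  case False
  then obtain t where "q = pt I (\<tau> t)"
    using q(1) T_eq by blast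
  then show ?thesis
    using q(2) vanishes_at_\<tau>[OF F, of t] by fastforce
next
  case True
  define g where "g s = (\<lambda>l. if b l = 0 then a l else s *s a l + b l)" for s
  have "\<exists>q. \<forall>s. F (g s) = poly q s"
  proof (rule polys_poly[OF forms_polys[OF F]])
    fix f :: "coords \<Rightarrow> complex" assume "f \<in> {\<lambda>v. v i $ k | i k. i \<in> I}"
    then obtain i k where f: "f = (\<lambda>v. v i $ k)"
      by blast
    show "\<exists>q. \<forall>t. f (g t) = poly q t"
    proof (cases "b i = 0")
      case True
      then show ?thesis
        by (intro exI[of _ "[:a i $ k:]"]) (simp add: g_def f)
    next
      case False
      then show ?thesis
        by (intro exI[of _ "[:b i $ k, a i $ k:]"]) (simp add: g_def f)
    qed
  qed
  then obtain u where u: "\<And>s. F (g s) = poly u s"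
    by blast
  have "g 0 = \<omega>"
    by (auto simp: g_def \<omega>_def)
  then have "poly u 0 \<noteq> 0"
    using q(2) vanishes_at_pt[OF F, of \<omega>] u[of 0] True by simp
  then have "u \<noteq> 0"
    by auto
  then have "finite {s. poly u s = 0}"
    by (rule poly_roots_finite)
  then have "\<exists>s. s \<notin> insert 0 {s. poly u s = 0}"
    using ex_new_if_finite infinite_UNIV_char_0 by blast
  then obtain s where s: "s \<noteq> 0" "poly u s \<noteq> 0"
    by blast
  have "g s = (\<lambda>l. (if b l = 0 then 1 else s) *s \<tau> (1 / s) l)"
    using s(1) by (auto simp: g_def \<tau>_def fun_eq_iff vec_eq_iff algebra_simps)
  then have "F (g s) = (\<Prod>l\<in>I. (if b l = 0 then 1 else s) ^ d l) * F (\<tau> (1 / s))"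
    using forms_scale[OF F] by simp
  then have "poly (pull F) (1 / s) \<noteq> 0"
    using s u poly_pull[OF F] by auto
  then show ?thesis
    by auto
qed

text \<open>Irreducibility of \<open>T\<close> reflects that C[t] has no zero divisors: two forms
  that do not vanish identically on \<open>T\<close> are both nonzero at a common parameter.\<close>

lemma irreducible: "zariski_irreducible I T"
  unfolding zariski_irreducible_def
proof (intro conjI allI impI)
  show "zariski_closed I T"
    by (rule T_closed)
  show "T \<noteq> {}"
    using T_eq by blast
  fix A B assume AB: "zariski_closed I A" "zariski_closed I B" "T \<subseteq> A \<union> B"
  show "T \<subseteq> A \<or> T \<subseteq> B"
  proof (rule ccontr)
    assume "\<not> ?thesis"
    then obtain q q' where q: "q \<in> T" "q \<notin> A" "q' \<in> T" "q' \<notin> B"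
      by blast
    then have P2s: "q \<in> P2s I" "q' \<in> P2s I"
      using T_blowup by (auto simp: blowup_def)
    obtain d F where F: "F \<in> forms I d" "\<And>q. q \<in> A \<Longrightarrow> vanishes_at I F q" "\<not> vanishes_at I F q"
      by (rule zariski_closedE[OF AB(1) P2s(1) q(2)]) blast
    obtain e G where G: "G \<in> forms I e" "\<And>q. q \<in> B \<Longrightarrow> vanishes_at I G q" "\<not> vanishes_at I G q'"
      by (rule zariski_closedE[OF AB(2) P2s(2) q(4)]) blast
    have "pull F \<noteq> 0" "pull G \<noteq> 0"
      using pull_nonzero F G q by blast+
    then have "\<exists>t. poly (pull F * pull G) t \<noteq> 0"
      using poly_all_0_iff_0[of "pull F * pull G"] by auto
    then obtain t where "poly (pull F) t \<noteq> 0" "poly (pull G) t \<noteq> 0"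
      by auto
    then have "pt I (\<tau> t) \<notin> A" "pt I (\<tau> t) \<notin> B"
      using F G vanishes_at_\<tau> by blast+
    then show False
      using AB(3) pt_\<tau>(1) by blast
  qed
qed

text \<open>Otherwise a point, \<open>T\<close> and \<open>C\<close> would form a chain of
  irreducible sets that is too long for a curve.\<close>

lemma not_subset_curve:
  assumes C: "irreducible_curve I C" and neq: "C \<noteq> T"
  shows "\<not> T \<subseteq> C"
proof
  assume "T \<subseteq> C"
  have "zariski_irreducible I {pt I \<omega>}"
    using pt_\<omega>(2) by (intro zariski_irreducible_singleton) auto
  moreover have "{pt I \<omega>} \<subset> T"
    using pt_\<omega>(1) pt_\<tau>(1)[of 0] pt_\<tau>_neq_\<omega>[of 0] by blast
  ultimately show False
    using C neq \<open>T \<subseteq> C\<close> irreducible unfolding irreducible_curve_def by blast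
qed

text \<open>A form of arbitrary multidegree that equals 1 along the chart. Multiplying by it adjusts
  multidegrees without changing the restriction.\<close>

definition \<Lambda> :: "(nat \<Rightarrow> nat) \<Rightarrow> coords \<Rightarrow> complex" where
  "\<Lambda> d v = (\<Prod>l\<in>I. dot (lam l) (v l) ^ d l)"

lemma \<Lambda>_forms: "\<Lambda> d \<in> forms I d"
proof -
  have "\<Lambda> d \<in> forms I (\<lambda>i. \<Sum>l\<in>I. d l * (if i = l then 1 else 0))"
    unfolding \<Lambda>_def by (intro forms_prod forms_power forms_dot) auto
  also have "\<dots> = forms I d"
    by (rule forms_degree_cong) (auto simp: if_distrib cong: if_cong)
  finally show ?thesis .
qed

lemma \<Lambda>_\<tau>: "\<Lambda> d (\<tau> t) = 1"
  by (simp add: \<Lambda>_def lam_\<tau>)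

text \<open>Homogenisation of \<open>g\<close> to degree \<open>N\<close> in the component
  \<open>i0\<close>: \<open>bet\<close> takes the place of t, and \<open>lam i0\<close> is the
  homogenising variable.\<close>

definition Hom :: "nat \<Rightarrow> complex poly \<Rightarrow> coords \<Rightarrow> complex" where
  "Hom N g v = (\<Sum>i\<le>N. coeff g i * (dot bet (v i0) ^ i * dot (lam i0) (v i0) ^ (N - i)))"

lemma Hom_forms: "Hom N g \<in> forms I (\<lambda>l. if l = i0 then N else 0)"
  unfolding Hom_def
proof (intro forms_sum forms_cmult)
  fix i assume "i \<in> {..N}"
  have "(\<lambda>v. dot bet (v i0) ^ i * dot (lam i0) (v i0) ^ (N - i)) \<in> forms I
      (\<lambda>l. i * (if l = i0 then 1 else 0) + (N - i) * (if l = i0 then 1 else 0))"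
    using i0 by (intro forms_mult forms_power forms_dot) auto
  also have "\<dots> = forms I (\<lambda>l. if l = i0 then N else 0)"
    using \<open>i \<in> {..N}\<close> by (intro forms_degree_cong) auto
  finally show "(\<lambda>v. dot bet (v i0) ^ i * dot (lam i0) (v i0) ^ (N - i)) \<in> forms I (\<lambda>l. if l = i0 then N else 0)" .
qed

lemma Hom_\<tau>:
  assumes "degree g \<le> N"
  shows "Hom N g (\<tau> t) = poly g t"
proof -
  have "poly g t = (\<Sum>i\<le>N. coeff g i * t ^ i)"
    unfolding poly_altdef using assms
    by (intro sum.mono_neutral_left) (auto simp: coeff_eq_0)
  then show ?thesis
    by (simp add: Hom_def bet_\<tau> lam_\<tau>[OF i0])
qed

lemma pull_Hom: "degree g \<le> N \<Longrightarrow> pull (Hom N g) = g"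
  by (rule pull_eqI[OF Hom_forms]) (simp add: Hom_\<tau>)

text \<open>The ideal in C[t] of the scheme-theoretic intersection of \<open>T\<close> and
  \<open>C\<close>, seen in the affine chart of \<open>T\<close>.\<close>

definition trace_ideal :: "(nat \<Rightarrow> point) set \<Rightarrow> complex poly set" where
  "trace_ideal C = {pull F | F d. F \<in> forms I d \<and> (\<forall>q\<in>C. vanishes_at I F q)}"

lemma trace_idealI: "F \<in> forms I d \<Longrightarrow> (\<And>q. q \<in> C \<Longrightarrow> vanishes_at I F q) \<Longrightarrow> pull F \<in> trace_ideal C"
  by (auto simp: trace_ideal_def)

text \<open>The two forms may have different multidegrees; each is first multiplied by the
  \<open>\<Lambda>\<close> of the other's multidegree.\<close>

lemma trace_ideal_add:
  assumes "f \<in> trace_ideal C" "g \<in> trace_ideal C"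
  shows "f + g \<in> trace_ideal C"
proof -
  obtain F d where F: "F \<in> forms I d" "\<forall>q\<in>C. vanishes_at I F q" "f = pull F"
    using assms(1) by (auto simp: trace_ideal_def)
  obtain G e where G: "G \<in> forms I e" "\<forall>q\<in>C. vanishes_at I G q" "g = pull G"
    using assms(2) by (auto simp: trace_ideal_def)
  have H: "(\<lambda>v. F v * \<Lambda> e v + \<Lambda> d v * G v) \<in> forms I (\<lambda>i. d i + e i)"
    using F G by (intro forms_add forms_mult \<Lambda>_forms)
  have "pull (\<lambda>v. F v * \<Lambda> e v + \<Lambda> d v * G v) \<in> trace_ideal C"
    using F(2) G(2) by (intro trace_idealI[OF H]) (auto simp: vanishes_at_def)
  moreover have "pull (\<lambda>v. F v * \<Lambda> e v + \<Lambda> d v * G v) = f + g"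
    by (rule pull_eqI[OF H]) (simp add: F G \<Lambda>_\<tau> poly_pull[OF F(1)] poly_pull[OF G(1)])
  ultimately show ?thesis
    by simp
qed

lemma trace_ideal_mult:
  assumes "f \<in> trace_ideal C"
  shows "g * f \<in> trace_ideal C"
proof -
  obtain F d where F: "F \<in> forms I d" "\<forall>q\<in>C. vanishes_at I F q" "f = pull F"
    using assms(1) by (auto simp: trace_ideal_def)
  have "pull (\<lambda>v. Hom (degree g) g v * F v) \<in> trace_ideal C"
    using F(2) by (intro trace_idealI[OF forms_mult[OF Hom_forms F(1)]]) (auto simp: vanishes_at_def)
  then show ?thesis
    by (simp add: pull_mult[OF Hom_forms F(1)] pull_Hom F)
qed

section \<open>Intersection number with a curve that misses the point at infinity\<close>

context
  fixes C :: "(nat \<Rightarrow> point) set"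
  assumes C: "zariski_closed I C" "C \<subseteq> blowup r p" "pt I \<omega> \<notin> C"
begin

text \<open>The ideal is nonzero because \<open>\<omega>\<close> is not on \<open>C\<close>: a form
  that vanishes on \<open>C\<close> but not at \<open>\<omega>\<close> has nonzero
  restriction.\<close>

lemma trace_generator:
  obtains h where "h \<in> trace_ideal C" "h \<noteq> 0" "\<And>f. f \<in> trace_ideal C \<Longrightarrow> h dvd f"
proof -
  obtain d F where F: "F \<in> forms I d" "\<And>q. q \<in> C \<Longrightarrow> vanishes_at I F q" "\<not> vanishes_at I F (pt I \<omega>)"
    by (rule zariski_closedE[OF C(1) pt_\<omega>(2) C(3)]) blast
  then show thesis
    using poly_ideal_principal[of "trace_ideal C" "pull F"] trace_ideal_add trace_ideal_mult
      pull_nonzero[OF F(1) pt_\<omega>(1)] trace_idealI[OF F(1)] that by blast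
qed

context
  fixes h :: "complex poly"
  assumes h: "h \<in> trace_ideal C" "h \<noteq> 0" "\<And>f. f \<in> trace_ideal C \<Longrightarrow> h dvd f"
begin

lemma pt_\<tau>_mem_iff: "pt I (\<tau> t) \<in> C \<longleftrightarrow> poly h t = 0"
proof
  obtain F d where F: "F \<in> forms I d" "\<forall>q\<in>C. vanishes_at I F q" "h = pull F"
    using h(1) by (auto simp: trace_ideal_def)
  assume "pt I (\<tau> t) \<in> C"
  then show "poly h t = 0"
    using F vanishes_at_\<tau> by blast
next
  assume "poly h t = 0"
  show "pt I (\<tau> t) \<in> C"
  proof (rule ccontr)
    assume "pt I (\<tau> t) \<notin> C"
    then obtain d F where F: "F \<in> forms I d" "\<And>q. q \<in> C \<Longrightarrow> vanishes_at I F q" "\<not> vanishes_at I F (pt I (\<tau> t))"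
      by (rule zariski_closedE[OF C(1) pt_\<tau>(2)]) blast
    have "h dvd pull F"
      using h(3) trace_idealI F by blast
    then show False
      using F(1,3) \<open>poly h t = 0\<close> vanishes_at_\<tau>[OF F(1), of t] by (auto elim!: dvdE)
  qed
qed

text \<open>With F / G representing \<open>\<psi>\<close> and \<open>G'\<close> the denominator off
  which it vanishes on \<open>C\<close>, the product F G G' is a form that vanishes on all of
  \<open>C\<close>, so \<open>h\<close> divides its restriction. Since \<open>G\<close> and
  \<open>G'\<close> are nonzero at \<open>t0\<close>, the whole power of t - t0 divides the
  restriction of \<open>F\<close>.\<close>

lemma local_ideal_curve_pull:
  assumes "\<psi> \<in> local_ideal r p C (pt I (\<tau> t0))"
  obtains f g where "poly g t0 \<noteq> 0" "[:- t0, 1:] ^ order t0 h dvd f"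
    "\<And>t. poly g t \<noteq> 0 \<Longrightarrow> \<psi> (pt I (\<tau> t)) = poly f t / poly g t"
proof -
  let ?P = "pt I (\<tau> t0)"
  obtain d F G where F: "F \<in> forms I d" "G \<in> forms I d" "\<not> vanishes_at I G ?P"
    "\<forall>q\<in>blowup r p. \<forall>v\<in>reps I q. G v \<noteq> 0 \<longrightarrow> \<psi> q = F v / G v"
    using assms unfolding local_ideal_def regular_at_def by blast
  obtain e G' where G': "G' \<in> forms I e" "\<not> vanishes_at I G' ?P" "\<forall>q\<in>C. \<not> vanishes_at I G' q \<longrightarrow> \<psi> q = 0"
    using assms unfolding local_ideal_def by blast
  have "vanishes_at I (\<lambda>v. F v * G v * G' v) q" if q: "q \<in> C" for q
    unfolding vanishes_at_def
  proof
    fix v assume v: "v \<in> reps I q"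
    show "F v * G v * G' v = 0"
    proof (cases "G v = 0 \<or> G' v = 0")
      case False
      then have "\<psi> q = F v / G v" "\<psi> q = 0"
        using F(4) G'(3) v q C(2) unfolding vanishes_at_def by blast+
      then show ?thesis
        using False by auto
    qed auto
  qed
  then have "h dvd pull (\<lambda>v. F v * G v * G' v)"
    by (intro h(3) trace_idealI[OF forms_mult[OF forms_mult[OF F(1,2)] G'(1)]])
  also have "pull (\<lambda>v. F v * G v * G' v) = pull F * pull G * pull G'"
    using F G' by (simp add: pull_mult[OF forms_mult[OF F(1,2)] G'(1)] pull_mult[OF F(1,2)])
  finally have dvd: "[:- t0, 1:] ^ order t0 h dvd pull F * (pull G * pull G')"
    using order_1[of t0 h] by (metis dvd_trans mult.assoc)
  have nz: "poly (pull G) t0 \<noteq> 0" "poly (pull G') t0 \<noteq> 0"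
    using F(3) G'(2) by (simp_all add: vanishes_at_\<tau>[OF F(2)] vanishes_at_\<tau>[OF G'(1)])
  have "[:- t0, 1:] ^ order t0 h dvd pull F"
  proof (cases "pull F = 0")
    case False
    moreover have nz': "pull G * pull G' \<noteq> 0" "poly (pull G * pull G') t0 \<noteq> 0"
      using nz by auto
    ultimately have "order t0 h \<le> order t0 (pull F) + order t0 (pull G * pull G')"
      using dvd order_divides[of t0 "order t0 h" "pull F * (pull G * pull G')"]
        order_mult[of "pull F" "pull G * pull G'" t0] by simp
    moreover have "order t0 (pull G * pull G') = 0"
      using nz'(2) by (rule order_0I)
    ultimately show ?thesis
      by (simp add: order_divides)
  qed simp
  then show thesis
    using that[of "pull G" "pull F"] nz F(4) pt_\<tau>(3) reps_pt_self
    by (simp add: poly_pull[OF F(1), symmetric] poly_pull[OF F(2), symmetric])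
qed

text \<open>Modulo the ideal of \<open>T\<close>, a local function is a rational function of t;
  modulo that of \<open>C\<close>, its numerator counts modulo \<open>h\<close>. The quotient is
  thus the localisation of C[t] at \<open>t0\<close> modulo \<open>h\<close>, and the powers of t -
  t0 below the order of \<open>h\<close> induce a basis. The work lies in lifting: every relation
  along \<open>T\<close> has to come from functions on the blow-up.\<close>

lemma quot_dim_local_rings:
  assumes t0: "poly h t0 = 0"
  shows "quot_dim (regular_at r p (pt I (\<tau> t0)))
      {\<lambda>q. \<phi> q + \<psi> q | \<phi> \<psi>. \<phi> \<in> local_ideal r p T (pt I (\<tau> t0)) \<and> \<psi> \<in> local_ideal r p C (pt I (\<tau> t0))} =
    order t0 h"
proof -
  let ?P = "pt I (\<tau> t0)"
  let ?W = "{\<lambda>q. \<phi> q + \<psi> q | \<phi> \<psi>. \<phi> \<in> local_ideal r p T ?P \<and> \<psi> \<in> local_ideal r p C ?P}"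
  let ?n = "order t0 h"
  let ?x = "[:- t0, 1:]"
  \<comment> \<open>A lift of the \<open>i\<close>-th power of t - t0; the denominator is a power of
    \<open>lam i0\<close>, which equals 1 on the chart.\<close>
  define f where "f i = ratio I (Hom i (?x ^ i)) (Hom i 1)" for i
  have degx: "degree (?x ^ i) \<le> i" for i
    by (simp add: degree_linear_power)
  have f_\<tau>: "f i (pt I (\<tau> t)) = poly (?x ^ i) t" for i t
    unfolding f_def using ratio_eq[OF Hom_forms Hom_forms pt_\<tau>(2) reps_pt_self, of i 1 t] degx[of i]
    by (simp add: Hom_\<tau>)
  have f_regular: "f i \<in> regular_at r p ?P" for i
    unfolding f_def by (intro regular_at_ratio[OF Hom_forms Hom_forms]) (simp add: vanishes_at_\<tau>[OF Hom_forms] pull_Hom)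
  have W: "cfun.subspace ?W"
    using cfun.subspace_sums[OF local_ideal_subspace[OF pt_\<tau>(2)] local_ideal_subspace[OF pt_\<tau>(2)]]
    by (simp add: plus_fun_def)
  have sumf: "(\<Sum>i<?n. (\<lambda>v. y i * f i v)) = (\<lambda>q. \<Sum>i<?n. y i * f i q)" for y
    by (rule sum_fun_eq)
  have "quot_dim (regular_at r p ?P) ?W = card {..<?n}"
  proof (rule quot_dim_eq[OF W, where f = f])
    show "f ` {..<?n} \<subseteq> regular_at r p ?P"
      using f_regular by blast
  next
    fix y assume "(\<Sum>i\<in>{..<?n}. (\<lambda>v. y i * f i v)) \<in> ?W"
    then obtain \<phi> \<psi> where \<phi>: "\<phi> \<in> local_ideal r p T ?P" and \<psi>: "\<psi> \<in> local_ideal r p C ?P"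
      and eq: "(\<lambda>q. \<Sum>i<?n. y i * f i q) = (\<lambda>q. \<phi> q + \<psi> q)"
      unfolding sumf by blast
    define U where "U = (\<Sum>i<?n. smult (y i) (?x ^ i))"
    have U: "poly U t = \<phi> (pt I (\<tau> t)) + \<psi> (pt I (\<tau> t))" for t
      using fun_cong[OF eq, of "pt I (\<tau> t)"] by (simp add: U_def f_\<tau> poly_sum)
    obtain d G where G: "G \<in> forms I d" "\<not> vanishes_at I G ?P" "\<forall>q\<in>T. \<not> vanishes_at I G q \<longrightarrow> \<phi> q = 0"
      using \<phi> unfolding local_ideal_def by blast
    obtain k g where k: "poly g t0 \<noteq> 0" "?x ^ ?n dvd k"
      "\<And>t. poly g t \<noteq> 0 \<Longrightarrow> \<psi> (pt I (\<tau> t)) = poly k t / poly g t"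
      by (rule local_ideal_curve_pull[OF \<psi>]) blast
    \<comment> \<open>Where no denominator vanishes, \<open>\<phi>\<close> is 0 on the chart and the
      combination agrees with \<open>\<psi>\<close>; multiplying by the denominator \<open>g\<close>
      gives a polynomial identity.\<close>
    have "U * g = k"
    proof (rule poly_eq_iff_nonzero)
      fix t assume t: "poly (pull G * g) t \<noteq> 0"
      then have "\<phi> (pt I (\<tau> t)) = 0"
        using G(3) pt_\<tau>(1) vanishes_at_\<tau>[OF G(1), of t] by (metis mult_zero_left poly_mult)
      moreover have "poly g t \<noteq> 0"
        using t by simp
      ultimately show "poly (U * g) t = poly k t"
        using k(3)[of t] by (simp add: U)
    next
      show "pull G * g \<noteq> 0"
        using G(2) k(1) vanishes_at_\<tau>[OF G(1), of t0] by fastforce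
    qed
    have "?x ^ ?n dvd U"
    proof (cases "U = 0")
      case False
      have "?n \<le> order t0 (U * g)"
        using k(2) \<open>U * g = k\<close> False k(1) order_divides[of t0 ?n "U * g"] by auto
      also have "\<dots> = order t0 U"
        using False k(1) order_mult[of U g t0] order_0I[OF k(1)] by fastforce
      finally show ?thesis
        by (simp add: order_divides)
    qed simp
    then show "\<forall>i\<in>{..<?n}. y i = 0"
      unfolding U_def using linear_factor_power_dvd_expansion by blast
  next
    show "regular_at r p ?P \<subseteq> cfun.span (f ` {..<?n} \<union> ?W)"
    proof
      fix \<theta> assume \<theta>: "\<theta> \<in> regular_at r p ?P"
      then obtain d F G where F: "F \<in> forms I d" "G \<in> forms I d" "\<not> vanishes_at I G ?P"
        "\<forall>q\<in>blowup r p. \<forall>v\<in>reps I q. G v \<noteq> 0 \<longrightarrow> \<theta> q = F v / G v"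
        unfolding regular_at_def by blast
      have \<theta>_\<tau>: "\<theta> (pt I (\<tau> t)) = poly (pull F) t / poly (pull G) t" if "poly (pull G) t \<noteq> 0" for t
        using F(4) pt_\<tau>(3) reps_pt_self that
        by (simp add: poly_pull[OF F(1), symmetric] poly_pull[OF F(2), symmetric])
      have G_t0: "poly (pull G) t0 \<noteq> 0"
        using F(3) by (simp add: vanishes_at_\<tau>[OF F(2)])
      obtain y k where yk: "pull F - (\<Sum>i<?n. smult (y i) (?x ^ i)) * pull G = ?x ^ ?n * k"
        using poly_quotient_expansion[OF G_t0] by blast
      obtain h1 where h1: "h = ?x ^ ?n * h1"
        using order_1[of t0 h] by (elim dvdE)
      have h1_t0: "poly h1 t0 \<noteq> 0"
        using order_decomp[OF h(2), of t0] h1 poly_eq_0_iff_dvd h(2)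
        by (metis mult_left_cancel mult_zero_left)
      obtain \<Psi> e where \<Psi>: "\<Psi> \<in> forms I e" "\<forall>q\<in>C. vanishes_at I \<Psi> q" "h = pull \<Psi>"
        using h(1) by (auto simp: trace_ideal_def)
      \<comment> \<open>The remainder of the expansion of \<open>\<theta>\<close> is (t - t0)^n k /
        pull G along \<open>T\<close>. To extend it to a function that vanishes on \<open>C\<close>,
        it is rewritten as h k / (h1 pull G), where the factor h is the restriction of
        \<open>\<Psi>\<close>, a form that is zero on \<open>C\<close>.\<close>
      define m where "m = pull G * h1"
      define N where "N = max (degree k) (degree m)"
      define A where "A v = \<Psi> v * Hom N k v" for v
      define B where "B v = \<Lambda> e v * Hom N m v" for v
      have A: "A \<in> forms I (\<lambda>i. e i + (if i = i0 then N else 0))"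
        unfolding A_def by (rule forms_mult[OF \<Psi>(1) Hom_forms])
      have B: "B \<in> forms I (\<lambda>i. e i + (if i = i0 then N else 0))"
        unfolding B_def by (rule forms_mult[OF \<Lambda>_forms Hom_forms])
      have A_\<tau>: "A (\<tau> t) = poly (h * k) t" and B_\<tau>: "B (\<tau> t) = poly m t" for t
        by (simp_all add: A_def B_def \<Lambda>_\<tau> Hom_\<tau> N_def poly_pull[OF \<Psi>(1)] \<Psi>(3))
      have B_P: "\<not> vanishes_at I B ?P"
        using G_t0 h1_t0 by (simp add: vanishes_at_pt[OF B] B_\<tau> m_def)
      define \<psi> where "\<psi> = ratio I A B"
      have \<psi>_regular: "\<psi> \<in> regular_at r p ?P"
        unfolding \<psi>_def by (rule regular_at_ratio[OF A B B_P])
      have \<psi>_\<tau>: "\<psi> (pt I (\<tau> t)) = poly (h * k) t / poly m t" if "poly m t \<noteq> 0" for t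
        unfolding \<psi>_def using ratio_eq[OF A B pt_\<tau>(2) reps_pt_self] that by (simp only: A_\<tau> B_\<tau>)
      have \<psi>: "\<psi> \<in> local_ideal r p C ?P"
        unfolding local_ideal_def mem_Collect_eq
      proof (rule conjI[OF \<psi>_regular], rule exI, rule bexI[OF _ B], rule conjI[OF B_P], intro ballI impI)
        fix q assume q: "q \<in> C" "\<not> vanishes_at I B q"
        then obtain v where v: "v \<in> reps I q" "B v \<noteq> 0"
          unfolding vanishes_at_def by blast
        have "q \<in> P2s I"
          using q C(2) by (auto simp: blowup_def)
        then have "\<psi> q = A v / B v"
          unfolding \<psi>_def using ratio_eq[OF A B] v by blast
        moreover have "A v = 0"
          using \<Psi>(2) q v by (simp add: A_def vanishes_at_def)
        ultimately show "\<psi> q = 0"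
          by simp
      qed
      \<comment> \<open>What is left after subtracting the Taylor part and \<open>\<psi>\<close>
        vanishes along \<open>T\<close>.\<close>
      define \<phi> where "\<phi> q = (\<theta> q + (\<Sum>i<?n. (- y i) * f i q)) + (- 1) * \<psi> q" for q
      have \<phi>: "\<phi> \<in> local_ideal r p T ?P"
        unfolding local_ideal_def mem_Collect_eq
      proof (intro conjI)
        show "\<phi> \<in> regular_at r p ?P"
          unfolding \<phi>_def
          by (intro regular_at_add regular_at_sum regular_at_cmult \<theta> f_regular \<psi>_regular pt_\<tau>(2))
        \<comment> \<open>The factor \<open>lam i0\<close> vanishes at \<open>\<omega>\<close>, so
          that only points of the chart remain to be checked.\<close>
        define G' where "G' v = G v * B v * dot (lam i0) (v i0)" for v
        have G': "G' \<in> forms I (\<lambda>i. d i + (e i + (if i = i0 then N else 0)) + (if i = i0 then 1 else 0))"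
          unfolding G'_def using i0 by (intro forms_mult F B forms_dot) auto
        have G'_\<tau>: "G' (\<tau> t) = poly (pull G) t * poly m t" for t
          by (simp add: G'_def B_\<tau> lam_\<tau>[OF i0] poly_pull[OF F(2)])
        have "\<not> vanishes_at I G' ?P"
          using G_t0 h1_t0 by (simp add: vanishes_at_pt[OF G'] G'_\<tau> m_def)
        moreover have "\<phi> q = 0" if q: "q \<in> T" "\<not> vanishes_at I G' q" for q
        proof -
          have "q \<noteq> pt I \<omega>"
            using q(2) b_i0 lam_b[OF i0] by (auto simp: vanishes_at_pt[OF G'] G'_def \<omega>_def)
          then obtain t where t: "q = pt I (\<tau> t)"
            using q(1) T_eq by blast
          then have nz: "poly (pull G) t \<noteq> 0" "poly m t \<noteq> 0"
            using q(2) by (auto simp: vanishes_at_pt[OF G'] G'_\<tau>)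
          then have nz': "poly h1 t \<noteq> 0"
            by (simp add: m_def)
          have "poly (pull F) t - (\<Sum>i<?n. y i * poly (?x ^ i) t) * poly (pull G) t = poly (?x ^ ?n) t * poly k t"
            using arg_cong[OF yk, of "\<lambda>f. poly f t"] by (simp add: poly_sum)
          moreover have "poly (h * k) t / poly m t = poly (?x ^ ?n) t * poly k t / poly (pull G) t"
            using nz nz' arg_cong[OF h1, of "\<lambda>f. poly f t"] by (simp add: m_def field_simps)
          ultimately have "poly (pull F) t / poly (pull G) t - (\<Sum>i<?n. y i * poly (?x ^ i) t) = poly (h * k) t / poly m t"
            using nz(1) by (simp add: field_simps)
          then show "\<phi> q = 0"
            unfolding \<phi>_def t \<theta>_\<tau>[OF nz(1)] \<psi>_\<tau>[OF nz(2)] f_\<tau> by (simp add: sum_negf)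
        qed
        ultimately show "\<exists>d. \<exists>G\<in>forms I d. \<not> vanishes_at I G ?P \<and> (\<forall>q\<in>T. \<not> vanishes_at I G q \<longrightarrow> \<phi> q = 0)"
          using G' by blast
      qed
      have "(\<lambda>q. \<phi> q + \<psi> q) \<in> ?W"
        using \<phi> \<psi> by blast
      then have 1: "(\<lambda>q. \<phi> q + \<psi> q) \<in> cfun.span (f ` {..<?n} \<union> ?W)"
        by (intro cfun.span_base UnI2)
      have 2: "(\<Sum>i<?n. (\<lambda>v. y i * f i v)) \<in> cfun.span (f ` {..<?n} \<union> ?W)"
        by (intro cfun.span_sum cfun.span_scale cfun.span_base UnI1 imageI)
      have "\<theta> = (\<lambda>q. \<phi> q + \<psi> q) + (\<Sum>i<?n. (\<lambda>v. y i * f i v))"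
        unfolding sumf by (auto simp: \<phi>_def fun_eq_iff sum_negf)
      then show "\<theta> \<in> cfun.span (f ` {..<?n} \<union> ?W)"
        using cfun.span_add[OF 1 2] by simp
    qed
  qed simp
  then show ?thesis
    by simp
qed

text \<open>Since \<open>\<omega>\<close> is off \<open>C\<close>, the intersection points are
  exactly the roots of \<open>h\<close>. Over the complex numbers the orders of the roots add up to
  the degree.\<close>

lemma curve_int_eq_degree: "curve_int r p T C = degree h"
proof -
  let ?R = "{t. poly h t = 0}"
  have "T \<inter> C = (\<lambda>t. pt I (\<tau> t)) ` ?R"
    using T_eq C(3) pt_\<tau>_mem_iff by auto
  moreover have "inj_on (\<lambda>t. pt I (\<tau> t)) ?R"
    by (rule inj_onI) (simp only: pt_\<tau>_inj)
  ultimately have "curve_int r p T C = (\<Sum>t\<in>?R. order t h)"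
    unfolding curve_int_def by (simp add: sum.reindex quot_dim_local_rings)
  also have "\<dots> = size (proots h)"
    using h(2) by (simp add: size_multiset_overloaded_eq)
  also have "\<dots> = degree h"
    by (rule size_proots_complex)
  finally show ?thesis .
qed

end

end

end

subsection \<open>Curves on the blow-up\<close>

lemma on_line_span: "on_line (vec.span {x}) (vec.span {w}) \<longleftrightarrow> dot w x = 0"
proof -
  have "on_line (vec.span {x}) (vec.span {w}) \<longleftrightarrow> (\<forall>c d. d * (c * dot w x) = 0)"
    unfolding on_line_def vec.span_singleton dot_def[symmetric] by (auto simp: dot_simps)
  also have "\<dots> \<longleftrightarrow> dot w x = 0"
    by (auto dest: spec[of _ 1])
  finally show ?thesis .
qed

lemma zariski_closed_Un:
  assumes "zariski_closed I A" "zariski_closed I B"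
  shows "zariski_closed I (A \<union> B)"
proof -
  obtain S S' where S: "S \<subseteq> (\<Union>d. forms I d)" "A = {q \<in> P2s I. \<forall>F\<in>S. vanishes_at I F q}"
    "S' \<subseteq> (\<Union>d. forms I d)" "B = {q \<in> P2s I. \<forall>F\<in>S'. vanishes_at I F q}"
    using assms unfolding zariski_closed_def by blast
  define R where "R = {(\<lambda>v. F v * G v) | F G. F \<in> S \<and> G \<in> S'}"
  have R: "\<exists>d. H \<in> forms I d" if "H \<in> R" for H
    using that S(1,3) forms_mult unfolding R_def by blast
  have "A \<union> B = {q \<in> P2s I. \<forall>F\<in>R. vanishes_at I F q}"
  proof (intro equalityI subsetI)
    fix q assume q: "q \<in> A \<union> B"
    have "vanishes_at I H q" if H: "H \<in> R" for H
    proof -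
      obtain F G where "H = (\<lambda>v. F v * G v)" "F \<in> S" "G \<in> S'"
        using H unfolding R_def by blast
      then show ?thesis
        using q S(2,4) by (auto simp: vanishes_at_def)
    qed
    then show "q \<in> {q \<in> P2s I. \<forall>F\<in>R. vanishes_at I F q}"
      using q S(2,4) by blast
  next
    fix q assume q: "q \<in> {q \<in> P2s I. \<forall>F\<in>R. vanishes_at I F q}"
    show "q \<in> A \<union> B"
    proof (rule ccontr)
      assume "q \<notin> A \<union> B"
      then obtain F G where FG: "F \<in> S" "G \<in> S'" "\<not> vanishes_at I F q" "\<not> vanishes_at I G q"
        using q S(2,4) by blast
      then obtain d e where "F \<in> forms I d" "G \<in> forms I e"
        using S(1,3) by blast
      then have "\<not> vanishes_at I (\<lambda>v. F v * G v) q"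
        using FG q by (intro not_vanishes_at_mult) auto
      moreover have "(\<lambda>v. F v * G v) \<in> R"
        using FG unfolding R_def by blast
      ultimately show False
        using q by blast
    qed
  qed
  then show ?thesis
    using zariski_closed_vanishing_set[of R I] R by simp
qed

lemma zariski_closed_empty: "zariski_closed I {}"
proof -
  have "{} = {q \<in> P2s I. vanishes_at I (\<lambda>v. 1) q}"
    using not_vanishes_at_1 by blast
  also have "zariski_closed I \<dots>"
    by (rule zariski_closed_vanishing[OF forms_1])
  finally show ?thesis .
qed

lemma zariski_closed_finite: "finite A \<Longrightarrow> A \<subseteq> P2s I \<Longrightarrow> finite I \<Longrightarrow> zariski_closed I A"
proof (induction A rule: finite_induct)
  case (insert x A)
  then show ?case
    using zariski_closed_Un[OF zariski_closed_singleton[of x I], of A] by simp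
qed (simp add: zariski_closed_empty)

text \<open>A finite set splits into one of its points and the closed rest. Irreducibility would
  leave a single point, which has no smaller irreducible subset.\<close>

lemma irreducible_curve_infinite:
  assumes C: "irreducible_curve I C" and I: "finite I"
  shows "infinite C"
proof
  assume "finite C"
  obtain Z where Z: "zariski_irreducible I Z" "Z \<subset> C"
    using C unfolding irreducible_curve_def by blast
  then obtain x where x: "x \<in> Z"
    unfolding zariski_irreducible_def by blast
  have irr: "zariski_irreducible I C"
    using C unfolding irreducible_curve_def by blast
  then have "C \<subseteq> P2s I"
    unfolding zariski_irreducible_def using zariski_closed_subset by blast
  then have "zariski_closed I {x}" "zariski_closed I (C - {x})"
    using x Z \<open>finite C\<close> I by (auto intro!: zariski_closed_finite)
  moreover have "C \<subseteq> {x} \<union> (C - {x})"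
    by blast
  ultimately have "C \<subseteq> {x} \<or> C \<subseteq> C - {x}"
    using irr unfolding zariski_irreducible_def by blast
  then show False
    using x Z by blast
qed

text \<open>A closed subset of \<open>T\<close> that omits a point consists of roots of a nonzero
  restriction and possibly \<open>\<omega>\<close>; it is finite, and a curve is not.\<close>

lemma (in rational_curve) curve_not_subset:
  assumes C: "irreducible_curve I C" and neq: "C \<noteq> T"
  shows "\<not> C \<subseteq> T"
proof
  assume sub: "C \<subseteq> T"
  obtain q where q: "q \<in> T" "q \<notin> C"
    using not_subset_curve[OF C neq] by blast
  then have "q \<in> P2s I"
    using T_blowup by (auto simp: blowup_def)
  have "zariski_closed I C"
    using C unfolding irreducible_curve_def zariski_irreducible_def by blast
  then obtain d F where F: "F \<in> forms I d" "\<And>q. q \<in> C \<Longrightarrow> vanishes_at I F q" "\<not> vanishes_at I F q"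
    by (rule zariski_closedE[OF _ \<open>q \<in> P2s I\<close> q(2)]) blast
  have "pull F \<noteq> 0"
    using pull_nonzero F q by blast
  then have "finite {t. poly (pull F) t = 0}"
    by (rule poly_roots_finite)
  moreover have "C \<subseteq> insert (pt I \<omega>) ((\<lambda>t. pt I (\<tau> t)) ` {t. poly (pull F) t = 0})"
    using sub T_eq F(2) vanishes_at_\<tau>[OF F(1)] by blast
  ultimately have "finite C"
    using finite_subset by blast
  then show False
    using irreducible_curve_infinite[OF C] by simp
qed

text \<open>Admits homogeneous parameters (s, t): scaling leads to t / s in the chart if s \<noteq>
  0, and to \<open>\<omega>\<close> otherwise. Constant components are not scaled.\<close>

lemma rational_curveI:
  fixes a b :: coords
  assumes lam: "\<And>l. l \<in> {0..r} \<Longrightarrow> dot (lam l) (a l) = 1" "\<And>l. l \<in> {0..r} \<Longrightarrow> dot (lam l) (b l) = 0"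
    and bet: "i0 \<le> r" "dot bet (a i0) = 0" "dot bet (b i0) = 1"
    and T: "T \<subseteq> blowup r p" "zariski_closed {0..r} T"
    and mem: "\<And>s t. s \<noteq> 0 \<or> t \<noteq> 0 \<Longrightarrow> pt {0..r} (\<lambda>l. if b l = 0 then a l else s *s a l + t *s b l) \<in> T"
    and ex: "\<And>q. q \<in> T \<Longrightarrow> \<exists>s t. (s \<noteq> 0 \<or> t \<noteq> 0) \<and> q = pt {0..r} (\<lambda>l. if b l = 0 then a l else s *s a l + t *s b l)"
  shows "rational_curve r p T a b lam i0 bet"
proof
  let ?x = "\<lambda>s t l. if b l = 0 then a l else s *s a l + t *s b l"
  have \<omega>: "(\<lambda>l. if b l = 0 then a l else b l) = ?x 0 1"
    by (auto simp: fun_eq_iff)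
  have \<tau>: "(\<lambda>l. a l + t *s b l) = ?x 1 t" for t
    by (auto simp: fun_eq_iff)
  have "q \<in> insert (pt {0..r} (?x 0 1)) (range (\<lambda>t. pt {0..r} (?x 1 t)))" if q: "q \<in> T" for q
  proof -
    obtain s t where st: "s \<noteq> 0 \<or> t \<noteq> 0" "q = pt {0..r} (?x s t)"
      using ex[OF q] by blast
    show ?thesis
    proof (cases "s = 0")
      case True
      have "pt {0..r} (?x s t) = pt {0..r} (?x 0 1)"
        using True st(1) by (intro pt_eqI) (auto intro: exI[of _ 1])
      then show ?thesis
        using st(2) by blast
    next
      case False
      have "pt {0..r} (?x s t) = pt {0..r} (?x 1 (t / s))"
      proof (rule pt_eqI)
        show "\<exists>c. c \<noteq> 0 \<and> ?x s t l = c *s ?x 1 (t / s) l" for l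
          using False by (intro exI[of _ "if b l = 0 then 1 else s"]) (simp add: vec_eq_iff algebra_simps)
      qed
      then show ?thesis
        using st(2) by blast
    qed
  qed
  then show "T = insert (pt {0..r} (\<lambda>l. if b l = 0 then a l else b l)) (range (\<lambda>t. pt {0..r} (\<lambda>l. a l + t *s b l)))"
    unfolding \<omega> \<tau> using mem[of 0 1] mem[of 1] by auto
qed (use lam bet T in auto)

section \<open>Equations and parametrisations of the curves on the blow-up\<close>

locale blown_up_points =
  fixes r :: nat and p :: "nat \<Rightarrow> point" and P :: "nat \<Rightarrow> complex ^ 3"
  assumes p_eq: "\<And>j. j \<in> {1..r} \<Longrightarrow> p j = vec.span {P j}"
    and P_nz: "\<And>j. j \<in> {1..r} \<Longrightarrow> P j \<noteq> 0"
    and P_distinct: "\<And>i j. i \<in> {1..r} \<Longrightarrow> j \<in> {1..r} \<Longrightarrow> i \<noteq> j \<Longrightarrow> crs (P i) (P j) \<noteq> 0"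
begin

lemma pt_mem_blowup:
  assumes "\<And>i. i \<in> {0..r} \<Longrightarrow> w i \<noteq> 0"
  shows "pt {0..r} w \<in> blowup r p \<longleftrightarrow> (\<forall>j\<in>{1..r}. dot (w j) (P j) = 0 \<and> dot (w j) (w 0) = 0)"
proof -
  have "on_line (p j) (pt {0..r} w j) \<and> on_line (pt {0..r} w 0) (pt {0..r} w j) \<longleftrightarrow>
      dot (w j) (P j) = 0 \<and> dot (w j) (w 0) = 0" if "j \<in> {1..r}" for j
    using that by (simp add: p_eq pt_nth on_line_span)
  then show ?thesis
    using assms pt_in_P2s[of "{0..r}" w] by (auto simp: blowup_def)
qed

lemma blowup_rep:
  assumes "q \<in> blowup r p"
  obtains w where "\<And>i. i \<in> {0..r} \<Longrightarrow> w i \<noteq> 0" "q = pt {0..r} w"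
    "\<And>j. j \<in> {1..r} \<Longrightarrow> dot (w j) (P j) = 0" "\<And>j. j \<in> {1..r} \<Longrightarrow> dot (w j) (w 0) = 0"
proof -
  have "q \<in> P2s {0..r}"
    using assms by (simp add: blowup_def)
  then obtain w where "\<And>i. i \<in> {0..r} \<Longrightarrow> w i \<noteq> 0" "q = pt {0..r} w"
    by (rule P2s_rep) blast
  then show thesis
    using that pt_mem_blowup[of w] assms by blast
qed

lemma zariski_closed_incidence:
  assumes "j \<in> {1..r}"
  shows "zariski_closed {0..r} {q \<in> P2s {0..r}. on_line (q 0) (q j)}"
proof (rule zariski_closed_form_pt)
  show "(\<lambda>v. \<Sum>k\<in>UNIV. v j $ k * v 0 $ k) \<in> forms {0..r} (\<lambda>l. (if l = j then 1 else 0) + (if l = 0 then 1 else 0))"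
    using assms by (intro forms_sum forms_mult forms_nth) auto
qed (use assms in \<open>simp add: pt_nth on_line_span dot_def\<close>)

lemma zariski_closed_on_line_fixed:
  assumes "j \<in> {0..r}"
  shows "zariski_closed {0..r} {q \<in> P2s {0..r}. on_line (vec.span {x}) (q j)}"
proof (rule zariski_closed_form_pt)
  show "(\<lambda>v. dot x (v j)) \<in> forms {0..r} (\<lambda>l. if l = j then 1 else 0)"
    using assms by (intro forms_dot) auto
qed (use assms in \<open>simp add: pt_nth on_line_span dot_commute\<close>)

lemma zariski_closed_on_fixed_line:
  assumes "j \<in> {0..r}"
  shows "zariski_closed {0..r} {q \<in> P2s {0..r}. on_line (q j) (vec.span {x})}"
proof (rule zariski_closed_form_pt)
  show "(\<lambda>v. dot x (v j)) \<in> forms {0..r} (\<lambda>l. if l = j then 1 else 0)"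
    using assms by (intro forms_dot) auto
qed (use assms in \<open>simp add: pt_nth on_line_span\<close>)

lemma zariski_closed_blowup: "zariski_closed {0..r} (blowup r p)"
proof -
  have "blowup r p = {q \<in> P2s {0..r}. \<forall>j\<in>{1..r}.
      q \<in> {q \<in> P2s {0..r}. on_line (vec.span {P j}) (q j)} \<inter> {q \<in> P2s {0..r}. on_line (q 0) (q j)}}"
    using p_eq by (auto simp: blowup_def)
  also have "zariski_closed {0..r} \<dots>"
    by (intro zariski_closed_INT zariski_closed_Int zariski_closed_on_line_fixed zariski_closed_incidence) auto
  finally show ?thesis .
qed

lemma zariski_closed_line_preimage: "zariski_closed {0..r} (line_preimage r p (vec.span {n}))"
proof -
  have "line_preimage r p (vec.span {n}) = blowup r p \<inter> {q \<in> P2s {0..r}. on_line (q 0) (vec.span {n})}"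
    by (auto simp: line_preimage_def blowup_def)
  then show ?thesis
    using zariski_closed_Int[OF zariski_closed_blowup zariski_closed_on_fixed_line[of 0 n]] by simp
qed

lemma zariski_closed_exceptional_curve:
  assumes j: "j \<in> {1..r}"
  shows "zariski_closed {0..r} (exceptional_curve r p j)"
proof -
  have "exceptional_curve r p j = blowup r p \<inter> {q \<in> P2s {0..r}. q 0 = vec.span {P j}}"
    using p_eq[OF j] by (auto simp: exceptional_curve_def blowup_def)
  also have "zariski_closed {0..r} \<dots>"
    using P_nz[OF j] by (intro zariski_closed_Int zariski_closed_blowup zariski_closed_coordinate_eq) auto
  finally show ?thesis .
qed

text \<open>The line misses all the points \<open>P j\<close>, so over its point x the
  \<open>j\<close>-th component must be the joining line \<open>crs x (P j)\<close>. This is linear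
  in x, hence a linear parametrisation of the line lifts to one of the pullback. An arbitrary point
  \<open>q\<close> can be put at infinity.\<close>

lemma line_preimage_rational_curve:
  assumes n: "n \<noteq> 0" "\<And>j. j \<in> {1..r} \<Longrightarrow> dot n (P j) \<noteq> 0"
    and q: "q \<in> line_preimage r p (vec.span {n})"
  obtains a b lam bet where
    "rational_curve r p (line_preimage r p (vec.span {n})) a b lam 0 bet"
    "pt {0..r} (\<lambda>l. if b l = 0 then a l else b l) = q"
    "crs (a 0) (b 0) = n"
    "\<And>j. j \<in> {1..r} \<Longrightarrow> a j = crs (a 0) (P j) \<and> b j = crs (b 0) (P j)"
proof -
  let ?T = "line_preimage r p (vec.span {n})"
  have "q \<in> blowup r p"
    using q by (simp add: line_preimage_def)
  then obtain w where w: "\<And>i. i \<in> {0..r} \<Longrightarrow> w i \<noteq> 0" "q = pt {0..r} w"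
    "\<And>j. j \<in> {1..r} \<Longrightarrow> dot (w j) (P j) = 0" "\<And>j. j \<in> {1..r} \<Longrightarrow> dot (w j) (w 0) = 0"
    by (rule blowup_rep) blast
  have "dot n (w 0) = 0"
    using q by (simp add: line_preimage_def w(2) pt_nth on_line_span)
  then obtain a0 where a0: "dot n a0 = 0" "crs a0 (w 0) = n"
    using perp_plane_basis[of n "w 0"] w(1)[of 0] by auto
  \<comment> \<open>Taking the image of \<open>q\<close> as second basis vector of the line makes
    \<open>q\<close> the point \<open>\<omega>\<close>.\<close>
  define b0 where "b0 = w 0"
  have b0: "dot n b0 = 0" "b0 \<noteq> 0" "crs a0 b0 = n"
    using \<open>dot n (w 0) = 0\<close> w(1)[of 0] a0 by (simp_all add: b0_def)
  define a where "a l = (if l = 0 then a0 else crs a0 (P l))" for l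
  define b where "b l = (if l = 0 then b0 else crs b0 (P l))" for l
  have ab: "crs (a l) (b l) \<noteq> 0" if "l \<in> {0..r}" for l
  proof (cases "l = 0")
    case True
    then show ?thesis
      using b0 n by (simp add: a_def b_def)
  next
    case False
    then have l: "l \<in> {1..r}"
      using that by simp
    \<comment> \<open>The lines joining two points of the line \<open>n\<close> to
      \<open>P l\<close> meet only in \<open>P l\<close>. Up to sign the scalar is the determinant
      of \<open>a0\<close>, \<open>b0\<close> and \<open>P l\<close>, which is nonzero because
      \<open>n\<close> misses \<open>P l\<close>.\<close>
    have "crs (crs a0 (P l)) (crs b0 (P l)) = (- dot n (P l)) *s P l \<or>
        crs (crs a0 (P l)) (crs b0 (P l)) = dot n (P l) *s P l"
      unfolding b0(3)[symmetric]
      by (simp add: vec_eq_iff forall_3 dot_def sum_3 crs_nth algebra_simps)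
    then show ?thesis
      using False n(2)[OF l] P_nz[OF l] by (auto simp: a_def b_def)
  qed
  then have "\<forall>l\<in>{0..r}. \<exists>x y. dot x (a l) = 1 \<and> dot x (b l) = 0 \<and> dot y (a l) = 0 \<and> dot y (b l) = 1"
    using exists_dual_pair by blast
  from bchoice[OF this] obtain lam where
    lam: "\<forall>l\<in>{0..r}. \<exists>y. dot (lam l) (a l) = 1 \<and> dot (lam l) (b l) = 0 \<and> dot y (a l) = 0 \<and> dot y (b l) = 1"
    by blast
  then obtain bet where bet: "dot bet (a 0) = 0" "dot bet (b 0) = 1"
    by fastforce
  have b_nz: "b l \<noteq> 0" if "l \<in> {0..r}" for l
    using ab[OF that] crs_swap[of "a l" "b l"] by (auto simp: crs_simps)
  have pt_eq: "pt {0..r} (\<lambda>l. if b l = 0 then a l else s *s a l + t *s b l) = pt {0..r} (\<lambda>l. s *s a l + t *s b l)"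
    for s t
    unfolding pt_def using b_nz by (intro restrict_ext) simp
  have T_iff: "pt {0..r} v \<in> ?T \<longleftrightarrow>
      dot n (v 0) = 0 \<and> (\<forall>j\<in>{1..r}. dot (v j) (P j) = 0 \<and> dot (v j) (v 0) = 0)"
    if "\<And>i. i \<in> {0..r} \<Longrightarrow> v i \<noteq> 0" for v
    using pt_mem_blowup[OF that] by (auto simp: line_preimage_def pt_nth on_line_span)
  have comb: "s *s a j + t *s b j = crs (s *s a0 + t *s b0) (P j)" if "j \<in> {1..r}" for s t j
    using that by (simp add: a_def b_def crs_simps)
  have T_eqI: "pt {0..r} v = pt {0..r} (\<lambda>l. s *s a l + t *s b l)"
    if v: "\<And>i. i \<in> {0..r} \<Longrightarrow> v i \<noteq> 0" "pt {0..r} v \<in> ?T" "v 0 = s *s a0 + t *s b0" for v s t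
  proof (rule pt_eqI)
    fix i assume i: "i \<in> {0..r}"
    show "\<exists>d. d \<noteq> 0 \<and> v i = d *s (s *s a i + t *s b i)"
    proof (cases "i = 0")
      case True
      then show ?thesis
        using v(3) by (intro exI[of _ 1]) (simp add: a_def b_def)
    next
      case False
      then have i': "i \<in> {1..r}"
        using i by simp
      have perp: "dot n (v 0) = 0" "dot (v i) (P i) = 0" "dot (v i) (v 0) = 0"
        using T_iff[of v] v(1,2) i' by blast+
      have "crs (v 0) (P i) \<noteq> 0"
      proof
        assume "crs (v 0) (P i) = 0"
        then obtain d where "P i = d *s v 0"
          using crs_eq_0D v(1)[of 0] by auto
        then show False
          using perp(1) n(2)[OF i'] by (simp add: dot_simps)
      qed
      then obtain d where d: "v i = d *s crs (v 0) (P i)"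
        using perp_pair_crs perp by blast
      then have "d \<noteq> 0"
        using v(1)[OF i] by auto
      then show ?thesis
        using d comb[OF i'] v(3) by auto
    qed
  qed
  have mem: "pt {0..r} (\<lambda>l. s *s a l + t *s b l) \<in> ?T" if st: "s \<noteq> 0 \<or> t \<noteq> 0" for s t
  proof -
    have nz: "s *s a l + t *s b l \<noteq> 0" if l: "l \<in> {0..r}" for l
    proof
      assume 0: "s *s a l + t *s b l = 0"
      obtain y where "dot (lam l) (a l) = 1" "dot (lam l) (b l) = 0" "dot y (a l) = 0" "dot y (b l) = 1"
        using lam l by blast
      then show False
        using st arg_cong[OF 0, of "dot (lam l)"] arg_cong[OF 0, of "dot y"] by (auto simp: dot_simps)
    qed
    have "dot n (s *s a 0 + t *s b 0) = 0"
      using a0 b0 by (simp add: a_def b_def dot_simps)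
    moreover have "dot (s *s a j + t *s b j) (P j) = 0 \<and> dot (s *s a j + t *s b j) (s *s a 0 + t *s b 0) = 0"
      if "j \<in> {1..r}" for j
      unfolding comb[OF that] by (simp add: a_def b_def dot_crs_self)
    ultimately show ?thesis
      using T_iff[of "\<lambda>l. s *s a l + t *s b l"] nz by blast
  qed
  have "rational_curve r p ?T a b lam 0 bet"
  proof (rule rational_curveI)
    show "pt {0..r} (\<lambda>l. if b l = 0 then a l else s *s a l + t *s b l) \<in> ?T" if "s \<noteq> 0 \<or> t \<noteq> 0" for s t
      unfolding pt_eq by (rule mem[OF that])
    fix x assume x: "x \<in> ?T"
    then have "x \<in> blowup r p"
      by (simp add: line_preimage_def)
    then obtain v where v: "\<And>i. i \<in> {0..r} \<Longrightarrow> v i \<noteq> 0" "x = pt {0..r} v"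
      by (rule blowup_rep) blast
    have "dot (v 0) (crs a0 b0) = 0"
      using x v T_iff[of v] b0(3) by (simp add: dot_commute)
    then obtain s t where st: "v 0 = s *s a0 + t *s b0"
      using perp_crs_span[of a0 b0 "v 0"] b0(3) n by blast
    then have "s \<noteq> 0 \<or> t \<noteq> 0"
      using v(1)[of 0] by auto
    then show "\<exists>s t. (s \<noteq> 0 \<or> t \<noteq> 0) \<and> x = pt {0..r} (\<lambda>l. if b l = 0 then a l else s *s a l + t *s b l)"
      unfolding pt_eq using T_eqI[of v, OF v(1) _ st] x v(2) by blast
  qed (use lam bet zariski_closed_line_preimage in \<open>auto simp: line_preimage_def\<close>)
  moreover have "(\<lambda>l. if b l = 0 then a l else b l) = (\<lambda>l. if b l = 0 then a l else 0 *s a l + 1 *s b l)"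
    by (auto simp: fun_eq_iff)
  then have "pt {0..r} (\<lambda>l. if b l = 0 then a l else b l) = q"
    using T_eqI[of w 0 1] pt_eq[of 0 1] w(1) q unfolding w(2) by (simp only:) (simp add: b0_def)
  ultimately show thesis
    using that[of a b lam bet] b0(3) by (auto simp: a_def b_def)
qed

text \<open>Over \<open>p j\<close> only the component \<open>j\<close> moves, through the pencil of
  lines at \<open>P j\<close>. For l other than 0 and j, the component is fixed as the line joining
  \<open>P j\<close> and \<open>P l\<close>, and the component 0 is the point itself. These have
  \<open>b l = 0\<close>. The line that belongs to \<open>q\<close> is put at infinity.\<close>

lemma exceptional_rational_curve:
  assumes j: "j \<in> {1..r}" and q: "q \<in> exceptional_curve r p j"
  obtains a b lam bet where
    "rational_curve r p (exceptional_curve r p j) a b lam j bet"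
    "pt {0..r} (\<lambda>l. if b l = 0 then a l else b l) = q"
    "a 0 = P j" "b 0 = 0" "dot (a j) (P j) = 0" "dot (b j) (P j) = 0"
proof -
  let ?T = "exceptional_curve r p j"
  have "q \<in> blowup r p"
    using q by (simp add: exceptional_curve_def)
  then obtain w where w: "\<And>i. i \<in> {0..r} \<Longrightarrow> w i \<noteq> 0" "q = pt {0..r} w"
    "\<And>j. j \<in> {1..r} \<Longrightarrow> dot (w j) (P j) = 0" "\<And>j. j \<in> {1..r} \<Longrightarrow> dot (w j) (w 0) = 0"
    by (rule blowup_rep) blast
  have j': "j \<in> {0..r}" "j \<noteq> 0"
    using j by auto
  obtain a0 where a0: "dot (P j) a0 = 0" "crs a0 (w j) = P j"
    using perp_plane_basis[of "P j" "w j"] w(1)[OF j'(1)] w(3)[OF j] by (auto simp: dot_commute)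
  define a where "a l = (if l = 0 then P j else if l = j then a0 else crs (P j) (P l))" for l
  define b where "b l = (if l = j then w j else 0)" for l
  have a_nz: "a l \<noteq> 0" if "l \<in> {0..r}" for l
    using that P_nz[OF j] P_distinct[OF j, of l] a0(2) by (auto simp: a_def crs_simps)
  have "\<exists>x. dot x (a l) = 1 \<and> dot x (b l) = 0" if l: "l \<in> {0..r}" for l
  proof (cases "l = j")
    case True
    then show ?thesis
      using exists_dual_pair[of a0 "w j"] a0 P_nz[OF j] j' by (auto simp: a_def b_def)
  next
    case False
    then show ?thesis
      using exists_dot_eq_1[OF a_nz[OF l]] by (simp add: b_def dot_simps)
  qed
  then have "\<forall>l\<in>{0..r}. \<exists>x. dot x (a l) = 1 \<and> dot x (b l) = 0"
    by blast
  from bchoice[OF this] obtain lam where lam: "\<forall>l\<in>{0..r}. dot (lam l) (a l) = 1 \<and> dot (lam l) (b l) = 0"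
    by blast
  obtain l' bet where bet: "dot l' a0 = 1" "dot l' (w j) = 0" "dot bet a0 = 0" "dot bet (w j) = 1"
    using exists_dual_pair[of a0 "w j"] a0 P_nz[OF j] by auto
  have T_iff: "pt {0..r} v \<in> ?T \<longleftrightarrow>
      crs (P j) (v 0) = 0 \<and> (\<forall>j\<in>{1..r}. dot (v j) (P j) = 0 \<and> dot (v j) (v 0) = 0)"
    if "\<And>i. i \<in> {0..r} \<Longrightarrow> v i \<noteq> 0" for v
    using pt_mem_blowup[OF that] span_eq_span_iff_crs[of "v 0" "P j"] that[of 0] P_nz[OF j]
    by (auto simp: exceptional_curve_def pt_nth p_eq[OF j])
  define x where "x s t l = (if l = j then s *s a0 + t *s w j else a l)" for s t l
  have T_eqI: "pt {0..r} v = pt {0..r} (x s t)"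
    if v: "\<And>i. i \<in> {0..r} \<Longrightarrow> v i \<noteq> 0" "pt {0..r} v \<in> ?T" "v j = s *s a0 + t *s w j" for v s t
  proof (rule pt_eqI)
    have perp: "crs (P j) (v 0) = 0" "\<And>i. i \<in> {1..r} \<Longrightarrow> dot (v i) (P i) = 0"
      "\<And>i. i \<in> {1..r} \<Longrightarrow> dot (v i) (v 0) = 0"
      using T_iff[of v] v(1,2) by blast+
    obtain d where d: "v 0 = d *s P j"
      using crs_eq_0D[OF perp(1) P_nz[OF j]] by blast
    then have d_nz: "d \<noteq> 0"
      using v(1)[of 0] by auto
    fix i assume i: "i \<in> {0..r}"
    consider "i = 0" | "i = j" | "i \<in> {1..r}" "i \<noteq> j"
      using i by fastforce
    then show "\<exists>d. d \<noteq> 0 \<and> v i = d *s x s t i"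
    proof cases
      case 1
      then show ?thesis
        using d d_nz j' by (auto simp: x_def a_def)
    next
      case 2
      then show ?thesis
        using v(3) by (intro exI[of _ 1]) (simp add: x_def)
    next
      case 3
      have "dot (v i) (P j) = 0"
        using perp(3)[OF 3(1)] d_nz unfolding d by (simp add: dot_simps)
      then obtain c' where c': "v i = c' *s crs (P j) (P i)"
        using perp_pair_crs perp(2)[OF 3(1)] P_distinct[OF j 3(1)] 3(2) by metis
      then have "c' \<noteq> 0"
        using v(1)[OF i] by auto
      then show ?thesis
        using c' 3 by (auto simp: x_def a_def)
    qed
  qed
  have mem: "pt {0..r} (x s t) \<in> ?T" if st: "s \<noteq> 0 \<or> t \<noteq> 0" for s t
  proof -
    have nz: "x s t l \<noteq> 0" if l: "l \<in> {0..r}" for l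
    proof (cases "l = j")
      case True
      have "s *s a0 + t *s w j \<noteq> 0"
      proof
        assume 0: "s *s a0 + t *s w j = 0"
        show False
          using st bet arg_cong[OF 0, of "dot l'"] arg_cong[OF 0, of "dot bet"] by (auto simp: dot_simps)
      qed
      then show ?thesis
        using True by (simp add: x_def)
    qed (use a_nz[OF l] in \<open>simp add: x_def\<close>)
    have "crs (P j) (x s t 0) = 0"
      using j' by (simp add: x_def a_def crs_simps)
    moreover have "dot (x s t i) (P i) = 0 \<and> dot (x s t i) (x s t 0) = 0" if "i \<in> {1..r}" for i
      using that j' a0 w(3)[OF j] by (auto simp: x_def a_def dot_simps dot_crs_self dot_commute[of a0])
    ultimately show ?thesis
      using T_iff[of "x s t"] nz by blast
  qed
  have x_eq: "(\<lambda>l. if b l = 0 then a l else s *s a l + t *s b l) = x s t" for s t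
    using w(1)[OF j'(1)] j' by (auto simp: b_def x_def a_def fun_eq_iff)
  have "rational_curve r p ?T a b lam j bet"
  proof (rule rational_curveI)
    show "pt {0..r} (\<lambda>l. if b l = 0 then a l else s *s a l + t *s b l) \<in> ?T" if "s \<noteq> 0 \<or> t \<noteq> 0" for s t
      unfolding x_eq by (rule mem[OF that])
    show "dot bet (a j) = 0" "dot bet (b j) = 1"
      using bet j' by (auto simp: a_def b_def)
    show "zariski_closed {0..r} ?T"
      using j by (rule zariski_closed_exceptional_curve)
    fix y assume y: "y \<in> ?T"
    then have "y \<in> blowup r p"
      by (simp add: exceptional_curve_def)
    then obtain v where v: "\<And>i. i \<in> {0..r} \<Longrightarrow> v i \<noteq> 0" "y = pt {0..r} v"
      "\<And>j. j \<in> {1..r} \<Longrightarrow> dot (v j) (P j) = 0"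
      by (rule blowup_rep) blast
    have "dot (v j) (crs a0 (w j)) = 0"
      unfolding a0(2) using v(3)[OF j] .
    then obtain s t where st: "v j = s *s a0 + t *s w j"
      using perp_crs_span[of a0 "w j" "v j"] a0(2) P_nz[OF j] by auto
    then have "s \<noteq> 0 \<or> t \<noteq> 0"
      using v(1)[OF j'(1)] by auto
    then show "\<exists>s t. (s \<noteq> 0 \<or> t \<noteq> 0) \<and> y = pt {0..r} (\<lambda>l. if b l = 0 then a l else s *s a l + t *s b l)"
      unfolding x_eq using T_eqI[of v, OF v(1) _ st] y v(2) by blast
  qed (use lam j in \<open>auto simp: exceptional_curve_def\<close>)
  moreover have "(\<lambda>l. if b l = 0 then a l else b l) = (\<lambda>l. if b l = 0 then a l else 0 *s a l + 1 *s b l)"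
    by (auto simp: fun_eq_iff)
  then have "pt {0..r} (\<lambda>l. if b l = 0 then a l else b l) = q"
    using T_eqI[of w 0 1] x_eq[of 0 1] w(1) q unfolding w(2) by (simp only:) simp
  moreover have "a 0 = P j" "b 0 = 0" "dot (a j) (P j) = 0" "dot (b j) (P j) = 0"
    using j' a0(1) w(3)[OF j] by (simp_all add: a_def b_def dot_commute)
  ultimately show thesis
    using that by blast
qed

end

subsection \<open>Homogeneous polynomials in three linear coordinates\<close>

definition monomial3 :: "('a \<Rightarrow> complex) \<Rightarrow> ('a \<Rightarrow> complex) \<Rightarrow> ('a \<Rightarrow> complex) \<Rightarrow> nat \<Rightarrow> nat \<Rightarrow> nat \<Rightarrow> 'a \<Rightarrow> complex" where
  "monomial3 l1 l2 l3 i j k x = l1 x ^ i * l2 x ^ j * l3 x ^ k"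

definition graded_part :: "('a \<Rightarrow> complex) \<Rightarrow> ('a \<Rightarrow> complex) \<Rightarrow> ('a \<Rightarrow> complex) \<Rightarrow> nat \<Rightarrow> ('a \<Rightarrow> complex) set" where
  "graded_part l1 l2 l3 e = cfun.span {monomial3 l1 l2 l3 i j k | i j k. i + j + k = e}"

lemma span_mult_const:
  fixes g :: "'a \<Rightarrow> complex"
  assumes "f \<in> cfun.span A" "\<And>a. a \<in> A \<Longrightarrow> (\<lambda>x. g x * a x) \<in> cfun.span B"
  shows "(\<lambda>x. g x * f x) \<in> cfun.span B"
  using assms(1)
proof (induction rule: cfun.span_induct_alt)
  case base
  then show ?case
    using cfun.span_zero[of B] by (simp add: zero_fun_def)
next
  case (step c a f)
  have "(\<lambda>x. c * (g x * a x)) + (\<lambda>x. g x * f x) \<in> cfun.span B"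
    using assms(2)[OF step(1)] step(2) by (intro cfun.span_add cfun.span_scale)
  also have "(\<lambda>x. c * (g x * a x)) + (\<lambda>x. g x * f x) = (\<lambda>x. g x * ((\<lambda>x. c * a x) + f) x)"
    by (auto simp: fun_eq_iff algebra_simps)
  finally show ?case .
qed

lemma span_mult:
  fixes f g :: "'a \<Rightarrow> complex"
  assumes "f \<in> cfun.span A" "g \<in> cfun.span A'" "\<And>a a'. a \<in> A \<Longrightarrow> a' \<in> A' \<Longrightarrow> (\<lambda>x. a x * a' x) \<in> cfun.span B"
  shows "(\<lambda>x. f x * g x) \<in> cfun.span B"
proof (rule span_mult_const[OF assms(2)])
  fix a' assume a': "a' \<in> A'"
  have "(\<lambda>x. a' x * f x) \<in> cfun.span B"
    by (rule span_mult_const[OF assms(1)]) (use assms(3)[OF _ a'] in \<open>simp add: mult.commute\<close>)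
  then show "(\<lambda>x. f x * a' x) \<in> cfun.span B"
    by (simp add: mult.commute)
qed

lemma graded_part_mult:
  assumes "f \<in> graded_part l1 l2 l3 d" "g \<in> graded_part l1 l2 l3 e"
  shows "(\<lambda>x. f x * g x) \<in> graded_part l1 l2 l3 (d + e)"
  unfolding graded_part_def
proof (rule span_mult[OF assms[unfolded graded_part_def]])
  fix a a' assume "a \<in> {monomial3 l1 l2 l3 i j k | i j k. i + j + k = d}"
    "a' \<in> {monomial3 l1 l2 l3 i j k | i j k. i + j + k = e}"
  then obtain i j k i' j' k' where *: "a = monomial3 l1 l2 l3 i j k" "i + j + k = d"
    "a' = monomial3 l1 l2 l3 i' j' k'" "i' + j' + k' = e"
    by blast
  then have "(\<lambda>x. a x * a' x) = monomial3 l1 l2 l3 (i + i') (j + j') (k + k')"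
    by (auto simp: fun_eq_iff monomial3_def power_add)
  moreover have "(i + i') + (j + j') + (k + k') = d + e"
    using * by simp
  ultimately show "(\<lambda>x. a x * a' x) \<in> cfun.span {monomial3 l1 l2 l3 i j k | i j k. i + j + k = d + e}"
    by (auto intro!: cfun.span_base)
qed

lemma graded_part_sum:
  assumes "\<And>i. i \<in> A \<Longrightarrow> f i \<in> graded_part l1 l2 l3 d"
  shows "(\<lambda>x. \<Sum>i\<in>A. f i x) \<in> graded_part l1 l2 l3 d"
  using cfun.span_sum[of A f] assms unfolding graded_part_def sum_fun_eq[symmetric] by blast

lemma graded_part_0: "(\<lambda>x. 0) \<in> graded_part l1 l2 l3 d"
  using graded_part_sum[of "{}"] by simp

text \<open>Grading by the scaling action \<open>s\<close>: as a polynomial in t, the value at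
  \<open>s t x\<close> has as its coefficients the graded parts of \<open>f\<close>. Keeping the
  whole polynomial \<open>q x\<close> lets sums and products be handled by the arithmetic of
  univariate polynomials.\<close>

lemma polys_graded_expansion:
  assumes "f \<in> polys {l1, l2, l3}"
    and l: "\<And>l x t. l \<in> {l1, l2, l3} \<Longrightarrow> l (s t x) = t * l x"
  shows "\<exists>q. (\<forall>d. (\<lambda>x. coeff (q x) d) \<in> graded_part l1 l2 l3 d) \<and> (\<forall>x t. f (s t x) = poly (q x) t)"
  using assms(1)
proof induction
  case (const c)
  have "(\<lambda>x. coeff [:c:] d) \<in> graded_part l1 l2 l3 d" for d
  proof (cases d)
    case 0
    have "monomial3 l1 l2 l3 0 0 0 \<in> graded_part l1 l2 l3 0"
      unfolding graded_part_def by (rule cfun.span_base) auto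
    from cfun.span_scale[OF this[unfolded graded_part_def], of c] show ?thesis
      using 0 by (simp add: monomial3_def graded_part_def)
  qed (simp add: graded_part_0)
  then show ?case
    by (intro exI[of _ "\<lambda>x. [:c:]"]) auto
next
  case (coord f)
  have "(\<lambda>x. coeff [:0, f x:] d) \<in> graded_part l1 l2 l3 d" for d
  proof (cases "d = 1")
    case True
    have "f = monomial3 l1 l2 l3 1 0 0 \<or> f = monomial3 l1 l2 l3 0 1 0 \<or> f = monomial3 l1 l2 l3 0 0 1"
      using coord by (auto simp: monomial3_def fun_eq_iff)
    then have "f \<in> graded_part l1 l2 l3 1"
      unfolding graded_part_def by (intro cfun.span_base) force
    then show ?thesis
      using True by simp
  next
    case False
    then have "coeff [:0, f x:] d = 0" for x
      by (auto simp: coeff_pCons split: nat.split)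
    then show ?thesis
      by (simp add: graded_part_0)
  qed
  moreover have "f (s t x) = poly [:0, f x:] t" for x t
    using l[OF coord] by simp
  ultimately show ?case
    by (intro exI[of _ "\<lambda>x. [:0, f x:]"]) auto
next
  case (add f g)
  then obtain q q' where q: "\<And>d. (\<lambda>x. coeff (q x) d) \<in> graded_part l1 l2 l3 d" "\<And>x t. f (s t x) = poly (q x) t"
    "\<And>d. (\<lambda>x. coeff (q' x) d) \<in> graded_part l1 l2 l3 d" "\<And>x t. g (s t x) = poly (q' x) t"
    by blast
  have "(\<lambda>x. coeff (q x + q' x) d) \<in> graded_part l1 l2 l3 d" for d
    using cfun.span_add[OF q(1)[of d, unfolded graded_part_def] q(3)[of d, unfolded graded_part_def]]
    by (simp add: graded_part_def plus_fun_def)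
  then show ?case
    using q by (intro exI[of _ "\<lambda>x. q x + q' x"]) auto
next
  case (mult f g)
  then obtain q q' where q: "\<And>d. (\<lambda>x. coeff (q x) d) \<in> graded_part l1 l2 l3 d" "\<And>x t. f (s t x) = poly (q x) t"
    "\<And>d. (\<lambda>x. coeff (q' x) d) \<in> graded_part l1 l2 l3 d" "\<And>x t. g (s t x) = poly (q' x) t"
    by blast
  have "(\<lambda>x. coeff (q x * q' x) d) \<in> graded_part l1 l2 l3 d" for d
    unfolding coeff_mult
  proof (rule graded_part_sum)
    fix i assume "i \<in> {..d}"
    then show "(\<lambda>x. coeff (q x) i * coeff (q' x) (d - i)) \<in> graded_part l1 l2 l3 d"
      using graded_part_mult[OF q(1)[of i] q(3)[of "d - i"]] by simp
  qed
  then show ?case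
    using q by (intro exI[of _ "\<lambda>x. q x * q' x"]) auto
qed

lemma homogeneous_in_graded_part:
  assumes "f \<in> polys {l1, l2, l3}"
    and l: "\<And>l x t. l \<in> {l1, l2, l3} \<Longrightarrow> l (s t x) = t * l x"
    and f: "\<And>x t. f (s t x) = t ^ e * f x"
  shows "f \<in> graded_part l1 l2 l3 e"
proof -
  obtain q where q: "\<And>d. (\<lambda>x. coeff (q x) d) \<in> graded_part l1 l2 l3 d" "\<And>x t. f (s t x) = poly (q x) t"
    using polys_graded_expansion[OF assms(1), of s] l by blast
  have "q x = monom (f x) e" for x
    by (rule poly_eq_poly_eq_iff[THEN iffD1]) (simp add: fun_eq_iff q(2)[symmetric] f poly_monom mult.commute)
  then have "f = (\<lambda>x. coeff (q x) e)"
    by simp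
  then show ?thesis
    using q(1)[of e] by simp
qed

subsection \<open>Growth of the coordinate ring of a plane curve\<close>

text \<open>The three coordinates are chosen such that \<open>l1 = 0\<close> is the line under consideration, with
  affine parameter \<open>t \<mapsto> u + t b\<close>.\<close>

locale line_coordinates =
  fixes l1 l2 l3 :: "complex ^ 3 \<Rightarrow> complex" and u b :: "complex ^ 3"
    and W :: "(complex ^ 3 \<Rightarrow> complex) set"
  assumes l_line: "\<And>s t. l1 (s *s u + t *s b) = 0" "\<And>s t. l2 (s *s u + t *s b) = s" "\<And>s t. l3 (s *s u + t *s b) = t"
    and W: "cfun.subspace W" and W_mult: "\<And>f g. f \<in> W \<Longrightarrow> (\<lambda>x. g x * f x) \<in> W"
begin

abbreviation "gr \<equiv> graded_part l1 l2 l3"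

definition line_multiples :: "nat \<Rightarrow> (complex ^ 3 \<Rightarrow> complex) set" where
  "line_multiples e = cfun.span {monomial3 l1 l2 l3 (Suc i) j k | i j k. Suc i + j + k = e}"

lemma line_multiples_zero:
  assumes "f \<in> line_multiples e"
  shows "f (s *s u + t *s b) = 0"
  using assms unfolding line_multiples_def
  by (induction rule: cfun.span_induct_alt) (auto simp: monomial3_def l_line)

text \<open>Modulo multiples of \<open>l1\<close> a form is a binary form in \<open>l2\<close> and
  \<open>l3\<close>, determined by its restriction to the line. The chart point u + t b yields it as
  a polynomial in t, and the point at infinity \<open>b\<close> yields the coefficient of the pure
  power of \<open>l3\<close>.\<close>

lemma graded_part_decomposition:
  assumes "f \<in> gr e"
  obtains c g where "g \<in> line_multiples e" "f = (\<Sum>i\<le>e. (\<lambda>x. c i * monomial3 l1 l2 l3 0 (e - i) i x)) + g"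
    "\<And>t. f (u + t *s b) = (\<Sum>i\<le>e. c i * t ^ i)" "f b = c e"
proof -
  let ?m = "\<lambda>i. monomial3 l1 l2 l3 0 (e - i) i"
  have "\<exists>c. \<exists>g\<in>line_multiples e. f = (\<Sum>i\<le>e. (\<lambda>x. c i * ?m i x)) + g"
    using assms unfolding graded_part_def
  proof (induction rule: cfun.span_induct_alt)
    case base
    have "0 = (\<Sum>i\<le>e. (\<lambda>x. (\<lambda>_. 0) i * ?m i x)) + 0"
      unfolding sum_fun_eq by (simp add: fun_eq_iff)
    moreover have "0 \<in> line_multiples e"
      by (simp add: line_multiples_def cfun.span_zero)
    ultimately show ?case
      by (intro exI[of _ "\<lambda>_. 0"] bexI[of _ 0])
  next
    case (step a m f)
    then obtain c g where cg: "g \<in> line_multiples e" "f = (\<Sum>i\<le>e. (\<lambda>x. c i * ?m i x)) + g"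
      by blast
    obtain i j k where m: "m = monomial3 l1 l2 l3 i j k" "i + j + k = e"
      using step by blast
    show ?case
    proof (cases i)
      case 0
      then have j: "m = ?m k" "k \<le> e"
        using m by auto
      have eq: "(\<Sum>i\<le>e. (c i + (if i = k then a else 0)) * ?m i x) = (\<Sum>i\<le>e. c i * ?m i x) + a * m x" for x
      proof -
        have "(\<Sum>i\<le>e. (c i + (if i = k then a else 0)) * ?m i x) =
            (\<Sum>i\<le>e. c i * ?m i x) + (\<Sum>i\<le>e. if i = k then a * ?m k x else 0)"
          unfolding sum.distrib[symmetric] by (intro sum.cong) (auto simp: algebra_simps)
        then show ?thesis
          using j by simp
      qed
      have "(\<lambda>x. a * m x) + f = (\<Sum>i\<le>e. (\<lambda>x. (c i + (if i = k then a else 0)) * ?m i x)) + g"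
        unfolding cg(2) sum_fun_eq using eq by (auto simp: fun_eq_iff)
      then show ?thesis
        using cg(1) by (intro exI[of _ "\<lambda>i. c i + (if i = k then a else 0)"] bexI[of _ g])
    next
      case (Suc i')
      then have "m \<in> line_multiples e"
        unfolding line_multiples_def using m by (intro cfun.span_base) blast
      then have "(\<lambda>x. a * m x) + g \<in> line_multiples e"
        using cg(1) unfolding line_multiples_def by (intro cfun.span_add cfun.span_scale)
      moreover have "(\<lambda>x. a * m x) + f = (\<Sum>i\<le>e. (\<lambda>x. c i * ?m i x)) + ((\<lambda>x. a * m x) + g)"
        unfolding cg(2) by (simp add: algebra_simps)
      ultimately show ?thesis
        by blast
    qed
  qed
  then obtain c g where cg: "g \<in> line_multiples e" "f = (\<Sum>i\<le>e. (\<lambda>x. c i * ?m i x)) + g"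
    by blast
  have f: "f (s *s u + t *s b) = (\<Sum>i\<le>e. c i * (s ^ (e - i) * t ^ i))" for s t
    unfolding cg(2) sum_fun_eq
    by (simp add: line_multiples_zero[OF cg(1)] monomial3_def l_line del: vector_smult_lid)
  have "f (u + t *s b) = (\<Sum>i\<le>e. c i * t ^ i)" for t
    using f[of 1 t] by simp
  moreover have "f b = c e"
  proof -
    have "f b = (\<Sum>i\<le>e. c i * (0 ^ (e - i) * 1 ^ i))"
      using f[of 0 1] by simp
    also have "\<dots> = (\<Sum>i\<le>e. if i = e then c e else 0)"
      by (intro sum.cong) (auto simp: power_0_left)
    finally show ?thesis
      by simp
  qed
  ultimately show thesis
    using that cg by blast
qed

text \<open>Multiply \<open>F\<close> by the monomial \<open>M\<close> that carries its top term on
  the line, with \<open>l3\<close>-exponent \<open>n\<close>, to the monomial in question. The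
  product lies in \<open>W\<close>. Its other terms have \<open>l3\<close>-exponent below
  \<open>i\<close> or are multiples of \<open>l1\<close>, and these are in \<open>S\<close> already.
  The inequalities on \<open>i\<close> say that \<open>M\<close> has nonnegative exponents.\<close>

lemma monomial_reduction:
  assumes S: "cfun.subspace S" "W \<subseteq> S" "line_multiples k \<subseteq> S"
    and F: "F \<in> W" "F = (\<Sum>i\<le>e. (\<lambda>x. c i * monomial3 l1 l2 l3 0 (e - i) i x)) + g" "g \<in> line_multiples e"
    and n: "n \<le> e" "c n \<noteq> 0" "\<And>i. n < i \<Longrightarrow> i \<le> e \<Longrightarrow> c i = 0"
    and i: "n \<le> i" "i \<le> k" "e - n \<le> k - i"
    and low: "\<And>i'. i' < i \<Longrightarrow> monomial3 l1 l2 l3 0 (k - i') i' \<in> S"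
  shows "monomial3 l1 l2 l3 0 (k - i) i \<in> S"
proof -
  define M where "M = monomial3 l1 l2 l3 0 (k - i - (e - n)) (i - n)"
  let ?m = "\<lambda>k i. monomial3 l1 l2 l3 0 (k - i) i"
  have "(\<lambda>x. M x * g x) \<in> line_multiples k"
    unfolding line_multiples_def
  proof (rule span_mult_const[OF F(3)[unfolded line_multiples_def]])
    fix a assume "a \<in> {monomial3 l1 l2 l3 (Suc i) j k | i j k. Suc i + j + k = e}"
    then obtain i' j' k' where a: "a = monomial3 l1 l2 l3 (Suc i') j' k'" "Suc i' + j' + k' = e"
      by blast
    have "(\<lambda>x. M x * a x) = monomial3 l1 l2 l3 (Suc i') (k - i - (e - n) + j') (i - n + k')"
      by (auto simp: M_def a(1) monomial3_def power_add fun_eq_iff algebra_simps)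
    moreover have "Suc i' + (k - i - (e - n) + j') + (i - n + k') = k"
      using a(2) i n(1) by linarith
    ultimately show "(\<lambda>x. M x * a x) \<in> cfun.span {monomial3 l1 l2 l3 (Suc i) j ka | i j ka. Suc i + j + ka = k}"
      by (intro cfun.span_base) blast
  qed
  then have Mg: "(\<lambda>x. M x * g x) \<in> S"
    using S(3) by blast
  have Mm: "M x * ?m e i' x = ?m k (i - n + i') x" if "i' \<le> n" for i' x
  proof -
    have "k - i - (e - n) + (e - i') = k - (i - n + i')"
      using that i n(1) by linarith
    moreover have "M x * ?m e i' x = l2 x ^ (k - i - (e - n) + (e - i')) * l3 x ^ (i - n + i')"
      by (simp add: M_def monomial3_def power_add)
    ultimately show ?thesis
      by (simp only: monomial3_def power_0 mult_1)
  qed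
  have rest: "(\<Sum>i'<n. (\<lambda>x. c i' * ?m k (i - n + i') x)) \<in> S"
  proof (intro cfun.subspace_sum[OF S(1)] cfun.subspace_scale[OF S(1)])
    fix i' assume "i' \<in> {..<n}"
    then show "?m k (i - n + i') \<in> S"
      using i(1) by (intro low) auto
  qed
  have F_eq: "F x = (\<Sum>i'\<le>n. c i' * ?m e i' x) + g x" for x
  proof -
    have "F x = (\<Sum>i'\<le>e. c i' * ?m e i' x) + g x"
      unfolding F(2) sum_fun_eq by simp
    also have "(\<Sum>i'\<le>e. c i' * ?m e i' x) = (\<Sum>i'\<le>n. c i' * ?m e i' x)"
      using n by (intro sum.mono_neutral_right) auto
    finally show ?thesis .
  qed
  have MF: "M x * F x = (\<Sum>i'\<le>n. c i' * ?m k (i - n + i') x) + M x * g x" for x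
  proof -
    have "M x * (\<Sum>i'\<le>n. c i' * ?m e i' x) = (\<Sum>i'\<le>n. c i' * ?m k (i - n + i') x)"
      unfolding sum_distrib_left by (intro sum.cong refl) (simp add: mult.left_commute[of "M x"] Mm)
    then show ?thesis
      unfolding F_eq by (simp only: distrib_left)
  qed
  have "M x * F x = (\<Sum>i'<n. c i' * ?m k (i - n + i') x) + c n * ?m k i x + M x * g x" for x
    unfolding MF lessThan_Suc_atMost[symmetric] using i(1) by simp
  then have "(\<lambda>x. c n * ?m k i x) = (\<lambda>x. M x * F x) - (\<Sum>i'<n. (\<lambda>x. c i' * ?m k (i - n + i') x)) - (\<lambda>x. M x * g x)"
    unfolding sum_fun_eq by (auto simp: fun_eq_iff)
  also have "\<dots> \<in> S"
    using W_mult[OF F(1), of M] S(2) Mg rest by (intro cfun.subspace_diff[OF S(1)]) auto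
  finally have "(\<lambda>x. (1 / c n) * (c n * ?m k i x)) \<in> S"
    by (rule cfun.subspace_scale[OF S(1)])
  then show ?thesis
    using n(2) by simp
qed

text \<open>In passing from degree k to k + 1, the multiples of \<open>l1\<close> come from the
  previous degree. A monomial in \<open>l2\<close>, \<open>l3\<close> with
  \<open>l3\<close>-exponent i is a new generator for i < deg h, is reduced by \<open>F1\<close> for
  deg h \<le> i < e0, and by \<open>F0\<close> for i \<ge> e0. The last range needs
  \<open>F0 b \<noteq> 0\<close>: the top term of \<open>F0\<close> is then a pure power of
  \<open>l3\<close>, so that nothing is required of the exponent of \<open>l2\<close>. Hence each
  step costs at most deg h generators.\<close>

lemma graded_part_growth:
  assumes F0: "F0 \<in> W" "F0 \<in> gr e0" "F0 b \<noteq> 0"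
    and F1: "F1 \<in> W" "F1 \<in> gr e1" "\<And>t. F1 (u + t *s b) = poly h t" "h \<noteq> 0"
  shows "\<exists>K0 K1. \<forall>k\<ge>K0. \<exists>B. finite B \<and> card B \<le> K1 + k * degree h \<and> gr k \<subseteq> cfun.span (B \<union> W)"
proof -
  let ?m = "\<lambda>k i. monomial3 l1 l2 l3 0 (k - i) i"
  let ?n = "degree h"
  obtain c0 g0 where c0: "g0 \<in> line_multiples e0" "F0 = (\<Sum>i\<le>e0. (\<lambda>x. c0 i * ?m e0 i x)) + g0" "F0 b = c0 e0"
    by (rule graded_part_decomposition[OF F0(2)]) blast
  obtain c1 g1 where c1: "g1 \<in> line_multiples e1" "F1 = (\<Sum>i\<le>e1. (\<lambda>x. c1 i * ?m e1 i x)) + g1"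
    "\<And>t. F1 (u + t *s b) = (\<Sum>i\<le>e1. c1 i * t ^ i)"
    by (rule graded_part_decomposition[OF F1(2)]) blast
  have "h = (\<Sum>i\<le>e1. monom (c1 i) i)"
    by (rule poly_eq_poly_eq_iff[THEN iffD1])
      (simp add: fun_eq_iff F1(3)[symmetric] c1(3) poly_sum poly_monom)
  then have coeff_h: "coeff h i = (if i \<le> e1 then c1 i else 0)" for i
    by (simp add: coeff_sum)
  have n: "?n \<le> e1" "c1 ?n \<noteq> 0" "\<And>i. ?n < i \<Longrightarrow> i \<le> e1 \<Longrightarrow> c1 i = 0"
  proof -
    have "coeff h ?n \<noteq> 0"
      using F1(4) by simp
    then show "?n \<le> e1" "c1 ?n \<noteq> 0"
      using coeff_h[of ?n] by (auto split: if_splits)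
    show "c1 i = 0" if "?n < i" "i \<le> e1" for i
      using coeff_h[of i] coeff_eq_0[OF that(1)] that(2) by simp
  qed
  \<comment> \<open>From this degree on, i < e0 leaves an \<open>l2\<close>-exponent of at least e1,
    enough for the reduction by \<open>F1\<close>.\<close>
  define K where "K = e0 + e1"
  have growth_step: "gr (Suc k) \<subseteq> cfun.span (((\<lambda>f x. l1 x * f x) ` B \<union> ?m (Suc k) ` {..<?n}) \<union> W)"
    if k: "Suc k \<ge> K" and B: "gr k \<subseteq> cfun.span (B \<union> W)" for k B
  proof -
    let ?S = "cfun.span (((\<lambda>f x. l1 x * f x) ` B \<union> ?m (Suc k) ` {..<?n}) \<union> W)"
    have lin: "monomial3 l1 l2 l3 (Suc i) j l \<in> ?S" if "Suc i + j + l = Suc k" for i j l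
    proof -
      have "monomial3 l1 l2 l3 i j l \<in> cfun.span (B \<union> W)"
      proof (rule subsetD[OF B])
        show "monomial3 l1 l2 l3 i j l \<in> gr k"
          unfolding graded_part_def using that by (intro cfun.span_base) auto
      qed
      then have "(\<lambda>x. l1 x * monomial3 l1 l2 l3 i j l x) \<in> ?S"
        by (rule span_mult_const) (auto intro!: cfun.span_base W_mult)
      then show ?thesis
        by (simp add: monomial3_def[abs_def] mult.assoc)
    qed
    have S: "cfun.subspace ?S" "W \<subseteq> ?S" "line_multiples (Suc k) \<subseteq> ?S"
    proof -
      show "W \<subseteq> ?S"
        by (auto intro: cfun.span_base)
      show "line_multiples (Suc k) \<subseteq> ?S"
        unfolding line_multiples_def using lin by (intro cfun.span_minimal) auto
    qed simp
    have pure: "?m (Suc k) i \<in> ?S" if "i \<le> Suc k" for i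
      using that
    proof (induction i rule: less_induct)
      case (less i)
      then have low: "?m (Suc k) i' \<in> ?S" if "i' < i" for i'
        using that by simp
      consider "i < ?n" | "?n \<le> i" "i < e0" | "e0 \<le> i"
        by linarith
      then show ?case
      proof cases
        case 1
        then show ?thesis
          by (auto intro: cfun.span_base)
      next
        case 2
        have "e1 - ?n \<le> Suc k - i"
          using 2 k unfolding K_def by linarith
        then show ?thesis
          using monomial_reduction[OF S F1(1) c1(2,1) n 2(1) less.prems _ low] by blast
      next
        case 3
        then show ?thesis
          using monomial_reduction[OF S F0(1) c0(2,1) order.refl _ _ 3 less.prems _ low] F0(3) c0(3) by simp
      qed
    qed
    have "monomial3 l1 l2 l3 i j l \<in> ?S" if "i + j + l = Suc k" for i j l
    proof (cases i)
      case 0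
      then have "j = Suc k - l" "l \<le> Suc k"
        using that by auto
      then show ?thesis
        using pure[of l] 0 by simp
    next
      case (Suc i')
      then show ?thesis
        using lin[of i' j l] that by simp
    qed
    then show ?thesis
      unfolding graded_part_def by (intro cfun.span_minimal) auto
  qed
  define B0 where "B0 = {monomial3 l1 l2 l3 i j l | i j l. i + j + l = K}"
  have "B0 \<subseteq> (\<lambda>(i, j, l). monomial3 l1 l2 l3 i j l) ` ({..K} \<times> {..K} \<times> {..K})"
  proof
    fix m assume "m \<in> B0"
    then obtain i j l where "m = monomial3 l1 l2 l3 i j l" "i + j + l = K"
      unfolding B0_def by blast
    then show "m \<in> (\<lambda>(i, j, l). monomial3 l1 l2 l3 i j l) ` ({..K} \<times> {..K} \<times> {..K})"
      by (intro image_eqI[of _ _ "(i, j, l)"]) auto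
  qed
  then have fin: "finite B0"
    by (rule finite_subset) auto
  have "\<exists>B. finite B \<and> card B \<le> card B0 + k * ?n \<and> gr k \<subseteq> cfun.span (B \<union> W)" if "k \<ge> K" for k
    using that
  proof (induction k rule: dec_induct)
    case base
    have "gr K \<subseteq> cfun.span (B0 \<union> W)"
      unfolding graded_part_def B0_def[symmetric] by (intro cfun.span_mono) auto
    then show ?case
      using fin by (intro exI[of _ B0]) auto
  next
    case (step k)
    then obtain B where B: "finite B" "card B \<le> card B0 + k * ?n" "gr k \<subseteq> cfun.span (B \<union> W)"
      by blast
    let ?B = "(\<lambda>f x. l1 x * f x) ` B \<union> ?m (Suc k) ` {..<?n}"
    have "card ?B \<le> card ((\<lambda>f x. l1 x * f x) ` B) + card (?m (Suc k) ` {..<?n})"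
      by (rule card_Un_le)
    also have "\<dots> \<le> card B + card {..<?n}"
      by (intro add_mono card_image_le B(1)) auto
    also have "\<dots> \<le> card B0 + Suc k * ?n"
      using B(2) by simp
    finally have "card ?B \<le> card B0 + Suc k * ?n" .
    moreover have "gr (Suc k) \<subseteq> cfun.span (?B \<union> W)"
      by (rule growth_step) (use step B in simp_all)
    moreover have "finite ?B"
      using B(1) by simp
    ultimately show ?case
      by blast
  qed
  then show ?thesis
    by blast
qed

end

text \<open>The trace ideal in terms of forms and polynomials alone, for use with explicit
  parametrisations. That \<open>h\<close> is realised by a form is used for lines, that it divides
  all restrictions for exceptional curves.\<close>

lemma (in rational_curve) curve_int_data:
  assumes C: "zariski_closed I C" "C \<subseteq> blowup r p" "pt I \<omega> \<notin> C"
  obtains h where "h \<noteq> 0" "curve_int r p T C = degree h"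
    "\<exists>d. \<exists>F\<in>forms I d. (\<forall>q\<in>C. vanishes_at I F q) \<and> (\<forall>t. F (\<tau> t) = poly h t)"
    "\<forall>d. \<forall>F\<in>forms I d. \<forall>f. (\<forall>q\<in>C. vanishes_at I F q) \<longrightarrow> (\<forall>t. F (\<tau> t) = poly f t) \<longrightarrow> h dvd f"
proof -
  obtain h where h: "h \<in> trace_ideal C" "h \<noteq> 0" "\<And>f. f \<in> trace_ideal C \<Longrightarrow> h dvd f"
    by (rule trace_generator[OF C]) blast
  show thesis
  proof
    show "h \<noteq> 0"
      by (rule h(2))
    show "curve_int r p T C = degree h"
      by (rule curve_int_eq_degree[OF C h])
    obtain F d where F: "F \<in> forms I d" "\<forall>q\<in>C. vanishes_at I F q" "h = pull F"
      using h(1) by (auto simp: trace_ideal_def)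
    then show "\<exists>d. \<exists>F\<in>forms I d. (\<forall>q\<in>C. vanishes_at I F q) \<and> (\<forall>t. F (\<tau> t) = poly h t)"
      using poly_pull by blast
    show "\<forall>d. \<forall>F\<in>forms I d. \<forall>f. (\<forall>q\<in>C. vanishes_at I F q) \<longrightarrow> (\<forall>t. F (\<tau> t) = poly f t) \<longrightarrow> h dvd f"
    proof (intro allI ballI impI)
      fix d F f assume F: "F \<in> forms I d" "\<forall>q\<in>C. vanishes_at I F q" "\<forall>t. F (\<tau> t) = poly f t"
      have "pull F = f"
        using F(3) by (intro pull_eqI[OF F(1)]) blast
      moreover have "pull F \<in> trace_ideal C"
        using F(2) by (intro trace_idealI[OF F(1)]) blast
      ultimately show "h dvd f"
        using h(3) by blast
    qed
  qed
qed

text \<open>On the vectors (1, t, t^2) each condition becomes a nonzero polynomial in t, and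
  finitely many of these have a common non-root.\<close>

lemma exists_vector_avoiding:
  assumes "finite V" "0 \<notin> V"
  shows "\<exists>n. n \<noteq> 0 \<and> (\<forall>v\<in>V. dot n v \<noteq> 0)"
proof -
  define g :: "complex ^ 3 \<Rightarrow> complex poly" where "g v = [:v $ 1, v $ 2, v $ 3:]" for v
  have "g v \<noteq> 0" if "v \<in> V" for v
  proof -
    have "v \<noteq> 0"
      using assms(2) that by blast
    then show ?thesis
      by (auto simp: g_def vec_eq_iff forall_3)
  qed
  then have "(\<Prod>v\<in>V. g v) \<noteq> 0"
    using assms(1) by simp
  then obtain t where "poly (\<Prod>v\<in>V. g v) t \<noteq> 0"
    using poly_all_0_iff_0 by blast
  then have t: "poly (g v) t \<noteq> 0" if "v \<in> V" for v
    using that assms(1) by (auto simp: poly_prod)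
  define n :: "complex ^ 3" where "n = vector [1, t, t ^ 2]"
  have "dot n v = poly (g v) t" for v
    by (simp add: n_def g_def dot_def sum_3 algebra_simps power2_eq_square)
  moreover have "n $ 1 = 1"
    by (simp add: n_def)
  then have "n \<noteq> 0"
    by auto
  ultimately show ?thesis
    using t by auto
qed

definition cone_ideal :: "(nat \<Rightarrow> point) set \<Rightarrow> (complex ^ 3 \<Rightarrow> complex) set" where
  "cone_ideal C = {f. \<forall>q\<in>C. \<forall>x\<in>q 0. f x = 0}"

lemma cone_ideal_subspace: "cfun.subspace (cone_ideal C)"
  by (auto simp: cfun.subspace_def cone_ideal_def)

lemma cone_ideal_mult: "f \<in> cone_ideal C \<Longrightarrow> (\<lambda>x. g x * f x) \<in> cone_ideal C"
  by (auto simp: cone_ideal_def)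

definition homogeneous :: "nat \<Rightarrow> (complex ^ 3 \<Rightarrow> complex) set" where
  "homogeneous k = {f \<in> polys {\<lambda>x. x $ i | i. True}. \<forall>x t. f (t *s x) = t ^ k * f x}"

section \<open>From curves on the blow-up to the ideal of the image in the plane\<close>

context blown_up_points
begin

lemma line_preimage_nonempty:
  assumes n: "n \<noteq> 0" "\<And>j. j \<in> {1..r} \<Longrightarrow> dot n (P j) \<noteq> 0"
  shows "line_preimage r p (vec.span {n}) \<noteq> {}"
proof -
  obtain y where y: "crs n y \<noteq> 0"
    using exists_crs_nonzero[OF n(1)] by blast
  define x where "x = crs n y"
  have x: "x \<noteq> 0" "dot n x = 0"
    using y by (simp_all add: x_def dot_crs_self)
  define w where "w l = (if l = 0 then x else crs x (P l))" for l
  have w: "w l \<noteq> 0" if "l \<in> {0..r}" for l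
  proof (cases "l = 0")
    case False
    then have l: "l \<in> {1..r}"
      using that by simp
    have "crs x (P l) \<noteq> 0"
    proof
      assume "crs x (P l) = 0"
      then obtain c where "P l = c *s x"
        using crs_eq_0D x(1) by blast
      then have "dot n (P l) = 0"
        using x(2) by (simp add: dot_simps)
      then show False
        using n(2)[OF l] by simp
    qed
    then show ?thesis
      using False by (simp add: w_def)
  qed (simp add: w_def x)
  have "pt {0..r} w \<in> blowup r p"
  proof (subst pt_mem_blowup)
    show "\<forall>j\<in>{1..r}. dot (w j) (P j) = 0 \<and> dot (w j) (w 0) = 0"
      by (auto simp: w_def dot_crs_self)
  qed (rule w)
  then have "pt {0..r} w \<in> line_preimage r p (vec.span {n})"
    using x by (simp add: line_preimage_def pt_nth on_line_span w_def)
  then show ?thesis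
    by blast
qed

lemma exceptional_curve_nonempty:
  assumes j: "j \<in> {1..r}"
  shows "exceptional_curve r p j \<noteq> {}"
proof -
  have "\<exists>y. y \<noteq> 0 \<and> dot (P j) y = 0"
    using exists_crs_nonzero[OF P_nz[OF j]] dot_crs_self by blast
  then obtain y where y: "y \<noteq> 0" "dot (P j) y = 0"
    by blast
  define w where "w l = (if l = 0 then P j else if l = j then y else crs (P j) (P l))" for l
  have w: "w l \<noteq> 0" if "l \<in> {0..r}" for l
    using that P_nz[OF j] P_distinct[OF j, of l] y by (auto simp: w_def)
  have "pt {0..r} w \<in> blowup r p"
  proof (subst pt_mem_blowup)
    show "\<forall>j\<in>{1..r}. dot (w j) (P j) = 0 \<and> dot (w j) (w 0) = 0"
      using y j by (auto simp: w_def dot_crs_self dot_commute[of y])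
  qed (rule w)
  then have "pt {0..r} w \<in> exceptional_curve r p j"
    using j by (simp add: exceptional_curve_def pt_nth w_def p_eq)
  then show ?thesis
    by blast
qed

text \<open>The choice in \<open>line_dot\<close> is not vacuous: if the first line that avoids the
  points has pullback \<open>C\<close>, a second one that also avoids the image of a point of
  \<open>C\<close> has a different pullback. Whatever line is chosen, only the stated properties of
  its coefficient vector are used later.\<close>

lemma line_dot_eq_curve_int:
  obtains n where "n \<noteq> 0" "\<And>j. j \<in> {1..r} \<Longrightarrow> dot n (P j) \<noteq> 0" "line_preimage r p (vec.span {n}) \<noteq> C"
    "line_dot r p C = int (curve_int r p (line_preimage r p (vec.span {n})) C)"
proof -
  let ?Q = "\<lambda>l. l \<in> P2 \<and> (\<forall>i\<in>{1..r}. \<not> on_line (p i) l) \<and> line_preimage r p l \<noteq> C"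
  have iff: "?Q (vec.span {n}) \<longleftrightarrow> (\<forall>j\<in>{1..r}. dot n (P j) \<noteq> 0) \<and> line_preimage r p (vec.span {n}) \<noteq> C"
    if "n \<noteq> 0" for n
    using that by (auto simp: P2_def p_eq on_line_span)
  have 0: "0 \<notin> P ` {1..r}"
    using P_nz by (metis imageE)
  obtain n where n: "n \<noteq> 0" "\<forall>v\<in>P ` {1..r}. dot n v \<noteq> 0"
    using exists_vector_avoiding[of "P ` {1..r}"] 0 by auto
  have "\<exists>l. ?Q l"
  proof (cases "line_preimage r p (vec.span {n}) = C")
    case False
    then show ?thesis
      using iff[OF n(1)] n(2) by blast
  next
    case True
    obtain q where q: "q \<in> line_preimage r p (vec.span {n})"
      using line_preimage_nonempty[OF n(1)] n(2) by blast
    then have "q \<in> blowup r p"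
      by (simp add: line_preimage_def)
    then obtain w where w: "\<And>i. i \<in> {0..r} \<Longrightarrow> w i \<noteq> 0" "q = pt {0..r} w"
      by (rule blowup_rep) blast
    obtain n' where n': "n' \<noteq> 0" "\<forall>v\<in>insert (w 0) (P ` {1..r}). dot n' v \<noteq> 0"
      using exists_vector_avoiding[of "insert (w 0) (P ` {1..r})"] 0 w(1)[of 0] by auto
    have "q \<notin> line_preimage r p (vec.span {n'})"
      using n'(2) by (simp add: line_preimage_def w(2) pt_nth on_line_span)
    then have "line_preimage r p (vec.span {n'}) \<noteq> C"
      using q True by blast
    then show ?thesis
      using iff[OF n'(1)] n'(2) by blast
  qed
  from someI_ex[OF this] have Q: "?Q (SOME l. ?Q l)" .
  then obtain n where n: "n \<noteq> 0" "(SOME l. ?Q l) = vec.span {n}"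
    unfolding P2_def by blast
  have "line_dot r p C = int (curve_int r p (line_preimage r p (vec.span {n})) C)"
    unfolding line_dot_def Let_def n(2) ..
  then show thesis
    using that[OF n(1)] Q unfolding n(2) iff[OF n(1)] by blast
qed

text \<open>A form on the blow-up is pushed down by inserting for each line component the join of x
  and \<open>P l\<close>. On the blow-up this join is a multiple of the actual component; the
  multiple is 0 where the image point is \<open>P l\<close>, which is allowed in
  \<open>reps\<close>. The degrees of all components add up.\<close>

lemma cone_ideal_of_form:
  assumes F: "F \<in> forms {0..r} d" and van: "\<And>q. q \<in> C \<Longrightarrow> vanishes_at {0..r} F q" and C: "C \<subseteq> blowup r p"
  defines "f \<equiv> \<lambda>x. F (\<lambda>l. if l = 0 then x else crs x (P l))"
  shows "f \<in> cone_ideal C" "f \<in> homogeneous (\<Sum>l\<in>{0..r}. d l)"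
proof -
  have "f x = 0" if q: "q \<in> C" "x \<in> q 0" for q x
  proof -
    have "q \<in> blowup r p"
      using q C by blast
    then obtain w where w: "\<And>i. i \<in> {0..r} \<Longrightarrow> w i \<noteq> 0" "q = pt {0..r} w"
      "\<And>j. j \<in> {1..r} \<Longrightarrow> dot (w j) (P j) = 0" "\<And>j. j \<in> {1..r} \<Longrightarrow> dot (w j) (w 0) = 0"
      by (rule blowup_rep) blast
    obtain c where c: "x = c *s w 0"
      using q(2) by (auto simp: w(2) pt_nth mem_span_singleton)
    have "\<exists>e. crs x (P i) = e *s w i" if i: "i \<in> {1..r}" for i
    proof (cases "crs (w 0) (P i) = 0")
      case True
      then show ?thesis
        unfolding c crs_simps by (intro exI[of _ 0]) simp
    next
      case False
      then obtain e where e: "w i = e *s crs (w 0) (P i)"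
        using perp_pair_crs w(3,4)[OF i] by blast
      then have "e \<noteq> 0"
        using w(1)[of i] i by auto
      then show ?thesis
        unfolding c crs_simps e by (intro exI[of _ "c / e"]) simp
    qed
    then have "\<forall>i\<in>{0..r}. \<exists>e. (if i = 0 then x else crs x (P i)) = e *s w i"
      using c by auto
    then have "(\<lambda>l. if l = 0 then x else crs x (P l)) \<in> reps {0..r} q"
      unfolding w(2) reps_pt by (rule bchoice)
    then show ?thesis
      using van[OF q(1)] by (simp add: f_def vanishes_at_def)
  qed
  then show "f \<in> cone_ideal C"
    by (auto simp: cone_ideal_def)
  have "f \<in> polys {\<lambda>x. x $ i | i. True}"
    unfolding f_def
  proof (rule polys_compose[OF forms_polys[OF F]])
    fix g :: "coords \<Rightarrow> complex" assume "g \<in> {\<lambda>v. v i $ k | i k. i \<in> {0..r}}"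
    then obtain i k where g: "g = (\<lambda>v. v i $ k)"
      by blast
    have lin: "(\<lambda>x. x $ i * P l $ j + (-1) * (x $ i' * P l $ j')) \<in> polys {\<lambda>x. x $ i | i. True}" for i j i' j' l
      by (intro polys.intros) auto
    show "(\<lambda>x. g (\<lambda>l. if l = 0 then x else crs x (P l))) \<in> polys {\<lambda>x. x $ i | i. True}"
    proof (cases "i = 0")
      case True
      then show ?thesis
        by (auto simp: g intro: polys.coord)
    next
      case False
      then show ?thesis
        using exhaust_3[of k] lin[of 2 i 3 3 2] lin[of 3 i 1 1 3] lin[of 1 i 2 2 1]
        by (auto simp: g crs_nth)
    qed
  qed
  moreover have "f (t *s x) = t ^ (\<Sum>l\<in>{0..r}. d l) * f x" for t x
  proof -
    have "f (t *s x) = F (\<lambda>l. t *s (if l = 0 then x else crs x (P l)))"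
      unfolding f_def by (rule arg_cong[of _ _ F]) (auto simp: fun_eq_iff crs_simps)
    also have "\<dots> = (\<Prod>l\<in>{0..r}. t ^ d l) * f x"
      unfolding f_def by (rule forms_scale[OF F])
    finally show ?thesis
      by (simp add: power_sum)
  qed
  ultimately show "f \<in> homogeneous (\<Sum>l\<in>{0..r}. d l)"
    by (auto simp: homogeneous_def)
qed

text \<open>The line chosen in \<open>line_dot\<close> supplies both forms of the growth estimate:
  pushing down a form through \<open>C\<close> that misses the point at infinity gives
  \<open>f0\<close>, and pushing down one that restricts to the generator \<open>h\<close> gives
  \<open>f1\<close>. The coordinates are the equation \<open>n\<close> of the line and the
  functionals \<open>lam 0\<close> and \<open>bet\<close> of its parametrisation.\<close>

lemma homogeneous_growth:
  assumes C: "irreducible_curve {0..r} C" "C \<subseteq> blowup r p"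
  obtains nL K0 K1 where "line_dot r p C = int nL"
    "\<forall>k\<ge>K0. \<exists>B. finite B \<and> card B \<le> K1 + k * nL \<and> homogeneous k \<subseteq> cfun.span (B \<union> cone_ideal C)"
proof -
  obtain n where n: "n \<noteq> 0" "\<And>j. j \<in> {1..r} \<Longrightarrow> dot n (P j) \<noteq> 0" "line_preimage r p (vec.span {n}) \<noteq> C"
    "line_dot r p C = int (curve_int r p (line_preimage r p (vec.span {n})) C)"
    by (rule line_dot_eq_curve_int[of C]) blast
  let ?T = "line_preimage r p (vec.span {n})"
  obtain q0 where "q0 \<in> ?T"
    using line_preimage_nonempty[OF n(1,2)] by blast
  obtain a b lam bet where "rational_curve r p ?T a b lam 0 bet"
    by (rule line_preimage_rational_curve[OF n(1,2) \<open>q0 \<in> ?T\<close>]) blast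
  then have "\<not> ?T \<subseteq> C"
    using rational_curve.not_subset_curve[OF _ C(1)] n(3) by blast
  then obtain q where q: "q \<in> ?T" "q \<notin> C"
    by blast
  \<comment> \<open>The curve is parametrised a second time, now with the point \<open>q\<close> off
    \<open>C\<close> at infinity.\<close>
  obtain a b lam bet where rc: "rational_curve r p ?T a b lam 0 bet"
    "pt {0..r} (\<lambda>l. if b l = 0 then a l else b l) = q" "crs (a 0) (b 0) = n"
    "\<And>j. j \<in> {1..r} \<Longrightarrow> a j = crs (a 0) (P j) \<and> b j = crs (b 0) (P j)"
    by (rule line_preimage_rational_curve[OF n(1,2) q(1)], assumption, rule that)
  have closed: "zariski_closed {0..r} C"
    using C(1) unfolding irreducible_curve_def zariski_irreducible_def by blast
  obtain h where h: "h \<noteq> 0" "curve_int r p ?T C = degree h"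
    "\<exists>d. \<exists>F\<in>forms {0..r} d. (\<forall>q\<in>C. vanishes_at {0..r} F q) \<and> (\<forall>t. F (\<lambda>l. a l + t *s b l) = poly h t)"
    by (rule rational_curve.curve_int_data[OF rc(1) closed C(2) q(2)[folded rc(2)]]) blast
  obtain d F where F: "F \<in> forms {0..r} d" "\<And>q. q \<in> C \<Longrightarrow> vanishes_at {0..r} F q"
    "\<And>t. F (\<lambda>l. a l + t *s b l) = poly h t"
    using h(3) by blast
  have "q \<in> P2s {0..r}"
    using q(1) by (simp add: line_preimage_def blowup_def)
  obtain d0 F0 where F0: "F0 \<in> forms {0..r} d0" "\<And>q. q \<in> C \<Longrightarrow> vanishes_at {0..r} F0 q" "\<not> vanishes_at {0..r} F0 q"
    by (rule zariski_closedE[OF closed \<open>q \<in> P2s {0..r}\<close> q(2)]) blast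
  define f0 where "f0 x = F0 (\<lambda>l. if l = 0 then x else crs x (P l))" for x
  define f1 where "f1 x = F (\<lambda>l. if l = 0 then x else crs x (P l))" for x
  have f0: "f0 \<in> cone_ideal C" "f0 \<in> homogeneous (sum d0 {0..r})"
    using cone_ideal_of_form[OF F0(1,2) C(2)] unfolding f0_def[abs_def] by blast+
  have f1: "f1 \<in> cone_ideal C" "f1 \<in> homogeneous (sum d {0..r})"
    using cone_ideal_of_form[OF F(1,2) C(2)] unfolding f1_def[abs_def] by blast+
  have b_nz: "b l \<noteq> 0" if "l \<in> {0..r}" for l
  proof (cases "l = 0")
    case True
    then show ?thesis
      using rational_curve.bet_b[OF rc(1)] by (auto simp: dot_simps)
  next
    case False
    then have l: "l \<in> {1..r}"
      using that by simp
    have "dot n (b 0) = 0"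
      unfolding rc(3)[symmetric] by (rule dot_crs_self)
    show ?thesis
    proof
      assume "b l = 0"
      then have "crs (b 0) (P l) = 0"
        using rc(4)[OF l] by simp
      moreover have "b 0 \<noteq> 0"
        using rational_curve.bet_b[OF rc(1)] by (auto simp: dot_simps)
      ultimately obtain c where "P l = c *s b 0"
        using crs_eq_0D by blast
      then show False
        using n(2)[OF l] \<open>dot n (b 0) = 0\<close> by (simp add: dot_simps)
    qed
  qed
  have "f0 (b 0) = F0 (\<lambda>l. if b l = 0 then a l else b l)"
    unfolding f0_def using b_nz rc(4) by (intro forms_cong[OF F0(1)]) (auto simp: Suc_le_eq)
  then have f0_b: "f0 (b 0) \<noteq> 0"
    using F0(3) vanishes_at_pt[OF F0(1)] unfolding rc(2)[symmetric] by simp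
  have f1_ab: "f1 (a 0 + t *s b 0) = poly h t" for t
  proof -
    have "f1 (a 0 + t *s b 0) = F (\<lambda>l. a l + t *s b l)"
      unfolding f1_def using rc(4) by (intro forms_cong[OF F(1)]) (auto simp: crs_simps)
    then show ?thesis
      by (simp add: F(3))
  qed
  obtain c where c: "dot c n = 1"
    using exists_dot_eq_1[OF n(1)] by blast
  \<comment> \<open>\<open>c\<close> is corrected so that \<open>c'\<close>, \<open>a 0\<close>,
    \<open>b 0\<close> is the basis dual to \<open>n\<close>, \<open>lam 0\<close>,
    \<open>bet\<close>.\<close>
  define c' where "c' = c - dot (lam 0) c *s a 0 - dot bet c *s b 0"
  have lam: "dot (lam 0) (a 0) = 1" "dot (lam 0) (b 0) = 0" "dot bet (a 0) = 0" "dot bet (b 0) = 1"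
    using rational_curve.lam_a[OF rc(1), of 0] rational_curve.lam_b[OF rc(1), of 0]
      rational_curve.bet_a[OF rc(1)] rational_curve.bet_b[OF rc(1)] by simp_all
  have n_ab: "dot n (a 0) = 0" "dot n (b 0) = 0"
    unfolding rc(3)[symmetric] by (rule dot_crs_self)+
  have coords: "x = dot n x *s c' + dot (lam 0) x *s a 0 + dot bet x *s b 0" for x
  proof -
    define y where "y = x - dot n x *s c"
    have "dot y (crs (a 0) (b 0)) = 0"
      unfolding rc(3) y_def using c by (simp add: dot_simps dot_commute[of x n])
    then obtain s t where st: "y = s *s a 0 + t *s b 0"
      using perp_crs_span[of "a 0" "b 0" y] rc(3) n(1) by blast
    have "dot (lam 0) y = s" "dot bet y = t"
      unfolding st by (simp_all add: dot_simps lam)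
    then have eqs: "dot (lam 0) x = s + dot n x * dot (lam 0) c" "dot bet x = t + dot n x * dot bet c"
      unfolding y_def by (simp_all add: dot_simps algebra_simps)
    have "dot n x *s c' + dot (lam 0) x *s a 0 + dot bet x *s b 0 = dot n x *s c + (s *s a 0 + t *s b 0)"
      unfolding eqs c'_def by (simp add: vec_eq_iff algebra_simps)
    also have "\<dots> = x"
      unfolding st[symmetric] y_def by simp
    finally show ?thesis
      by (rule sym)
  qed
  let ?l = "{dot n, dot (lam 0), dot bet}"
  have hom: "homogeneous k \<subseteq> graded_part (dot n) (dot (lam 0)) (dot bet) k" for k
  proof
    fix f assume "f \<in> homogeneous k"
    then have f: "f \<in> polys {\<lambda>x. x $ i | i. True}" "\<And>x t. f (t *s x) = t ^ k * f x"
      by (auto simp: homogeneous_def)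
    show "f \<in> graded_part (dot n) (dot (lam 0)) (dot bet) k"
    proof (rule homogeneous_in_graded_part[where s = "\<lambda>t x. t *s x"])
      show "f \<in> polys ?l"
      proof (rule polys_compose[OF f(1), where g = "\<lambda>x. x"])
        fix g :: "complex ^ 3 \<Rightarrow> complex" assume "g \<in> {\<lambda>x. x $ i | i. True}"
        then obtain i where g: "g = (\<lambda>x. x $ i)"
          by blast
        have "x $ i = dot n x * c' $ i + dot (lam 0) x * a 0 $ i + dot bet x * b 0 $ i" for x
          using arg_cong[OF coords[of x], of "\<lambda>v. v $ i"] by simp
        then have "(\<lambda>x. g x) = (\<lambda>x. dot n x * c' $ i + dot (lam 0) x * a 0 $ i + dot bet x * b 0 $ i)"
          unfolding g by (rule ext)
        also have "\<dots> \<in> polys ?l"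
          by (intro polys.intros) auto
        finally show "(\<lambda>x. g x) \<in> polys ?l" .
      qed
    next
      show "l (t *s x) = t * l x" if "l \<in> ?l" for l x t
        using that by (auto simp: dot_simps)
    qed (rule f(2))
  qed
  have lc: "line_coordinates (dot n) (dot (lam 0)) (dot bet) (a 0) (b 0) (cone_ideal C)"
    by unfold_locales (simp_all add: dot_simps n_ab lam cone_ideal_subspace cone_ideal_mult)
  have "\<exists>K0 K1. \<forall>k\<ge>K0. \<exists>B. finite B \<and> card B \<le> K1 + k * degree h \<and>
      graded_part (dot n) (dot (lam 0)) (dot bet) k \<subseteq> cfun.span (B \<union> cone_ideal C)"
    by (rule line_coordinates.graded_part_growth[OF lc f0(1) _ f0_b f1(1) _ f1_ab h(1)])
      (use f0 f1 hom in blast)+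
  then obtain K0 K1 where K: "\<And>k. k \<ge> K0 \<Longrightarrow> \<exists>B. finite B \<and> card B \<le> K1 + k * degree h \<and>
      graded_part (dot n) (dot (lam 0)) (dot bet) k \<subseteq> cfun.span (B \<union> cone_ideal C)"
    by blast
  show thesis
  proof
    show "line_dot r p C = int (degree h)"
      using n(4) h(2) by simp
    show "\<forall>k\<ge>K0. \<exists>B. finite B \<and> card B \<le> K1 + k * degree h \<and> homogeneous k \<subseteq> cfun.span (B \<union> cone_ideal C)"
      using K hom by (meson subset_trans)
  qed
qed

end

subsection \<open>Taylor coefficients\<close>

definition exponent_triangle :: "nat \<Rightarrow> (nat \<times> nat) set" where
  "exponent_triangle k = {(\<alpha>, \<beta>). \<alpha> + \<beta> \<le> k}"

lemma finite_exponent_triangle: "finite (exponent_triangle k)"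
  by (rule finite_subset[of _ "{..k} \<times> {..k}"]) (auto simp: exponent_triangle_def)

text \<open>The first coordinate homogenises, so that the affine point (X, Y) is (1, X, Y).\<close>

definition hom_poly :: "nat \<Rightarrow> (nat \<times> nat \<Rightarrow> complex) \<Rightarrow> complex ^ 3 \<Rightarrow> complex" where
  "hom_poly k c x = (\<Sum>(\<alpha>, \<beta>)\<in>exponent_triangle k. c (\<alpha>, \<beta>) * (x $ 1 ^ (k - \<alpha> - \<beta>) * x $ 2 ^ \<alpha> * x $ 3 ^ \<beta>))"

text \<open>The coefficient of (x - X)^s (y - Y)^t in the expansion at (X, Y). Truncated subtraction
  in the exponents does no harm, as the binomial coefficient is 0 there.\<close>

definition taylor :: "nat \<Rightarrow> complex \<Rightarrow> complex \<Rightarrow> (nat \<times> nat \<Rightarrow> complex) \<Rightarrow> nat \<Rightarrow> nat \<Rightarrow> complex" where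
  "taylor k X Y c s t = (\<Sum>(\<alpha>, \<beta>)\<in>exponent_triangle k.
     c (\<alpha>, \<beta>) * (of_nat (\<alpha> choose s) * X ^ (\<alpha> - s) * (of_nat (\<beta> choose t) * Y ^ (\<beta> - t))))"

lemma taylor_add: "taylor k X Y (c + c') s t = taylor k X Y c s t + taylor k X Y c' s t"
  unfolding taylor_def sum.distrib[symmetric] split_beta plus_fun_def distrib_right ..

lemma taylor_cmult: "taylor k X Y (\<lambda>z. a * c z) s t = a * taylor k X Y c s t"
  unfolding taylor_def sum_distrib_left split_beta mult.assoc ..

lemma taylor_sum: "taylor k X Y (\<lambda>z. \<Sum>i\<in>A. f i z) s t = (\<Sum>i\<in>A. taylor k X Y (f i) s t)"
proof -
  have "taylor k X Y (\<lambda>_. 0) s t = 0"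
    by (simp add: taylor_def)
  then show ?thesis
    by (induction A rule: infinite_finite_induct) (simp_all add: taylor_add[unfolded plus_fun_def])
qed

lemma taylor_outside: "s + t > k \<Longrightarrow> taylor k X Y c s t = 0"
  unfolding taylor_def by (intro sum.neutral) (auto simp: exponent_triangle_def)

lemma hom_poly_sum: "hom_poly k (\<lambda>z. \<Sum>i\<in>A. y i * f i z) x = (\<Sum>i\<in>A. y i * hom_poly k (f i) x)"
  unfolding hom_poly_def sum_distrib_left sum_distrib_right split_beta
  by (subst sum.swap) (simp add: mult.assoc)

lemma binomial_shift:
  fixes X :: complex
  shows "x ^ \<alpha> = (\<Sum>s\<le>\<alpha>. of_nat (\<alpha> choose s) * (x - X * z) ^ s * (X * z) ^ (\<alpha> - s))"
  using binomial_ring[of "x - X * z" "X * z" \<alpha>] by simp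

text \<open>The homogeneous Taylor formula: the second and third coordinates are expanded around X
  and Y times the first, and the powers of the first coordinate that appear combine to the exponent
  k - s - t.\<close>

lemma hom_poly_taylor:
  "hom_poly k c x = (\<Sum>(s, t)\<in>exponent_triangle k. taylor k X Y c s t *
     (x $ 1 ^ (k - s - t) * (x $ 2 - X * x $ 1) ^ s * (x $ 3 - Y * x $ 1) ^ t))"
proof -
  let ?z = "x $ 1" and ?u = "x $ 2 - X * x $ 1" and ?v = "x $ 3 - Y * x $ 1"
  let ?b = "\<lambda>\<alpha> \<beta> s t. of_nat (\<alpha> choose s) * X ^ (\<alpha> - s) * (of_nat (\<beta> choose t) * Y ^ (\<beta> - t))"
  let ?m = "\<lambda>s t. ?z ^ (k - s - t) * ?u ^ s * ?v ^ t"
  have mono: "?z ^ (k - \<alpha> - \<beta>) * x $ 2 ^ \<alpha> * x $ 3 ^ \<beta> = (\<Sum>(s, t)\<in>exponent_triangle k. ?b \<alpha> \<beta> s t * ?m s t)"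
    if "\<alpha> + \<beta> \<le> k" for \<alpha> \<beta>
  proof -
    have "x $ 2 ^ \<alpha> * x $ 3 ^ \<beta> =
        (\<Sum>s\<le>\<alpha>. of_nat (\<alpha> choose s) * ?u ^ s * (X * ?z) ^ (\<alpha> - s)) *
        (\<Sum>t\<le>\<beta>. of_nat (\<beta> choose t) * ?v ^ t * (Y * ?z) ^ (\<beta> - t))"
      by (simp only: binomial_shift[of "x $ 2" \<alpha> X ?z] binomial_shift[of "x $ 3" \<beta> Y ?z])
    also have "\<dots> = (\<Sum>(s, t)\<in>{..\<alpha>} \<times> {..\<beta>}. of_nat (\<alpha> choose s) * ?u ^ s * (X * ?z) ^ (\<alpha> - s) *
        (of_nat (\<beta> choose t) * ?v ^ t * (Y * ?z) ^ (\<beta> - t)))"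
      by (simp add: sum_product sum.cartesian_product)
    finally have "?z ^ (k - \<alpha> - \<beta>) * x $ 2 ^ \<alpha> * x $ 3 ^ \<beta> =
        (\<Sum>(s, t)\<in>{..\<alpha>} \<times> {..\<beta>}. ?z ^ (k - \<alpha> - \<beta>) * (of_nat (\<alpha> choose s) * ?u ^ s * (X * ?z) ^ (\<alpha> - s) *
        (of_nat (\<beta> choose t) * ?v ^ t * (Y * ?z) ^ (\<beta> - t))))"
      unfolding mult.assoc case_prod_unfold by (simp only: sum_distrib_left)
    also have "\<dots> = (\<Sum>(s, t)\<in>{..\<alpha>} \<times> {..\<beta>}. ?b \<alpha> \<beta> s t * ?m s t)"
    proof -
      have eq: "?z ^ (k - \<alpha> - \<beta>) * (of_nat (\<alpha> choose s) * ?u ^ s * (X * ?z) ^ (\<alpha> - s) *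
          (of_nat (\<beta> choose t) * ?v ^ t * (Y * ?z) ^ (\<beta> - t))) = ?b \<alpha> \<beta> s t * ?m s t"
        if "s \<le> \<alpha>" "t \<le> \<beta>" for s t
      proof -
        have "k - s - t = (k - \<alpha> - \<beta>) + (\<alpha> - s) + (\<beta> - t)"
          using that \<open>\<alpha> + \<beta> \<le> k\<close> by simp
        then have "?z ^ (k - s - t) = ?z ^ (k - \<alpha> - \<beta>) * ?z ^ (\<alpha> - s) * ?z ^ (\<beta> - t)"
          by (simp only: power_add)
        then show ?thesis
          by (simp only: power_mult_distrib mult_ac)
      qed
      show ?thesis
        unfolding case_prod_unfold by (rule sum.cong[OF refl], rule eq) auto
    qed
    also have "\<dots> = (\<Sum>(s, t)\<in>exponent_triangle k. ?b \<alpha> \<beta> s t * ?m s t)"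
      using that by (intro sum.mono_neutral_left finite_exponent_triangle) (auto simp: exponent_triangle_def not_le)
    finally show ?thesis .
  qed
  have "hom_poly k c x = (\<Sum>(\<alpha>, \<beta>)\<in>exponent_triangle k. c (\<alpha>, \<beta>) * (\<Sum>(s, t)\<in>exponent_triangle k. ?b \<alpha> \<beta> s t * ?m s t))"
    unfolding hom_poly_def
  proof (intro sum.cong refl)
    fix z assume z: "z \<in> exponent_triangle k"
    obtain \<alpha> \<beta> where "z = (\<alpha>, \<beta>)"
      by (cases z)
    moreover have "\<alpha> + \<beta> \<le> k"
      using z calculation by (simp add: exponent_triangle_def)
    ultimately show "(case z of (\<alpha>, \<beta>) \<Rightarrow> c (\<alpha>, \<beta>) * (?z ^ (k - \<alpha> - \<beta>) * x $ 2 ^ \<alpha> * x $ 3 ^ \<beta>)) =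
        (case z of (\<alpha>, \<beta>) \<Rightarrow> c (\<alpha>, \<beta>) * (\<Sum>(s, t)\<in>exponent_triangle k. ?b \<alpha> \<beta> s t * ?m s t))"
      by (simp only: case_prod_conv mono)
  qed
  also have "\<dots> = (\<Sum>a\<in>exponent_triangle k. \<Sum>z\<in>exponent_triangle k. c a * (?b (fst a) (snd a) (fst z) (snd z) * ?m (fst z) (snd z)))"
    by (simp add: split_beta sum_distrib_left)
  also have "\<dots> = (\<Sum>z\<in>exponent_triangle k. \<Sum>a\<in>exponent_triangle k. c a * (?b (fst a) (snd a) (fst z) (snd z) * ?m (fst z) (snd z)))"
    by (rule sum.swap)
  also have "\<dots> = (\<Sum>(s, t)\<in>exponent_triangle k. taylor k X Y c s t * ?m s t)"
    unfolding taylor_def by (simp add: split_beta sum_distrib_right mult.assoc)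
  finally show ?thesis .
qed

lemma hom_poly_homogeneous: "hom_poly k c \<in> homogeneous k"
proof -
  have "hom_poly k c \<in> polys {\<lambda>x. x $ i | i. True}"
    unfolding hom_poly_def[abs_def] split_beta
    by (intro polys_sum polys.mult polys_power polys.const polys.coord) auto
  moreover have "hom_poly k c (t *s x) = t ^ k * hom_poly k c x" for x t
    unfolding hom_poly_def sum_distrib_left
  proof (intro sum.cong refl, clarify)
    fix \<alpha> \<beta> assume "(\<alpha>, \<beta>) \<in> exponent_triangle k"
    then have "k = (k - \<alpha> - \<beta>) + \<alpha> + \<beta>"
      by (simp add: exponent_triangle_def)
    then have "t ^ k = t ^ (k - \<alpha> - \<beta>) * t ^ \<alpha> * t ^ \<beta>"
      by (metis power_add)
    then show "c (\<alpha>, \<beta>) * ((t *s x) $ 1 ^ (k - \<alpha> - \<beta>) * (t *s x) $ 2 ^ \<alpha> * (t *s x) $ 3 ^ \<beta>) =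
        t ^ k * (c (\<alpha>, \<beta>) * (x $ 1 ^ (k - \<alpha> - \<beta>) * x $ 2 ^ \<alpha> * x $ 3 ^ \<beta>))"
      by (simp only: vector_smult_component power_mult_distrib mult_ac)
  qed
  ultimately show ?thesis
    by (simp add: homogeneous_def)
qed

text \<open>With coefficients 0 beyond \<open>N\<close>, differentiation keeps the range of
  summation and only shifts the coefficients, and the formula also covers n > N.\<close>

lemma deriv_shifted_power_sum:
  fixes A :: "nat \<Rightarrow> complex"
  assumes "\<And>i. i > N \<Longrightarrow> A i = 0"
  shows "(deriv ^^ n) (\<lambda>y. \<Sum>i\<le>N. A i * (y - Y) ^ i) Y = fact n * A n"
  using assms
proof (induction n arbitrary: A)
  case 0
  have "(\<Sum>i\<le>N. A i * (Y - Y) ^ i) = (\<Sum>i\<le>N. if i = 0 then A 0 else 0)"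
    by (intro sum.cong) (auto simp: power_0_left)
  then show ?case
    by simp
next
  case (Suc n)
  define A' where "A' i = of_nat (Suc i) * A (Suc i)" for i
  have "deriv (\<lambda>y. \<Sum>i\<le>N. A i * (y - Y) ^ i) = (\<lambda>y. \<Sum>i\<le>N. A' i * (y - Y) ^ i)"
  proof
    fix y
    have "((\<lambda>y. \<Sum>i\<le>N. A i * (y - Y) ^ i) has_field_derivative
        (\<Sum>i\<le>N. A i * (of_nat i * (y - Y) ^ (i - 1)))) (at y)"
      by (auto intro!: derivative_eq_intros sum.cong simp: mult_ac)
    then have "deriv (\<lambda>y. \<Sum>i\<le>N. A i * (y - Y) ^ i) y = (\<Sum>i\<le>N. A i * (of_nat i * (y - Y) ^ (i - 1)))"
      by (rule DERIV_imp_deriv)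
    also have "\<dots> = (\<Sum>i\<le>Suc N. A i * (of_nat i * (y - Y) ^ (i - 1)))"
      using Suc.prems[of "Suc N"] by simp
    also have "\<dots> = (\<Sum>i\<le>N. A' i * (y - Y) ^ i)"
      unfolding sum.atMost_Suc_shift by (simp add: A'_def mult_ac)
    finally show "deriv (\<lambda>y. \<Sum>i\<le>N. A i * (y - Y) ^ i) y = (\<Sum>i\<le>N. A' i * (y - Y) ^ i)" .
  qed
  then have "(deriv ^^ Suc n) (\<lambda>y. \<Sum>i\<le>N. A i * (y - Y) ^ i) Y = fact n * A' n"
    unfolding funpow_Suc_right o_def using Suc.IH[of A'] Suc.prems by (simp add: A'_def)
  then show ?case
    by (simp add: A'_def algebra_simps)
qed

section \<open>Vanishing orders and independent conditions in terms of Taylor coefficients\<close>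

lemma plane_poly_taylor:
  assumes D: "D \<subseteq> exponent_triangle k" and c: "\<And>z. z \<notin> D \<Longrightarrow> c z = 0"
  shows "plane_poly D c x y = (\<Sum>t\<le>k. (\<Sum>s\<le>k. taylor k X Y c s t * (x - X) ^ s) * (y - Y) ^ t)"
proof -
  have "plane_poly D c x y = hom_poly k c (vector [1, x, y])"
    unfolding plane_poly_def hom_poly_def using D c
    by (intro sum.mono_neutral_cong_left finite_exponent_triangle) (auto simp: mult.assoc)
  also have "\<dots> = (\<Sum>(s, t)\<in>exponent_triangle k. taylor k X Y c s t * ((x - X) ^ s * (y - Y) ^ t))"
    unfolding hom_poly_taylor[of k c _ X Y] by (intro sum.cong) auto
  also have "\<dots> = (\<Sum>(s, t)\<in>{..k} \<times> {..k}. taylor k X Y c s t * ((x - X) ^ s * (y - Y) ^ t))"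
  proof (intro sum.mono_neutral_left ballI)
    fix z assume "z \<in> {..k} \<times> {..k} - exponent_triangle k"
    then have "taylor k X Y c (fst z) (snd z) = 0"
      by (intro taylor_outside) (auto simp: exponent_triangle_def)
    then show "(case z of (s, t) \<Rightarrow> taylor k X Y c s t * ((x - X) ^ s * (y - Y) ^ t)) = 0"
      by (simp add: split_beta)
  qed (auto simp: exponent_triangle_def)
  also have "\<dots> = (\<Sum>s\<le>k. \<Sum>t\<le>k. taylor k X Y c s t * ((x - X) ^ s * (y - Y) ^ t))"
    by (simp add: sum.cartesian_product)
  also have "\<dots> = (\<Sum>t\<le>k. \<Sum>s\<le>k. taylor k X Y c s t * ((x - X) ^ s * (y - Y) ^ t))"
    by (rule sum.swap)
  finally show ?thesis
    by (simp add: sum_distrib_right mult.assoc)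
qed

lemma vanishes_to_iff_taylor:
  assumes D: "D \<subseteq> exponent_triangle k" and c: "\<And>z. z \<notin> D \<Longrightarrow> c z = 0"
  shows "vanishes_to (plane_poly D c) m (X, Y) \<longleftrightarrow> (\<forall>s t. s + t < m \<longrightarrow> taylor k X Y c s t = 0)"
proof -
  have "(deriv ^^ s) (\<lambda>x. (deriv ^^ t) (plane_poly D c x) Y) X = fact s * (fact t * taylor k X Y c s t)" for s t
  proof -
    have inner: "(deriv ^^ t) (plane_poly D c x) Y = (\<Sum>s\<le>k. (fact t * taylor k X Y c s t) * (x - X) ^ s)" for x
    proof -
      have "plane_poly D c x = (\<lambda>y. \<Sum>t\<le>k. (\<Sum>s\<le>k. taylor k X Y c s t * (x - X) ^ s) * (y - Y) ^ t)"
        by (rule ext) (rule plane_poly_taylor[OF D c])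
      then have "(deriv ^^ t) (plane_poly D c x) Y = fact t * (\<Sum>s\<le>k. taylor k X Y c s t * (x - X) ^ s)"
        using deriv_shifted_power_sum[of k "\<lambda>t. \<Sum>s\<le>k. taylor k X Y c s t * (x - X) ^ s" t Y]
        by (simp add: taylor_outside)
      then show ?thesis
        by (simp add: sum_distrib_left mult.assoc)
    qed
    show ?thesis
      unfolding inner by (rule deriv_shifted_power_sum) (simp add: taylor_outside)
  qed
  then show ?thesis
    by (simp add: vanishes_to_def)
qed

lemma card_derivative_indices: "card {(s, t). s + t < (m::nat)} = m * (m + 1) div 2"
proof -
  have eq: "{(s, t). s + t < m} = (SIGMA s:{..<m}. {..<m - s})"
    by auto
  have "card {(s, t). s + t < m} = (\<Sum>s<m. m - s)"
    unfolding eq by simp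
  also have "\<dots> = (\<Sum>s<m. Suc s)"
    by (rule sum.reindex_bij_witness[of _ "\<lambda>s. m - Suc s" "\<lambda>s. m - Suc s"]) auto
  also have "\<dots> = \<Sum>{0..m}"
    by (induction m) auto
  also have "\<dots> = m * (m + 1) div 2"
    by (simp add: gauss_sum_nat)
  finally show ?thesis .
qed

text \<open>Since the dimension of a non-special nonempty system is \<open>#D\<close> minus the number of conditions,
  the conditions are independent, that is, the partial Taylor expansions can be prescribed.\<close>

lemma nonspecial_prescribed_taylor:
  assumes D: "finite D" "D \<subseteq> exponent_triangle k"
    and dim: "system_dim r D m (\<lambda>i. (X i, Y i)) = expected_dim r D m"
      "0 \<le> system_dim r D m (\<lambda>i. (X i, Y i))"
  shows "\<exists>c. (\<forall>z. z \<notin> D \<longrightarrow> c z = 0) \<and>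
    (\<forall>i\<in>{1..r}. \<forall>s t. s + t < m i \<longrightarrow> taylor k (X i) (Y i) c s t = T i s t)"
proof -
  define S where "S = (SIGMA i:{1..r}. {(s, t). s + t < m i})"
  have fin: "finite {(s, t). s + t < m i}" for i
    by (rule finite_subset[of _ "{..m i} \<times> {..m i}"]) auto
  then have S: "finite S"
    unfolding S_def by (intro finite_SigmaI) auto
  have cardS: "card S = (\<Sum>i\<in>{1..r}. m i * (m i + 1) div 2)"
    unfolding S_def using fin by (simp add: card_SigmaI card_derivative_indices)
  let ?U = "{c :: nat \<times> nat \<Rightarrow> complex. \<forall>z. z \<notin> D \<longrightarrow> c z = 0}"
  define l where "l = (\<lambda>(i, s, t) c. taylor k (X i) (Y i) c s t)"
  have sys: "linear_system r D m (\<lambda>i. (X i, Y i)) = {c \<in> ?U. \<forall>s\<in>S. l s c = 0}"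
  proof (intro equalityI subsetI)
    fix c assume "c \<in> linear_system r D m (\<lambda>i. (X i, Y i))"
    then have c: "\<And>z. z \<notin> D \<Longrightarrow> c z = 0" "\<And>i. i \<in> {1..r} \<Longrightarrow> vanishes_to (plane_poly D c) (m i) (X i, Y i)"
      unfolding linear_system_def by auto
    then show "c \<in> {c \<in> ?U. \<forall>s\<in>S. l s c = 0}"
      using vanishes_to_iff_taylor[OF D(2) c(1)] by (auto simp: S_def l_def)
  next
    fix c assume "c \<in> {c \<in> ?U. \<forall>s\<in>S. l s c = 0}"
    then have c: "\<And>z. z \<notin> D \<Longrightarrow> c z = 0" "\<forall>s\<in>S. l s c = 0"
      by auto
    then have "vanishes_to (plane_poly D c) (m i) (X i, Y i)" if "i \<in> {1..r}" for i
      using vanishes_to_iff_taylor[OF D(2), of c "m i" "X i" "Y i"] c that by (auto simp: S_def l_def)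
    then show "c \<in> linear_system r D m (\<lambda>i. (X i, Y i))"
      using c(1) by (simp add: linear_system_def)
  qed
  \<comment> \<open>Nonnegative dimension rules out the value -1 of the maximum in
    \<open>expected_dim\<close>, so the count is exact.\<close>
  have "int (cfun.dim {c \<in> ?U. \<forall>s\<in>S. l s c = 0}) = int (card D) - (\<Sum>i=1..r. int (m i * (m i + 1) div 2))"
    using dim unfolding system_dim_def expected_dim_def sys by (auto simp: max_def split: if_splits)
  also have "(\<Sum>i=1..r. int (m i * (m i + 1) div 2)) = int (card S)"
    unfolding cardS by simp
  finally have "cfun.dim {c \<in> ?U. \<forall>s\<in>S. l s c = 0} + card S = cfun.dim ?U"
    unfolding dim_supported_functions(3)[OF D(1)] by linarith
  moreover obtain E where "finite E" "?U \<subseteq> cfun.span E"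
    using dim_supported_functions(2)[OF D(1)] by blast
  ultimately have "\<exists>c\<in>?U. \<forall>s\<in>S. l s c = (\<lambda>(i, s, t). T i s t) s"
    by (intro cfun.functionals_surjective[OF S dim_supported_functions(1)[OF D(1)]])
      (auto simp: l_def taylor_add taylor_cmult)
  then obtain c where "c \<in> ?U" "\<forall>s\<in>S. l s c = (\<lambda>(i, s, t). T i s t) s"
    by blast
  then show ?thesis
    by (intro exI[of _ c]) (auto simp: S_def l_def)
qed

subsection \<open>Leading forms along the exceptional curves\<close>

lemma binary_form_mult_linear:
  fixes A B :: complex
  assumes "\<And>U V. f U V = (\<Sum>s\<le>n. c s * U ^ s * V ^ (n - s))"
  shows "\<exists>c'. \<forall>U V. (A * U + B * V) * f U V = (\<Sum>s\<le>Suc n. c' s * U ^ s * V ^ (Suc n - s))"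
proof -
  define c' where "c' s = (if s = 0 then 0 else A * c (s - 1)) + (if s \<le> n then B * c s else 0)" for s
  have "(A * U + B * V) * f U V = (\<Sum>s\<le>Suc n. c' s * U ^ s * V ^ (Suc n - s))" for U V
  proof -
    have "(\<Sum>s\<le>Suc n. c' s * U ^ s * V ^ (Suc n - s)) =
        (\<Sum>s\<le>Suc n. (if s = 0 then 0 else A * c (s - 1)) * U ^ s * V ^ (Suc n - s)) +
        (\<Sum>s\<le>Suc n. (if s \<le> n then B * c s else 0) * U ^ s * V ^ (Suc n - s))"
      by (simp only: c'_def distrib_right sum.distrib)
    also have "(\<Sum>s\<le>Suc n. (if s = 0 then 0 else A * c (s - 1)) * U ^ s * V ^ (Suc n - s)) =
        (\<Sum>s\<le>n. A * U * (c s * U ^ s * V ^ (n - s)))"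
      unfolding sum.atMost_Suc_shift by (simp add: mult_ac)
    also have "(\<Sum>s\<le>Suc n. (if s \<le> n then B * c s else 0) * U ^ s * V ^ (Suc n - s)) =
        (\<Sum>s\<le>n. B * V * (c s * U ^ s * V ^ (n - s)))"
      unfolding sum.atMost_Suc by (simp add: Suc_diff_le mult_ac)
    finally show ?thesis
      unfolding assms by (simp only: distrib_right sum_distrib_left sum.distrib mult.assoc)
  qed
  then show ?thesis
    by blast
qed

lemma binary_form_mult_power:
  fixes A B :: complex
  assumes "\<exists>c. \<forall>U V. f U V = (\<Sum>s\<le>n. c s * U ^ s * V ^ (n - s))"
  shows "\<exists>c. \<forall>U V. (A * U + B * V) ^ m * f U V = (\<Sum>s\<le>m + n. c s * U ^ s * V ^ (m + n - s))"
proof (induction m)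
  case 0
  then show ?case
    using assms by simp
next
  case (Suc m)
  then obtain c where "\<And>U V. (A * U + B * V) ^ m * f U V = (\<Sum>s\<le>m + n. c s * U ^ s * V ^ (m + n - s))"
    by blast
  from binary_form_mult_linear[of "\<lambda>U V. (A * U + B * V) ^ m * f U V", OF this, of A B] show ?case
    by (simp only: power_Suc mult.assoc add_Suc)
qed

text \<open>Only the existence of the coefficients matters. With one linear form equal to 1 and the
  other equal to the parameter on an exceptional curve, these binary forms restrict to the powers
  t^a.\<close>

lemma binary_form_expansion:
  fixes A B A' B' :: complex
  assumes "a \<le> n"
  shows "\<exists>c. \<forall>U V. (A * U + B * V) ^ (n - a) * (A' * U + B' * V) ^ a = (\<Sum>s\<le>n. c s * U ^ s * V ^ (n - s))"
proof -
  have "\<exists>c. \<forall>U V :: complex. 1 = (\<Sum>s\<le>0. c s * U ^ s * V ^ (0 - s))"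
    by (intro exI[of _ "\<lambda>_. 1"]) simp
  from binary_form_mult_power[OF this, of A' B' a]
  have "\<exists>c. \<forall>U V. (A' * U + B' * V) ^ a = (\<Sum>s\<le>a. c s * U ^ s * V ^ (a - s))"
    by simp
  from binary_form_mult_power[OF this, of A B "n - a"] show ?thesis
    using assms by simp
qed

lemma dot_vector: "dot (vector [a, b, c]) v = a * v $ 1 + b * v $ 2 + c * v $ 3"
  by (simp add: dot_def sum_3)

text \<open>For \<open>n \<ge> e\<close>, the coefficient families \<open>b n 0, \<dots>, b n (e - 1)\<close> of binary forms of degree \<open>n\<close> are
  independent modulo the leading forms at \<open>(X, Y)\<close> of the curves that contain the image of \<open>C\<close>.\<close>

definition leading_form_basis ::
  "(nat \<Rightarrow> point) set \<Rightarrow> complex \<Rightarrow> complex \<Rightarrow> nat \<Rightarrow> (nat \<Rightarrow> nat \<Rightarrow> nat \<Rightarrow> complex) \<Rightarrow> bool" where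
  "leading_form_basis C X Y e b \<longleftrightarrow> (\<forall>n k c y. e \<le> n \<longrightarrow> hom_poly k c \<in> cone_ideal C \<longrightarrow>
     (\<forall>s t. s + t < n \<longrightarrow> taylor k X Y c s t = 0) \<longrightarrow>
     (\<forall>s\<le>n. taylor k X Y c s (n - s) = (\<Sum>a<e. y a * b n a s)) \<longrightarrow> (\<forall>a<e. y a = 0))"

context blown_up_points
begin

text \<open>If the plane curve \<open>hom_poly k c\<close> contains the image of \<open>C\<close> and has multiplicity at least \<open>n\<close>
  at the \<open>j\<close>-th point, then its pullback minus \<open>n\<close> times the exceptional curve still contains \<open>C\<close>,
  and its trace on the exceptional curve is the leading form.\<close>

lemma exceptional_trace:
  assumes C: "irreducible_curve {0..r} C" "C \<subseteq> blowup r p" and j: "j \<in> {1..r}"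
    and neq: "C \<noteq> exceptional_curve r p j" and P1: "P j $ 1 = 1"
    and van: "hom_poly k c \<in> cone_ideal C"
    and mult: "\<And>s t. s + t < n \<Longrightarrow> taylor k (P j $ 2) (P j $ 3) c s t = 0" and n: "n \<le> k"
  obtains d F where "F \<in> forms {0..r} d" "\<And>q. q \<in> C \<Longrightarrow> vanishes_at {0..r} F q"
    "\<And>v. v 0 = P j \<Longrightarrow> F v = (\<Sum>s\<le>n. taylor k (P j $ 2) (P j $ 3) c s (n - s) * v j $ 3 ^ s * (- v j $ 2) ^ (n - s))"
proof -
  let ?X = "P j $ 2" and ?Y = "P j $ 3"
  let ?T = "taylor k ?X ?Y c"
  \<comment> \<open>\<open>u\<close> and \<open>w\<close> are the homogenised local coordinates at
    \<open>P j\<close>. On the blow-up the line component through \<open>P j\<close> makes (U, V)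
    proportional to (u, w), so these are the usual projective coordinates on the exceptional
    curve.\<close>
  define Z u w U V where "Z = (vector [1, 0, 0] :: complex ^ 3)" and "u = (vector [- ?X, 1, 0] :: complex ^ 3)"
    and "w = (vector [- ?Y, 0, 1] :: complex ^ 3)" and "U = (vector [0, 0, 1] :: complex ^ 3)"
    and "V = (vector [0, - 1, 0] :: complex ^ 3)"
  have dots: "dot Z x = x $ 1" "dot u x = x $ 2 - ?X * x $ 1" "dot w x = x $ 3 - ?Y * x $ 1"
    "dot U x = x $ 3" "dot V x = - x $ 2" for x
    by (simp_all add: Z_def u_def w_def U_def V_def dot_vector)
  define A where "A = {z \<in> exponent_triangle k. n \<le> fst z + snd z}"
  \<comment> \<open>From u^s w^t with s + t \<ge> n, exactly n factors are replaced by factors U or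
    V, those of u first. This divides the pullback by the n-th power of the equation of the
    exceptional curve.\<close>
  define m where "m s t v = dot Z (v 0) ^ (k - s - t) *
      (dot u (v 0) ^ (s - min s n) * dot w (v 0) ^ (t - (n - min s n))) *
      (dot U (v j) ^ min s n * dot V (v j) ^ (n - min s n))" for s t and v :: coords
  define F where "F v = (\<Sum>z\<in>A. ?T (fst z) (snd z) * m (fst z) (snd z) v)" for v
  have finA: "finite A"
    using finite_exponent_triangle by (simp add: A_def)
  let ?d = "\<lambda>l. (k - n) * (if l = 0 then 1 else 0) + n * (if l = j then 1 else 0)"
  have F: "F \<in> forms {0..r} ?d"
    unfolding F_def[abs_def]
  proof (intro forms_sum forms_cmult)
    fix z assume z: "z \<in> A"
    obtain s t where st: "z = (s, t)"
      by (cases z)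
    then have le: "s + t \<le> k" "n \<le> s + t"
      using z by (simp_all add: A_def exponent_triangle_def)
    let ?a = "\<lambda>l. if l = 0 then 1 else (0::nat)" and ?b = "\<lambda>l. if l = j then 1 else (0::nat)"
    have "m s t \<in> forms {0..r} (\<lambda>l. (k - s - t) * ?a l + ((s - min s n) * ?a l + (t - (n - min s n)) * ?a l) +
        (min s n * ?b l + (n - min s n) * ?b l))"
      unfolding m_def[abs_def] using j by (intro forms_mult forms_power forms_dot) auto
    also have "\<dots> = forms {0..r} ?d"
    proof (rule forms_degree_cong)
      have "(k - s - t) + ((s - min s n) + (t - (n - min s n))) = k - n" "min s n + (n - min s n) = n"
        using le by (auto simp: min_def)
      then show "(k - s - t) * ?a l + ((s - min s n) * ?a l + (t - (n - min s n)) * ?a l) +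
          (min s n * ?b l + (n - min s n) * ?b l) = ?d l" for l
        by auto
    qed
    finally show "m (fst z) (snd z) \<in> forms {0..r} ?d"
      using st by simp
  qed
  have F_exc: "F v = (\<Sum>s\<le>n. ?T s (n - s) * v j $ 3 ^ s * (- v j $ 2) ^ (n - s))" if v: "v 0 = P j" for v
  proof -
    \<comment> \<open>On the exceptional curve u = w = 0, so only the terms in which all the factors
      were replaced survive.\<close>
    have m0: "m s t v = (if s + t = n then v j $ 3 ^ s * (- v j $ 2) ^ (n - s) else 0)"
      if "n \<le> s + t" for s t
    proof (cases "s + t = n")
      case True
      then have "min s n = s" "t - (n - s) = 0"
        by auto
      then show ?thesis
        using True v P1 by (simp add: m_def dots)
    next
      case False
      then have "s - min s n > 0 \<or> t - (n - min s n) > 0"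
        using that by (auto simp: min_def)
      then show ?thesis
        using False v P1 by (auto simp: m_def dots power_0_left)
    qed
    have "F v = (\<Sum>z\<in>A. if fst z + snd z = n then ?T (fst z) (snd z) * (v j $ 3 ^ fst z * (- v j $ 2) ^ (n - fst z)) else 0)"
      unfolding F_def by (intro sum.cong refl) (auto simp: A_def m0)
    also have "\<dots> = (\<Sum>z\<in>{z \<in> A. fst z + snd z = n}. ?T (fst z) (snd z) * (v j $ 3 ^ fst z * (- v j $ 2) ^ (n - fst z)))"
      using finA by (simp add: sum.inter_filter)
    also have "\<dots> = (\<Sum>s\<le>n. ?T s (n - s) * (v j $ 3 ^ s * (- v j $ 2) ^ (n - s)))"
      using n by (intro sum.reindex_bij_witness[of _ "\<lambda>s. (s, n - s)" fst]) (auto simp: A_def exponent_triangle_def)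
    finally show ?thesis
      by (simp add: mult.assoc)
  qed
  have irr: "zariski_irreducible {0..r} C"
    using C(1) by (simp add: irreducible_curve_def)
  have not_sub: "\<not> C \<subseteq> exceptional_curve r p j"
  proof -
    obtain q where q: "q \<in> exceptional_curve r p j"
      using exceptional_curve_nonempty[OF j] by blast
    obtain a b lam bet where "rational_curve r p (exceptional_curve r p j) a b lam j bet"
      by (rule exceptional_rational_curve[OF j q])
    then show ?thesis
      using rational_curve.curve_not_subset C(1) neq by blast
  qed
  have "\<forall>q\<in>C. vanishes_at {0..r} F q"
  proof (rule zariski_irreducible_vanishing[OF irr F zariski_closed_exceptional_curve[OF j] not_sub])
    fix q assume q: "q \<in> C" "q \<notin> exceptional_curve r p j"
    then have "q \<in> blowup r p"
      using C(2) by blast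
    then obtain v where v: "\<And>i. i \<in> {0..r} \<Longrightarrow> v i \<noteq> 0" "q = pt {0..r} v"
      "\<And>j. j \<in> {1..r} \<Longrightarrow> dot (v j) (P j) = 0" "\<And>j. j \<in> {1..r} \<Longrightarrow> dot (v j) (v 0) = 0"
      by (rule blowup_rep) blast
    have "vec.span {v 0} \<noteq> vec.span {P j}"
      using q(2) \<open>q \<in> blowup r p\<close> by (simp add: exceptional_curve_def v(2) pt_nth p_eq[OF j])
    then have "crs (P j) (v 0) \<noteq> 0"
      using span_eq_span_iff_crs v(1)[of 0] P_nz[OF j] by simp
    have uw: "dot u (v 0) \<noteq> 0 \<or> dot w (v 0) \<noteq> 0"
    proof (rule ccontr)
      assume "\<not> ?thesis"
      then have "v 0 $ 2 = ?X * v 0 $ 1" "v 0 $ 3 = ?Y * v 0 $ 1"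
        by (simp_all add: dots)
      then have "crs (P j) (v 0) = 0"
        using P1 by (simp add: vec_eq_iff forall_3 crs_nth)
      then show False
        using \<open>crs (P j) (v 0) \<noteq> 0\<close> by simp
    qed
    have "dot (v j) (P j) = 0" "dot (v j) (v 0) = 0"
      using v(3,4) j by blast+
    then have "v j $ 1 + ?X * v j $ 2 + ?Y * v j $ 3 = 0"
      "v j $ 1 * v 0 $ 1 + v j $ 2 * v 0 $ 2 + v j $ 3 * v 0 $ 3 = 0"
      using P1 by (simp_all add: dot_def sum_3 mult.commute)
    then have rel: "dot u (v 0) * v j $ 2 + dot w (v 0) * v j $ 3 = 0"
      unfolding dots by algebra
    \<comment> \<open>Off the exceptional curve, u or w is nonzero and determines the factor. There
      \<open>F\<close> is \<open>\<rho> ^ n\<close> times the plane form, which vanishes on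
      \<open>C\<close>.\<close>
    obtain \<rho> where \<rho>: "dot U (v j) = \<rho> * dot u (v 0)" "dot V (v j) = \<rho> * dot w (v 0)"
    proof (cases "dot u (v 0) = 0")
      case True
      then have "v j $ 3 = 0" "dot w (v 0) \<noteq> 0"
        using uw rel by auto
      then show thesis
        using that[of "- v j $ 2 / dot w (v 0)"] True by (simp add: dots(4,5))
    next
      case False
      have "- v j $ 2 = (v j $ 3 / dot u (v 0)) * dot w (v 0)"
      proof -
        have "- (v j $ 2 * dot u (v 0)) = v j $ 3 * dot w (v 0)"
          using rel by (simp add: add_eq_0_iff mult.commute)
        then show ?thesis
          using False by (simp add: field_simps)
      qed
      then show thesis
        using that[of "v j $ 3 / dot u (v 0)"] False by (simp add: dots(4,5))
    qed
    have m_eq: "m s t v = \<rho> ^ n * (dot Z (v 0) ^ (k - s - t) * dot u (v 0) ^ s * dot w (v 0) ^ t)" if "n \<le> s + t" for s t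
    proof -
      have s: "s = (s - min s n) + min s n" and t: "t = (t - (n - min s n)) + (n - min s n)"
        and nn: "n = min s n + (n - min s n)"
        using that by (auto simp: min_def)
      have "\<rho> ^ n = \<rho> ^ min s n * \<rho> ^ (n - min s n)"
        using nn by (metis power_add)
      moreover have "dot u (v 0) ^ s = dot u (v 0) ^ (s - min s n) * dot u (v 0) ^ min s n"
        using s by (metis power_add)
      moreover have "dot w (v 0) ^ t = dot w (v 0) ^ (t - (n - min s n)) * dot w (v 0) ^ (n - min s n)"
        using t by (metis power_add)
      ultimately show ?thesis
        unfolding m_def \<rho> by (simp only: power_mult_distrib mult_ac)
    qed
    have "F v = \<rho> ^ n * (\<Sum>z\<in>A. ?T (fst z) (snd z) * (dot Z (v 0) ^ (k - fst z - snd z) * dot u (v 0) ^ fst z * dot w (v 0) ^ snd z))"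
      unfolding F_def sum_distrib_left by (intro sum.cong refl) (auto simp: A_def m_eq mult_ac)
    also have "(\<Sum>z\<in>A. ?T (fst z) (snd z) * (dot Z (v 0) ^ (k - fst z - snd z) * dot u (v 0) ^ fst z * dot w (v 0) ^ snd z)) =
        (\<Sum>z\<in>exponent_triangle k. ?T (fst z) (snd z) * (dot Z (v 0) ^ (k - fst z - snd z) * dot u (v 0) ^ fst z * dot w (v 0) ^ snd z))"
      using mult by (intro sum.mono_neutral_left finite_exponent_triangle) (auto simp: A_def not_le)
    also have "\<dots> = hom_poly k c (v 0)"
      unfolding hom_poly_taylor[of k c "v 0" ?X ?Y] by (simp add: split_beta dots)
    also have "hom_poly k c (v 0) = 0"
    proof -
      have "v 0 \<in> q 0"
        by (simp add: v(2) pt_nth vec.span_base)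
      then show ?thesis
        using van q(1) by (simp add: cone_ideal_def)
    qed
    finally have "F v = 0"
      by simp
    then show "vanishes_at {0..r} F q"
      unfolding v(2) using vanishes_at_pt[OF F] by blast
  qed
  then show thesis
    using that[OF F] F_exc by blast
qed

text \<open>The family consists of the binary forms that restrict to the powers t^a, a < e, on the
  exceptional curve. A leading form in their span restricts to a polynomial of degree below e. If it
  belongs to a curve through the image of \<open>C\<close>, this polynomial is divisible by
  \<open>h\<close>, whose degree is e, so it is 0.\<close>

lemma exceptional_leading_forms:
  assumes C: "irreducible_curve {0..r} C" "C \<subseteq> blowup r p" and j: "j \<in> {1..r}"
    and neq: "C \<noteq> exceptional_curve r p j" and P1: "P j $ 1 = 1"
  defines "e \<equiv> curve_int r p (exceptional_curve r p j) C"
  shows "\<exists>b. leading_form_basis C (P j $ 2) (P j $ 3) e b"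
proof -
  let ?T = "exceptional_curve r p j" and ?X = "P j $ 2" and ?Y = "P j $ 3"
  obtain q0 where q0: "q0 \<in> ?T"
    using exceptional_curve_nonempty[OF j] by blast
  obtain a b lam bet where "rational_curve r p ?T a b lam j bet"
    by (rule exceptional_rational_curve[OF j q0])
  then have "\<not> ?T \<subseteq> C"
    using rational_curve.not_subset_curve[OF _ C(1)] neq by blast
  then obtain q where q: "q \<in> ?T" "q \<notin> C"
    by blast
  obtain a b lam bet where rc: "rational_curve r p ?T a b lam j bet"
    "pt {0..r} (\<lambda>l. if b l = 0 then a l else b l) = q"
    "a 0 = P j" "b 0 = 0" "dot (a j) (P j) = 0" "dot (b j) (P j) = 0"
    by (rule exceptional_rational_curve[OF j q(1)])
  have closed: "zariski_closed {0..r} C"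
    using C(1) unfolding irreducible_curve_def zariski_irreducible_def by blast
  obtain h where h: "h \<noteq> 0" "curve_int r p ?T C = degree h"
    "\<forall>d. \<forall>F\<in>forms {0..r} d. \<forall>f. (\<forall>q\<in>C. vanishes_at {0..r} F q) \<longrightarrow>
      (\<forall>t. F (\<lambda>l. a l + t *s b l) = poly f t) \<longrightarrow> h dvd f"
    by (rule rational_curve.curve_int_data[OF rc(1) closed C(2) q(2)[folded rc(2)]]) blast
  have e: "e = degree h"
    by (simp add: e_def h(2))
  define x where "x t = a j + t *s b j" for t
  \<comment> \<open>On lines through \<open>P j\<close> the first coordinate is a combination of the
    others. Eliminating it turns \<open>lam j\<close> and \<open>bet\<close> into binary forms in
    the third and the negated second coordinate.\<close>
  define A B A' B' where "A = lam j $ 3 - lam j $ 1 * ?Y" and "B = lam j $ 1 * ?X - lam j $ 2"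
    and "A' = bet $ 3 - bet $ 1 * ?Y" and "B' = bet $ 1 * ?X - bet $ 2"
  have x1: "x t $ 1 = - ?X * x t $ 2 - ?Y * x t $ 3" for t
  proof -
    have "dot (x t) (P j) = 0"
      using rc by (simp add: x_def dot_simps)
    then have "x t $ 1 + ?X * x t $ 2 + ?Y * x t $ 3 = 0"
      using P1 by (simp add: dot_def sum_3 mult.commute)
    then show ?thesis
      by algebra
  qed
  have AB: "A * x t $ 3 + B * (- x t $ 2) = 1" for t
  proof -
    have "dot (lam j) (x t) = 1"
      using rational_curve.lam_a[OF rc(1)] rational_curve.lam_b[OF rc(1)] j by (simp add: x_def dot_simps)
    then show ?thesis
      by (simp add: A_def B_def dot_def sum_3 x1 algebra_simps)
  qed
  have AB': "A' * x t $ 3 + B' * (- x t $ 2) = t" for t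
  proof -
    have "dot bet (x t) = t"
      using rational_curve.bet_a[OF rc(1)] rational_curve.bet_b[OF rc(1)] by (simp add: x_def dot_simps)
    then show ?thesis
      by (simp add: A'_def B'_def dot_def sum_3 x1 algebra_simps)
  qed
  have "\<forall>n a. \<exists>c. a \<le> n \<longrightarrow> (\<forall>U V. (A * U + B * V) ^ (n - a) * (A' * U + B' * V) ^ a = (\<Sum>s\<le>n. c s * U ^ s * V ^ (n - s)))"
    using binary_form_expansion by blast
  then obtain f where f: "\<And>n a U V. a \<le> n \<Longrightarrow>
      (A * U + B * V) ^ (n - a) * (A' * U + B' * V) ^ a = (\<Sum>s\<le>n. f n a s * U ^ s * V ^ (n - s))"
    by metis
  have f_x: "(\<Sum>s\<le>n. f n a s * x t $ 3 ^ s * (- x t $ 2) ^ (n - s)) = t ^ a" if "a \<le> n" for n a t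
    using f[OF that, of "x t $ 3" "- x t $ 2"] unfolding AB AB' by simp
  show ?thesis
    unfolding leading_form_basis_def
  proof (intro exI[of _ f] allI impI)
    fix n k c y i assume *: "e \<le> n" "hom_poly k c \<in> cone_ideal C"
      "\<forall>s t. s + t < n \<longrightarrow> taylor k ?X ?Y c s t = 0"
      "\<forall>s\<le>n. taylor k ?X ?Y c s (n - s) = (\<Sum>a<e. y a * f n a s)" "i < e"
    define g where "g = (\<Sum>a<e. monom (y a) a)"
    have g: "poly g t = (\<Sum>s\<le>n. taylor k ?X ?Y c s (n - s) * x t $ 3 ^ s * (- x t $ 2) ^ (n - s))" for t
    proof -
      have "(\<Sum>s\<le>n. taylor k ?X ?Y c s (n - s) * x t $ 3 ^ s * (- x t $ 2) ^ (n - s)) =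
          (\<Sum>s\<le>n. \<Sum>a<e. y a * (f n a s * x t $ 3 ^ s * (- x t $ 2) ^ (n - s)))"
        using *(4) by (intro sum.cong refl) (simp add: sum_distrib_right mult.assoc)
      also have "\<dots> = (\<Sum>a<e. \<Sum>s\<le>n. y a * (f n a s * x t $ 3 ^ s * (- x t $ 2) ^ (n - s)))"
        by (rule sum.swap)
      also have "\<dots> = (\<Sum>a<e. y a * (\<Sum>s\<le>n. f n a s * x t $ 3 ^ s * (- x t $ 2) ^ (n - s)))"
        by (simp only: sum_distrib_left)
      also have "\<dots> = (\<Sum>a<e. y a * t ^ a)"
        using *(1) by (intro sum.cong refl) (simp only: f_x lessThan_iff)
      finally show ?thesis
        by (simp add: g_def poly_sum poly_monom)
    qed
    have "h dvd g"
    proof (cases "n \<le> k")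
      case True
      obtain d F where F: "F \<in> forms {0..r} d" "\<And>q. q \<in> C \<Longrightarrow> vanishes_at {0..r} F q"
        "\<And>v. v 0 = P j \<Longrightarrow> F v = (\<Sum>s\<le>n. taylor k ?X ?Y c s (n - s) * v j $ 3 ^ s * (- v j $ 2) ^ (n - s))"
        by (rule exceptional_trace[OF C j neq P1 *(2) _ True]) (use *(3) in blast)+
      have "F (\<lambda>l. a l + t *s b l) = poly g t" for t
        by (subst F(3)) (simp_all add: rc(3,4) g x_def)
      then show ?thesis
        using h(3) F(1,2) by blast
    next
      \<comment> \<open>If n exceeds the degree k, all Taylor coefficients of order n are 0.\<close>
      case False
      then have "taylor k ?X ?Y c s (n - s) = 0" if "s \<le> n" for s
        using that by (intro taylor_outside) simp
      then have "poly g t = poly 0 t" for t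
        by (simp add: g)
      then have "g = 0"
        using poly_all_0_iff_0 by force
      then show ?thesis
        by simp
    qed
    have coeff: "coeff g i = (if i < e then y i else 0)" for i
      by (simp add: g_def coeff_sum)
    have "g = 0"
    proof (rule ccontr)
      assume "g \<noteq> 0"
      then have "degree h \<le> degree g"
        using \<open>h dvd g\<close> by (rule dvd_imp_degree_le[rotated])
      moreover have "coeff g (degree g) \<noteq> 0"
        using \<open>g \<noteq> 0\<close> by simp
      ultimately show False
        using coeff[of "degree g"] e by (simp split: if_splits)
    qed
    then show "y i = 0"
      using coeff[of i] *(5) by simp
  qed
qed

end

subsection \<open>Counting conditions\<close>

text \<open>The points have first coordinate 1 where this is used, so their affine coordinates are
  the other two entries. The bound \<open>c\<close> will be the lower end k m (1 - 1/(N+1)) of the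
  tolerance.\<close>

definition admits_system :: "nat \<Rightarrow> (nat \<Rightarrow> complex ^ 3) \<Rightarrow> nat \<Rightarrow> real \<Rightarrow> bool" where
  "admits_system r P k c \<longleftrightarrow> (\<exists>mk D. finite D \<and> D \<subseteq> exponent_triangle k \<and>
     system_dim r D mk (\<lambda>i. (P i $ 2, P i $ 3)) = expected_dim r D mk \<and>
     0 \<le> system_dim r D mk (\<lambda>i. (P i $ 2, P i $ 3)) \<and> (\<forall>i\<in>{1..r}. c \<le> real (mk i)))"

context blown_up_points
begin

lemma line_exceptional_disjoint:
  assumes "j \<in> {1..r}" "dot n (P j) \<noteq> 0"
  shows "line_preimage r p (vec.span {n}) \<inter> exceptional_curve r p j = {}"
  using assms by (auto simp: line_preimage_def exceptional_curve_def p_eq on_line_span)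

lemma exceptional_disjoint:
  assumes "i \<in> {1..r}" "j \<in> {1..r}" "i \<noteq> j"
  shows "exceptional_curve r p i \<inter> exceptional_curve r p j = {}"
proof -
  have "p i \<noteq> p j"
    unfolding p_eq[OF assms(1)] p_eq[OF assms(2)]
    using span_eq_span_iff_crs[OF P_nz[OF assms(1)] P_nz[OF assms(2)]] P_distinct[OF assms(2,1)] assms(3) by auto
  then show ?thesis
    by (auto simp: exceptional_curve_def)
qed

lemma line_dot_exceptional:
  assumes "j \<in> {1..r}"
  shows "line_dot r p (exceptional_curve r p j) = 0"
proof -
  obtain n where n: "\<And>j. j \<in> {1..r} \<Longrightarrow> dot n (P j) \<noteq> 0"
    "line_dot r p (exceptional_curve r p j) = int (curve_int r p (line_preimage r p (vec.span {n})) (exceptional_curve r p j))"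
    by (rule line_dot_eq_curve_int[of "exceptional_curve r p j"]) blast
  then show ?thesis
    using line_exceptional_disjoint[OF assms n(1)[OF assms]] by (simp add: curve_int_def)
qed

text \<open>Only the sign matters. For i = j the value is H.E_j = 0 minus a length; for i \<noteq> j
  the curves are disjoint.\<close>

lemma exceptional_dot_exceptional:
  assumes "i \<in> {1..r}" "j \<in> {1..r}"
  shows "exceptional_dot r p i (exceptional_curve r p j) \<le> 0"
proof (cases "i = j")
  case True
  then show ?thesis
    using line_dot_exceptional[OF assms(2)] by (simp add: exceptional_dot_def Let_def)
next
  case False
  have "exceptional_curve r p j \<noteq> exceptional_curve r p i"
    using exceptional_disjoint[OF assms False] exceptional_curve_nonempty[OF assms(1)] by auto
  then show ?thesis
    using exceptional_disjoint[OF assms False] by (simp add: exceptional_dot_def curve_int_def)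
qed

text \<open>For each (j, n, a) there is a form of order at least n at the \<open>j\<close>-th point
  whose degree-n part there is the a-th family member, and which has order at least
  \<open>mk i\<close> at the other points. A combination in the ideal of the image of
  \<open>C\<close> is tested at one point at a time: the forms attached to the other points
  contribute nothing in orders below \<open>mk j\<close>.\<close>

lemma conditions_bound:
  assumes C: "irreducible_curve {0..r} C" "C \<subseteq> blowup r p"
    and neq: "\<And>j. j \<in> {1..r} \<Longrightarrow> C \<noteq> exceptional_curve r p j" and P1: "\<And>j. j \<in> {1..r} \<Longrightarrow> P j $ 1 = 1"
    and B: "finite B" "homogeneous k \<subseteq> cfun.span (B \<union> cone_ideal C)"
    and D: "finite D" "D \<subseteq> exponent_triangle k"
    and dim: "system_dim r D mk (\<lambda>i. (P i $ 2, P i $ 3)) = expected_dim r D mk"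
      "0 \<le> system_dim r D mk (\<lambda>i. (P i $ 2, P i $ 3))"
  defines "e \<equiv> \<lambda>j. curve_int r p (exceptional_curve r p j) C"
  shows "(\<Sum>j=1..r. (mk j - e j) * e j) \<le> card B"
proof -
  have "\<forall>j\<in>{1..r}. \<exists>b. leading_form_basis C (P j $ 2) (P j $ 3) (e j) b"
    unfolding e_def using exceptional_leading_forms[OF C _ neq P1] by blast
  from bchoice[OF this] obtain b where b: "\<forall>j\<in>{1..r}. leading_form_basis C (P j $ 2) (P j $ 3) (e j) (b j)"
    by blast
  \<comment> \<open>Orders below \<open>e j\<close> are left out, as the independent families exist
    only from \<open>e j\<close> on. If \<open>mk j\<close> is smaller, the range is empty, in line
    with truncated subtraction.\<close>
  define S where "S = (SIGMA j:{1..r}. {e j..<mk j} \<times> {..<e j})"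
  have S: "finite S"
    unfolding S_def by (intro finite_SigmaI) auto
  have "\<forall>x. \<exists>c. \<forall>i\<in>{1..r}. \<forall>s t. s + t < mk i \<longrightarrow> taylor k (P i $ 2) (P i $ 3) c s t =
      (if i = fst x \<and> s + t = fst (snd x) then b i (fst (snd x)) (snd (snd x)) s else 0)"
  proof
    fix x
    show "\<exists>c. \<forall>i\<in>{1..r}. \<forall>s t. s + t < mk i \<longrightarrow> taylor k (P i $ 2) (P i $ 3) c s t =
        (if i = fst x \<and> s + t = fst (snd x) then b i (fst (snd x)) (snd (snd x)) s else 0)"
      using nonspecial_prescribed_taylor[OF D dim,
        of "\<lambda>i s t. if i = fst x \<and> s + t = fst (snd x) then b i (fst (snd x)) (snd (snd x)) s else 0"] by blast
  qed
  from choice[OF this] obtain c where c: "\<And>x i s t. i \<in> {1..r} \<Longrightarrow> s + t < mk i \<Longrightarrow>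
      taylor k (P i $ 2) (P i $ 3) (c x) s t =
      (if i = fst x \<and> s + t = fst (snd x) then b i (fst (snd x)) (snd (snd x)) s else 0)"
    by blast
  have "card S \<le> card B"
  proof (rule cfun.card_le_of_independent_mod[OF cone_ideal_subspace S B(1), where f = "\<lambda>x. hom_poly k (c x)"])
    show "hom_poly k (c x) \<in> cfun.span (B \<union> cone_ideal C)" for x
      using B(2) hom_poly_homogeneous by blast
  next
    fix y assume y: "(\<Sum>x\<in>S. (\<lambda>v. y x * hom_poly k (c x) v)) \<in> cone_ideal C"
    define c' where "c' z = (\<Sum>x\<in>S. y x * c x z)" for z
    have "hom_poly k c' = (\<Sum>x\<in>S. (\<lambda>v. y x * hom_poly k (c x) v))"
      unfolding sum_fun_eq c'_def[abs_def] by (rule ext) (rule hom_poly_sum)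
    then have van: "hom_poly k c' \<in> cone_ideal C"
      using y by simp
    have taylor_c': "taylor k (P j $ 2) (P j $ 3) c' s t =
        (\<Sum>x\<in>S. if j = fst x \<and> s + t = fst (snd x) then y x * b j (fst (snd x)) (snd (snd x)) s else 0)"
      if "j \<in> {1..r}" "s + t < mk j" for j s t
      unfolding c'_def[abs_def] taylor_sum taylor_cmult by (intro sum.cong refl) (simp add: c[OF that])
    \<comment> \<open>Induction on the order: once the coefficients of lower order are 0, the part
      of degree n at the \<open>j\<close>-th point is the leading form to which independence
      applies.\<close>
    have "y (j, n, a) = 0" if "(j, n, a) \<in> S" for j n a
      using that
    proof (induction n arbitrary: a rule: less_induct)
      case (less n)
      have j: "j \<in> {1..r}" and n: "e j \<le> n" "n < mk j" and a: "a < e j"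
        using less.prems by (auto simp: S_def)
      have "taylor k (P j $ 2) (P j $ 3) c' s t = 0" if "s + t < n" for s t
      proof -
        have "s + t < mk j"
          using that n by simp
        from taylor_c'[OF j this] show ?thesis
          using less.IH that by (auto intro!: sum.neutral)
      qed
      moreover have "taylor k (P j $ 2) (P j $ 3) c' s (n - s) = (\<Sum>a<e j. y (j, n, a) * b j n a s)"
        if "s \<le> n" for s
      proof -
        have lt: "s + (n - s) < mk j"
          using that n by simp
        have "taylor k (P j $ 2) (P j $ 3) c' s (n - s) =
            (\<Sum>x\<in>S. if j = fst x \<and> n = fst (snd x) then y x * b j (fst (snd x)) (snd (snd x)) s else 0)"
          unfolding taylor_c'[OF j lt] using that by simp
        also have "\<dots> = (\<Sum>x\<in>{x \<in> S. j = fst x \<and> n = fst (snd x)}. y x * b j (fst (snd x)) (snd (snd x)) s)"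
          by (rule sum.inter_filter[OF S, symmetric])
        also have "\<dots> = (\<Sum>a<e j. y (j, n, a) * b j n a s)"
          using j n by (intro sum.reindex_bij_witness[of _ "\<lambda>a. (j, n, a)" "\<lambda>x. snd (snd x)"]) (auto simp: S_def)
        finally show ?thesis .
      qed
      ultimately have "\<forall>a<e j. y (j, n, a) = 0"
        using b[unfolded leading_form_basis_def, rule_format, OF j, of n k c' "\<lambda>a. y (j, n, a)"] n(1) van by blast
      then show ?case
        using a by blast
    qed
    then show "\<forall>x\<in>S. y x = 0"
      by auto
  qed
  moreover have "card S = (\<Sum>j=1..r. (mk j - e j) * e j)"
    unfolding S_def by (subst card_SigmaI) (auto simp: card_cartesian_product)
  ultimately show ?thesis
    by simp
qed

text \<open>If the inequality failed, a sufficiently small tolerance would keep a positive gap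
  \<open>\<gamma>\<close>. The count of conditions then grows faster than the dimension bound by
  \<open>\<gamma>\<close> for each k, and for large k this outweighs the constant
  \<open>R\<close>.\<close>

lemma exceptional_sum_le_line_dot:
  assumes C: "irreducible_curve {0..r} C" "C \<subseteq> blowup r p"
    and neq: "\<And>j. j \<in> {1..r} \<Longrightarrow> C \<noteq> exceptional_curve r p j" and P1: "\<And>j. j \<in> {1..r} \<Longrightarrow> P j $ 1 = 1"
    and m: "m > 0"
    and sys: "\<And>N::nat. \<exists>k0. \<forall>k\<ge>k0. admits_system r P k (real k * m * (1 - 1 / real (Suc N)))"
  shows "m * (\<Sum>j=1..r. real (curve_int r p (exceptional_curve r p j) C)) \<le> real_of_int (line_dot r p C)"
proof (rule ccontr)
  define e where "e j = curve_int r p (exceptional_curve r p j) C" for j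
  define E where "E = (\<Sum>j=1..r. real (e j))"
  obtain nL K0 K1 where nL: "line_dot r p C = int nL"
    and K: "\<forall>k\<ge>K0. \<exists>B. finite B \<and> card B \<le> K1 + k * nL \<and> homogeneous k \<subseteq> cfun.span (B \<union> cone_ideal C)"
    by (rule homogeneous_growth[OF C])
  assume "\<not> ?thesis"
  then have less: "real nL < m * E"
    by (simp add: nL E_def e_def)
  then have mE: "m * E > 0"
    by (smt (verit) of_nat_0_le_iff)
  obtain N where N: "1 / real (Suc N) < (m * E - real nL) / (m * E)"
    using nat_approx_posE[of "(m * E - real nL) / (m * E)"] less mE by (auto simp: field_simps)
  define \<gamma> where "\<gamma> = m * (1 - 1 / real (Suc N)) * E - real nL"
  have "1 / real (Suc N) * (m * E) < m * E - real nL"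
    using N mE by (simp add: pos_less_divide_eq)
  then have \<gamma>: "\<gamma> > 0"
    by (simp add: \<gamma>_def algebra_simps)
  obtain k0 where k0: "\<And>k. k \<ge> k0 \<Longrightarrow> admits_system r P k (real k * m * (1 - 1 / real (Suc N)))"
    using sys[of N] by blast
  \<comment> \<open>The terms independent of k: the constant of the growth estimate, and the orders
    below \<open>e j\<close> left out at each point, which cost the square of
    \<open>e j\<close>.\<close>
  define R where "R = real K1 + (\<Sum>j=1..r. real (e j) * real (e j))"
  obtain k1 :: nat where k1: "R / \<gamma> < real k1"
    using reals_Archimedean2 by blast
  define k where "k = max k1 (max k0 K0)"
  have "k0 \<le> k" "K0 \<le> k"
    by (simp_all add: k_def)
  from k0[OF this(1)] obtain mk D where D: "finite D" "D \<subseteq> exponent_triangle k"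
      "system_dim r D mk (\<lambda>i. (P i $ 2, P i $ 3)) = expected_dim r D mk"
      "0 \<le> system_dim r D mk (\<lambda>i. (P i $ 2, P i $ 3))"
      "\<And>i. i \<in> {1..r} \<Longrightarrow> real k * m * (1 - 1 / real (Suc N)) \<le> real (mk i)"
    unfolding admits_system_def by blast
  obtain B where B: "finite B" "card B \<le> K1 + k * nL" "homogeneous k \<subseteq> cfun.span (B \<union> cone_ideal C)"
    using K \<open>K0 \<le> k\<close> by blast
  have "(\<Sum>j=1..r. (mk j - e j) * e j) \<le> card B"
    unfolding e_def by (rule conditions_bound[OF C neq P1 B(1,3) D(1-4)])
  then have "(\<Sum>j=1..r. (mk j - e j) * e j) \<le> K1 + k * nL"
    using B(2) by simp
  then have "real (\<Sum>j=1..r. (mk j - e j) * e j) \<le> real (K1 + k * nL)"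
    by (rule of_nat_mono)
  \<comment> \<open>Truncated subtraction is never smaller than the real difference, so the estimate
    holds even if \<open>mk j < e j\<close>.\<close>
  moreover have "(\<Sum>j=1..r. (real k * m * (1 - 1 / real (Suc N)) - real (e j)) * real (e j)) \<le> real (\<Sum>j=1..r. (mk j - e j) * e j)"
    unfolding of_nat_sum of_nat_mult
  proof (intro sum_mono mult_right_mono)
    fix j assume "j \<in> {1..r}"
    then show "real k * m * (1 - 1 / real (Suc N)) - real (e j) \<le> real (mk j - e j)"
      using D(5)[of j] by (simp add: of_nat_diff_real)
  qed auto
  ultimately have "(\<Sum>j=1..r. (real k * m * (1 - 1 / real (Suc N)) - real (e j)) * real (e j)) \<le> real K1 + real k * real nL"
    by simp
  also have "(\<Sum>j=1..r. (real k * m * (1 - 1 / real (Suc N)) - real (e j)) * real (e j)) =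
      real k * m * (1 - 1 / real (Suc N)) * E - (\<Sum>j=1..r. real (e j) * real (e j))"
    by (simp only: left_diff_distrib sum_subtractf E_def sum_distrib_left)
  finally have "real k * \<gamma> \<le> R"
    by (simp add: \<gamma>_def R_def algebra_simps)
  moreover have "R < real k * \<gamma>"
  proof -
    have "R < real k1 * \<gamma>"
      using k1 \<gamma> by (simp add: pos_divide_less_eq)
    also have "\<dots> \<le> real k * \<gamma>"
      using \<gamma> by (intro mult_right_mono) (auto simp: k_def)
    finally show ?thesis .
  qed
  ultimately show False
    by simp
qed

lemma nef_of_systems:
  assumes P1: "\<And>j. j \<in> {1..r} \<Longrightarrow> P j $ 1 = 1" and m: "m > 0"
    and sys: "\<And>N::nat. \<exists>k0. \<forall>k\<ge>k0. admits_system r P k (real k * m * (1 - 1 / real (Suc N)))"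
  shows "nef r p (\<lambda>i. H_div i - m * (\<Sum>j=1..r. E_div j i))"
  unfolding nef_def
proof (intro allI impI, elim conjE)
  fix C assume C: "C \<subseteq> blowup r p" "irreducible_curve {0..r} C"
  let ?D = "\<lambda>i. H_div i - m * (\<Sum>j=1..r. E_div j i)"
  have "?D 0 = 1"
    by (simp add: H_div_def E_div_def)
  moreover have "?D j = - m" if "j \<in> {1..r}" for j
    using that by (simp add: H_div_def E_div_def)
  ultimately have dot: "divisor_dot r p ?D C = of_int (line_dot r p C) - m * (\<Sum>j=1..r. of_int (exceptional_dot r p j C))"
    by (simp add: divisor_dot_def sum_distrib_left sum_negf)
  show "0 \<le> divisor_dot r p ?D C"
  proof (cases "\<exists>j\<in>{1..r}. C = exceptional_curve r p j")
    case True
    then obtain j where j: "j \<in> {1..r}" "C = exceptional_curve r p j"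
      by blast
    have "(\<Sum>i=1..r. real_of_int (exceptional_dot r p i C)) \<le> 0"
      using exceptional_dot_exceptional[OF _ j(1)] unfolding j(2) by (intro sum_nonpos) simp
    then have "m * (\<Sum>i=1..r. real_of_int (exceptional_dot r p i C)) \<le> 0"
      using m by (simp add: mult_nonneg_nonpos)
    moreover have "line_dot r p C = 0"
      unfolding j(2) by (rule line_dot_exceptional[OF j(1)])
    ultimately show ?thesis
      unfolding dot by simp
  next
    case False
    then have "exceptional_dot r p j C = int (curve_int r p (exceptional_curve r p j) C)" if "j \<in> {1..r}" for j
      using that by (auto simp: exceptional_dot_def)
    then have "(\<Sum>j=1..r. real_of_int (exceptional_dot r p j C)) =
        (\<Sum>j=1..r. real (curve_int r p (exceptional_curve r p j) C))"
      by simp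
    then show ?thesis
      unfolding dot using exceptional_sum_le_line_dot[OF C(2,1) _ P1 m sys] False by auto
  qed
qed

end

subsection \<open>From general to very general points\<close>

definition affine_coords :: "coords \<Rightarrow> nat \<Rightarrow> complex \<times> complex" where
  "affine_coords v i = (v i $ 2 / v i $ 1, v i $ 3 / v i $ 1)"

text \<open>The same degree N is used at every point, so that a power of the product of all first
  coordinates clears the denominators; products of this kind also equalise the degrees in a
  sum.\<close>

lemma polys_homogenize:
  assumes "F \<in> polys ({\<lambda>p. fst (p i) | i. i \<in> {1..r}} \<union> {\<lambda>p. snd (p i) | i. i \<in> {1..r}})"
  shows "\<exists>N. \<exists>G\<in>forms {1..r} (\<lambda>_. N). \<forall>v. (\<forall>i\<in>{1..r}. v i $ 1 \<noteq> 0) \<longrightarrow>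
    G v = (\<Prod>i\<in>{1..r}. v i $ 1) ^ N * F (affine_coords v)"
  using assms
proof induction
  case (const c)
  show ?case
    using forms_cmult[OF forms_1, of c] by (intro exI[of _ 0] bexI[of _ "\<lambda>v. c"]) auto
next
  case (coord f)
  then obtain i and k :: 3 where i: "i \<in> {1..r}"
    and f: "\<And>v. f (affine_coords v) = v i $ k / v i $ 1"
    by (fastforce simp: affine_coords_def)
  define G where "G v = v i $ k * (\<Prod>j\<in>{1..r} - {i}. v j $ 1)" for v :: coords
  have "G \<in> forms {1..r} (\<lambda>l. (if l = i then 1 else 0) + (\<Sum>j\<in>{1..r} - {i}. if l = j then 1 else 0))"
    unfolding G_def[abs_def] using i by (intro forms_mult forms_prod forms_nth) auto
  also have "\<dots> = forms {1..r} (\<lambda>_. 1)"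
    by (rule forms_degree_cong) auto
  finally have "G \<in> forms {1..r} (\<lambda>_. 1)" .
  moreover have "G v = (\<Prod>i\<in>{1..r}. v i $ 1) ^ 1 * f (affine_coords v)"
    if "\<forall>i\<in>{1..r}. v i $ 1 \<noteq> 0" for v
  proof -
    have "(\<Prod>j\<in>{1..r}. v j $ 1) = v i $ 1 * (\<Prod>j\<in>{1..r} - {i}. v j $ 1)"
      by (rule prod.remove) (use i in auto)
    then show ?thesis
      using i that unfolding f G_def by simp
  qed
  ultimately show ?case
    by blast
next
  case (add f g)
  then obtain N N' G G' where G: "G \<in> forms {1..r} (\<lambda>_. N)" "G' \<in> forms {1..r} (\<lambda>_. N')"
    "\<And>v. (\<forall>i\<in>{1..r}. v i $ 1 \<noteq> 0) \<Longrightarrow> G v = (\<Prod>i\<in>{1..r}. v i $ 1) ^ N * f (affine_coords v)"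
    "\<And>v. (\<forall>i\<in>{1..r}. v i $ 1 \<noteq> 0) \<Longrightarrow> G' v = (\<Prod>i\<in>{1..r}. v i $ 1) ^ N' * g (affine_coords v)"
    by blast
  define Q where "Q v = (\<Prod>i\<in>{1..r}. v i $ 1)" for v :: coords
  have "Q \<in> forms {1..r} (\<lambda>l. \<Sum>i\<in>{1..r}. if l = i then 1 else 0)"
    unfolding Q_def[abs_def] by (intro forms_prod forms_nth) auto
  also have "\<dots> = forms {1..r} (\<lambda>_. 1)"
    by (rule forms_degree_cong) auto
  finally have Q: "(\<lambda>v. Q v ^ n) \<in> forms {1..r} (\<lambda>_. n)" for n
    using forms_power[of Q "{1..r}" "\<lambda>_. 1" n] by simp
  have mem: "(\<lambda>v. G v * Q v ^ N' + Q v ^ N * G' v) \<in> forms {1..r} (\<lambda>_. N + N')"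
    using forms_add[OF forms_mult[OF G(1) Q] forms_mult[OF Q G(2)]] .
  have eq: "G v * Q v ^ N' + Q v ^ N * G' v = (\<Prod>i\<in>{1..r}. v i $ 1) ^ (N + N') *
      (f (affine_coords v) + g (affine_coords v))"
    if "\<forall>i\<in>{1..r}. v i $ 1 \<noteq> 0" for v
    unfolding G(3)[OF that] G(4)[OF that] Q_def power_add distrib_left by (simp only: mult_ac)
  show ?case
    by (intro exI[of _ "N + N'"] bexI[OF _ mem] allI impI) (rule eq)
next
  case (mult f g)
  then obtain N N' G G' where G: "G \<in> forms {1..r} (\<lambda>_. N)" "G' \<in> forms {1..r} (\<lambda>_. N')"
    "\<And>v. (\<forall>i\<in>{1..r}. v i $ 1 \<noteq> 0) \<Longrightarrow> G v = (\<Prod>i\<in>{1..r}. v i $ 1) ^ N * f (affine_coords v)"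
    "\<And>v. (\<forall>i\<in>{1..r}. v i $ 1 \<noteq> 0) \<Longrightarrow> G' v = (\<Prod>i\<in>{1..r}. v i $ 1) ^ N' * g (affine_coords v)"
    by blast
  have mem: "(\<lambda>v. G v * G' v) \<in> forms {1..r} (\<lambda>_. N + N')"
    using forms_mult[OF G(1,2)] .
  have eq: "G v * G' v = (\<Prod>i\<in>{1..r}. v i $ 1) ^ (N + N') *
      (f (affine_coords v) * g (affine_coords v))"
    if "\<forall>i\<in>{1..r}. v i $ 1 \<noteq> 0" for v
    unfolding G(3)[OF that] G(4)[OF that] power_add by (simp only: mult_ac)
  show ?case
    by (intro exI[of _ "N + N'"] bexI[OF _ mem] allI impI) (rule eq)
qed

text \<open>The closed set also contains the tuples with a point on the line at infinity.\<close>

lemma general_points_closed_set: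
  assumes "general_points r Q"
  shows "\<exists>Z. zariski_closed {1..r} Z \<and> Z \<subset> P2s {1..r} \<and>
    (\<forall>w. pt {1..r} w \<in> P2s {1..r} - Z \<longrightarrow> (\<forall>i\<in>{1..r}. w i $ 1 \<noteq> 0) \<and> Q (affine_coords w))"
proof -
  obtain F p0 where F: "F \<in> polys ({\<lambda>p. fst (p i) | i. i \<in> {1..r}} \<union> {\<lambda>p. snd (p i) | i. i \<in> {1..r}})"
    "F p0 \<noteq> 0" "\<And>p. F p \<noteq> 0 \<Longrightarrow> Q p"
    using assms unfolding general_points_def by blast
  obtain N G where G: "G \<in> forms {1..r} (\<lambda>_. N)"
    "\<And>v. (\<forall>i\<in>{1..r}. v i $ 1 \<noteq> 0) \<Longrightarrow> G v = (\<Prod>i\<in>{1..r}. v i $ 1) ^ N * F (affine_coords v)"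
    using polys_homogenize[OF F(1)] by blast
  define H where "H v = G v * (\<Prod>i\<in>{1..r}. v i $ 1)" for v
  have H: "H \<in> forms {1..r} (\<lambda>l. N + (\<Sum>i\<in>{1..r}. if l = i then 1 else 0))"
    unfolding H_def[abs_def] by (intro forms_mult G(1) forms_prod forms_nth) auto
  let ?Z = "{q \<in> P2s {1..r}. vanishes_at {1..r} H q}"
  define v0 :: coords where "v0 i = vector [1, fst (p0 i), snd (p0 i)]" for i
  have v0: "v0 i $ 1 = 1" "v0 i $ 2 = fst (p0 i)" "v0 i $ 3 = snd (p0 i)" for i
    by (simp_all add: v0_def)
  have "v0 i \<noteq> 0" for i
    using v0(1)[of i] by auto
  then have "pt {1..r} v0 \<in> P2s {1..r}"
    by (intro pt_in_P2s)
  moreover have "H v0 \<noteq> 0"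
    using G(2)[of v0] F(2) by (simp add: H_def v0 affine_coords_def[abs_def])
  ultimately have "?Z \<subset> P2s {1..r}"
    using vanishes_at_pt[OF H, of v0] by blast
  moreover have "(\<forall>i\<in>{1..r}. w i $ 1 \<noteq> 0) \<and> Q (affine_coords w)" if "pt {1..r} w \<in> P2s {1..r} - ?Z" for w
  proof -
    have "H w \<noteq> 0"
      using that vanishes_at_pt[OF H, of w] by blast
    then show ?thesis
      using G(2)[of w] F(3) by (auto simp: H_def)
  qed
  ultimately show ?thesis
    using zariski_closed_vanishing[OF H] by blast
qed

text \<open>Distinct first affine coordinates force distinct points, and they are the nonvanishing
  of a single product, which is nonzero at the points (i, 0).\<close>

lemma general_points_distinct:
  "general_points r (\<lambda>p. \<forall>i\<in>{1..r}. \<forall>j\<in>{1..r}. i \<noteq> j \<longrightarrow> fst (p i) \<noteq> fst (p j))"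
proof -
  define S where "S = {(i, j). i \<in> {1..r} \<and> j \<in> {1..r} \<and> i \<noteq> j}"
  have S: "finite S"
    by (rule finite_subset[of _ "{1..r} \<times> {1..r}"]) (auto simp: S_def)
  define F where "F p = (\<Prod>x\<in>S. fst (p (fst x)) + (- 1) * fst (p (snd x)))" for p :: "nat \<Rightarrow> complex \<times> complex"
  have "F \<in> polys ({\<lambda>p. fst (p i) | i. i \<in> {1..r}} \<union> {\<lambda>p. snd (p i) | i. i \<in> {1..r}})"
    unfolding F_def[abs_def] by (intro polys_prod polys.add polys.mult polys.const polys.coord) (auto simp: S_def)
  moreover have "F (\<lambda>i. (of_nat i, 0)) \<noteq> 0"
    using S by (auto simp: F_def S_def)
  moreover have "fst (p i) \<noteq> fst (p j)" if "F p \<noteq> 0" "i \<in> {1..r}" "j \<in> {1..r}" "i \<noteq> j" for p i j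
  proof -
    have "(i, j) \<in> S"
      using that by (simp add: S_def)
    then show ?thesis
      using that(1) S by (force simp: F_def)
  qed
  ultimately show ?thesis
    unfolding general_points_def by blast
qed

theorem proposition0p5:
  fixes r :: nat and m :: real
  assumes "r \<ge> 1"
    and "m > 0"
    and "contains_asymptotically ({(x, y). x + y \<le> 1} \<inter> {(x, y). 0 \<le> x \<and> 0 \<le> y}) r (\<lambda>_. m) 0"
  shows "very_general_points r
    (\<lambda>p. nef r p (\<lambda>i. H_div i - m * (\<Sum>j=1..r. E_div j i)))"
proof -
  let ?P = "{(x, y). x + y \<le> 1} \<inter> {(x, y). 0 \<le> x \<and> 0 \<le> y} :: (real \<times> real) set"
  \<comment> \<open>The tolerances are restricted to 1/(N+1), so that only countably many systems
    occur.\<close>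
  define sys where "sys N k mk D \<longleftrightarrow>
      finite D \<and> (\<lambda>(\<alpha>, \<beta>). (real \<alpha>, real \<beta>)) ` D \<subseteq> (\<lambda>x. real k *\<^sub>R x) ` ?P \<and>
      nonspecial_dim_ge r D mk 0 \<and> (\<forall>i\<in>{1..r}. \<bar>(real (mk i) - real k * m) / (real k * m)\<bar> < 1 / real (Suc N))"
    for N k mk D
  have "\<exists>k0. \<forall>k\<ge>k0. \<exists>mk D. sys N k mk D" for N
    using assms(3) unfolding contains_asymptotically_def sys_def by simp
  then obtain k0 mk D where sys: "\<And>N k. k \<ge> k0 N \<Longrightarrow> sys N k (mk N k) (D N k)"
    by metis
  note sys = sys[unfolded sys_def]
  define good where "good N k p \<longleftrightarrow>
      system_dim r (D N k) (mk N k) p = expected_dim r (D N k) (mk N k) \<and> 0 \<le> system_dim r (D N k) (mk N k) p"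
    for N k p
  define avoids where "avoids Q Z \<longleftrightarrow> zariski_closed {1..r} Z \<and> Z \<subset> P2s {1..r} \<and>
      (\<forall>w. pt {1..r} w \<in> P2s {1..r} - Z \<longrightarrow> (\<forall>i\<in>{1..r}. w i $ 1 \<noteq> 0) \<and> Q (affine_coords w))" for Q Z
  have "\<exists>Z. avoids (good N k) Z" if "k \<ge> k0 N" for N k
    unfolding avoids_def using sys[OF that]
    by (intro general_points_closed_set) (simp add: nonspecial_dim_ge_def good_def[abs_def])
  then obtain Z where Z: "\<And>N k. k \<ge> k0 N \<Longrightarrow> avoids (good N k) (Z N k)"
    by metis
  obtain Z0 where Z0: "avoids (\<lambda>p. \<forall>i\<in>{1..r}. \<forall>j\<in>{1..r}. i \<noteq> j \<longrightarrow> fst (p i) \<noteq> fst (p j)) Z0"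
    using general_points_closed_set[OF general_points_distinct[of r]] unfolding avoids_def by blast
  \<comment> \<open>One closed set for each pair of a tolerance and a large enough k, and one more
    that keeps the points distinct.\<close>
  define \<Z> where "\<Z> = insert Z0 ((\<lambda>(N, k). Z N k) ` {(N, k). k \<ge> k0 N})"
  show ?thesis
    unfolding very_general_points_def
  proof (intro exI[of _ \<Z>] conjI ballI)
    show "countable \<Z>"
      unfolding \<Z>_def by (intro countable_insert countable_image) auto
    have "\<exists>Q. avoids Q A" if "A \<in> \<Z>" for A
      using that Z Z0 unfolding \<Z>_def by auto
    then show "zariski_closed {1..r} A" "A \<subset> P2s {1..r}" if "A \<in> \<Z>" for A
      using that unfolding avoids_def by blast+
  next
    fix q assume q: "q \<in> P2s {1..r} - \<Union>\<Z>"
    then have "q \<in> P2s {1..r}"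
      by blast
    then obtain w where w: "\<And>i. i \<in> {1..r} \<Longrightarrow> w i \<noteq> 0" "q = pt {1..r} w"
      by (rule P2s_rep) blast
    have "q \<in> P2s {1..r} - Z0"
      using q by (auto simp: \<Z>_def)
    then have w1: "\<And>i. i \<in> {1..r} \<Longrightarrow> w i $ 1 \<noteq> 0"
      and distinct: "\<And>i j. i \<in> {1..r} \<Longrightarrow> j \<in> {1..r} \<Longrightarrow> i \<noteq> j \<Longrightarrow> w i $ 2 / w i $ 1 \<noteq> w j $ 2 / w j $ 1"
      using Z0 unfolding avoids_def w(2) affine_coords_def by auto
    \<comment> \<open>The closed sets contain all tuples with a point at infinity, so the first
      coordinate can be scaled to 1.\<close>
    define P where "P i = (1 / w i $ 1) *s w i" for i
    interpret blown_up_points r q P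
    proof
      fix i assume i: "i \<in> {1..r}"
      have "1 / w i $ 1 \<noteq> 0"
        using w1[OF i] by simp
      from span_singleton_scale[OF this] show "q i = vec.span {P i}"
        using i by (simp add: w(2) pt_nth P_def)
      show "P i \<noteq> 0"
        unfolding P_def vec.scale_eq_0_iff using w(1)[OF i] w1[OF i] by simp
    next
      fix i j assume ij: "i \<in> {1..r}" "j \<in> {1..r}" "i \<noteq> j"
      have "crs (P i) (P j) $ 3 = w j $ 2 / w j $ 1 - w i $ 2 / w i $ 1"
        using w1[OF ij(1)] w1[OF ij(2)] by (simp add: P_def crs_nth)
      then show "crs (P i) (P j) \<noteq> 0"
        using distinct[OF ij] by auto
    qed
    show "nef r q (\<lambda>i. H_div i - m * (\<Sum>j=1..r. E_div j i))"
    proof (rule nef_of_systems)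
      show "P j $ 1 = 1" if "j \<in> {1..r}" for j
        using w1[OF that] by (simp add: P_def)
      fix N :: nat
      \<comment> \<open>The maximum with 1 makes k positive, as needed to clear the denominator k
        m.\<close>
      have "finite (D N k) \<and> D N k \<subseteq> exponent_triangle k \<and>
          system_dim r (D N k) (mk N k) (\<lambda>i. (P i $ 2, P i $ 3)) = expected_dim r (D N k) (mk N k) \<and>
          0 \<le> system_dim r (D N k) (mk N k) (\<lambda>i. (P i $ 2, P i $ 3)) \<and>
          (\<forall>i\<in>{1..r}. real k * m * (1 - 1 / real (Suc N)) \<le> real (mk N k i))" if k: "k \<ge> max 1 (k0 N)" for k
      proof (intro conjI ballI)
        have k': "k \<ge> k0 N" "k > 0"
          using k by auto
        show "finite (D N k)"
          using sys[OF k'(1)] by blast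
        show "D N k \<subseteq> exponent_triangle k"
        proof
          fix z assume z: "z \<in> D N k"
          obtain \<alpha> \<beta> where z_eq: "z = (\<alpha>, \<beta>)"
            by (cases z)
          have "(real \<alpha>, real \<beta>) \<in> (\<lambda>x. real k *\<^sub>R x) ` ?P"
            using sys[OF k'(1)] z unfolding z_eq by blast
          then obtain x where "x \<in> ?P" "(real \<alpha>, real \<beta>) = real k *\<^sub>R x"
            by blast
          then have "real \<alpha> = real k * fst x" "real \<beta> = real k * snd x" "fst x + snd x \<le> 1"
            by (auto simp: scaleR_prod_def)
          then have "real \<alpha> + real \<beta> \<le> real k * 1"
            by (metis distrib_left mult_left_mono of_nat_0_le_iff)
          then show "z \<in> exponent_triangle k"
            by (simp add: exponent_triangle_def z_eq)
        qed
        have "q \<in> P2s {1..r} - Z N k"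
          using q k'(1) by (auto simp: \<Z>_def)
        then have "good N k (affine_coords w)"
          using Z[OF k'(1)] unfolding avoids_def w(2) by blast
        then show "system_dim r (D N k) (mk N k) (\<lambda>i. (P i $ 2, P i $ 3)) = expected_dim r (D N k) (mk N k)"
          "0 \<le> system_dim r (D N k) (mk N k) (\<lambda>i. (P i $ 2, P i $ 3))"
          by (simp_all add: good_def P_def affine_coords_def[abs_def])
        fix i assume i: "i \<in> {1..r}"
        have pos: "real k * m > 0"
          using k'(2) assms(2) by simp
        have "\<bar>(real (mk N k i) - real k * m) / (real k * m)\<bar> < 1 / real (Suc N)"
          using sys[OF k'(1)] i by blast
        then have "- (1 / real (Suc N)) < (real (mk N k i) - real k * m) / (real k * m)"
          by (simp only: abs_less_iff minus_less_iff)
        then have "- (1 / real (Suc N)) * (real k * m) < real (mk N k i) - real k * m"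
          using pos by (simp only: pos_less_divide_eq)
        then show "real k * m * (1 - 1 / real (Suc N)) \<le> real (mk N k i)"
          by (simp add: algebra_simps)
      qed
      then show "\<exists>k0. \<forall>k\<ge>k0. admits_system r P k (real k * m * (1 - 1 / real (Suc N)))"
        unfolding admits_system_def by blast
    qed (rule assms(2))
  qed
qed

end
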